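(* The spectral problem of finding numbers $\lambda$ (eigenvalues) and nonzero functions $u$ (eigenfunctions) with $$u_{tt}(x,t)-\mathcal{L}_x u(x,t)=\lambda\, u(x,1-t),\quad (x,t)\in D,\qquad u(x,0)=u_t(x,0)=0,\quad x\in\Omega,$$ and $u(\cdot,t)\in\mathcal{D}(\mathcal{L}_x)$ for every $t\in(0,1)$, has a complete orthonormal system of eigenfunctions in $L_2(D)$ of the form $$u_{km}(x,t)=u_k(x)\,v_{km}(t),\qquad k,m\in\mathbb{N},$$ where $v_{km}$ are nonzero solutions of $$v_{km}''(t)-\mu_k v_{km}(t)=\lambda_{km}v_{km}(1-t),\quad 0<t<1,\qquad v_{km}(0)=v_{km}'(0)=0,$$ and $\lambda_{km}$ are the eigenvalues of the spectral problem. In addition, for large $k$ the smallest (in absolute value) eigenvalue $\lambda_{k1}$ among $\{\lambda_{km}\}_{m\in\mathbb{N}}$ has the asymptotic behavior $$\lambda_{k1}=4\mu_k e^{-\sqrt{\mu_k}}\,(1+o(1)),\qquad k\to\infty .$$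
   Context: $\Omega\subset\mathbb{R}^n$ is a bounded domain with smooth boundary and $D=\Omega\times(0,1)$, with points written $(x,t)$, $x\in\Omega$, $t\in(0,1)$. $\mathcal{L}_x$ is a self-adjoint unbounded operator in $L_2(\Omega)$, with domain $\mathcal{D}(\mathcal{L}_x)$, with compact resolvent and satisfying $(\mathcal{L}_x u,u)\ge\|u\|^2$ for $u\in\mathcal{D}(\mathcal{L}_x)$. $\mu_k$, $k\in\mathbb{N}$, are all the eigenvalues of $\mathcal{L}_x$, counted with multiplicity and numbered in nondecreasing order, and $u_k(x)$, $k\in\mathbb{N}$, is a complete orthonormal system in $L_2(\Omega)$ of corresponding eigenfunctions, $\mathcal{L}_x u_k=\mu_k u_k$. For each fixed $k$ the eigenvalues $\lambda_{km}$, $m\in\mathbb{N}$, are numbered so that $\lambda_{k1}$ has the smallest absolute value. *)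

theory Defs
  imports "HOL-Analysis.Analysis"
begin

section \<open>Smoothly bounded domains\<close>

text \<open>Only used on open sets \<open>U\<close>.\<close>

primrec C_times :: "nat \<Rightarrow> (real ^ 'n \<Rightarrow> real) \<Rightarrow> (real ^ 'n) set \<Rightarrow> bool" where
  "C_times 0 f U \<longleftrightarrow> continuous_on U f"
| "C_times (Suc k) f U \<longleftrightarrow>
     (\<exists>g :: 'n \<Rightarrow> real ^ 'n \<Rightarrow> real.
        (\<forall>x\<in>U. (f has_derivative (\<lambda>h. \<Sum>i\<in>UNIV. g i x * (h $ i))) (at x)) \<and>
        (\<forall>i. C_times k (g i) U))"

definition C_infinity :: "(real ^ 'n \<Rightarrow> real) \<Rightarrow> (real ^ 'n) set \<Rightarrow> bool" where
  "C_infinity f U \<longleftrightarrow> (\<forall>k. C_times k f U)"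

text \<open>Near each boundary point, \<open>\<Omega>\<close> lies on one side of a regular level set of a smooth
  local defining function; the last conjunct says that the gradient does not vanish there.\<close>

definition smooth_boundary :: "(real ^ 'n) set \<Rightarrow> bool" where
  "smooth_boundary \<Omega> \<longleftrightarrow>
     (\<forall>p\<in>frontier \<Omega>. \<exists>U \<rho>. open U \<and> p \<in> U \<and> C_infinity \<rho> U \<and>
        \<Omega> \<inter> U = {x\<in>U. \<rho> x < 0} \<and> \<not> (\<rho> has_derivative (\<lambda>_. 0)) (at p))"

definition smooth_bounded_domain :: "(real ^ 'n) set \<Rightarrow> bool" where
  "smooth_bounded_domain \<Omega> \<longleftrightarrow>
     \<Omega> \<noteq> {} \<and> open \<Omega> \<and> connected \<Omega> \<and> bounded \<Omega> \<and> smooth_boundary \<Omega>"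

section \<open>The Hilbert space of square integrable functions\<close>

text \<open>Elements of $L_2$ are represented by functions; two representatives are identified when
  they agree almost everywhere. Every class has a Borel representative, so the Borel-measurable
  \<open>lborel\<close> suffices.\<close>

abbreviation leb :: "'a::euclidean_space set \<Rightarrow> 'a measure" where
  "leb S \<equiv> restrict_space lborel S"

definition L2 :: "'a measure \<Rightarrow> ('a \<Rightarrow> complex) set" where
  "L2 M = {f \<in> borel_measurable M. integrable M (\<lambda>x. (cmod (f x))\<^sup>2)}"

definition l2inner :: "'a measure \<Rightarrow> ('a \<Rightarrow> complex) \<Rightarrow> ('a \<Rightarrow> complex) \<Rightarrow> complex" where
  "l2inner M f g = (LINT x|M. f x * cnj (g x))"

text \<open>Meaningful only for members of \<open>L2 M\<close> (the Bochner integral is \<open>0\<close> when undefined).\<close>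

definition l2norm :: "'a measure \<Rightarrow> ('a \<Rightarrow> complex) \<Rightarrow> real" where
  "l2norm M f = sqrt (LINT x|M. (cmod (f x))\<^sup>2)"

definition complete_orthonormal_system :: "'a measure \<Rightarrow> ('i \<Rightarrow> 'a \<Rightarrow> complex) \<Rightarrow> bool" where
  "complete_orthonormal_system M \<phi> \<longleftrightarrow>
     (\<forall>i. \<phi> i \<in> L2 M) \<and>
     (\<forall>i j. l2inner M (\<phi> i) (\<phi> j) = (if i = j then 1 else 0)) \<and>
     (\<forall>f\<in>L2 M. \<forall>\<epsilon>>0. \<exists>F c. finite F \<and> l2norm M (\<lambda>x. f x - (\<Sum>i\<in>F. c i * \<phi> i x)) < \<epsilon>)"

section \<open>Unbounded operators\<close>

text \<open>An operator is given by its domain \<open>D\<close>, a set of representatives closed under a.e.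
  equality, and a map \<open>A\<close> whose values matter only on \<open>D\<close> and only up to a.e. equality.\<close>

definition linear_operator ::
  "'a measure \<Rightarrow> ('a \<Rightarrow> complex) set \<Rightarrow> (('a \<Rightarrow> complex) \<Rightarrow> 'a \<Rightarrow> complex) \<Rightarrow> bool" where
  "linear_operator M D A \<longleftrightarrow>
     D \<subseteq> L2 M \<and> (\<lambda>_. 0) \<in> D \<and> (\<forall>f\<in>D. A f \<in> L2 M) \<and>
     (\<forall>f\<in>D. \<forall>g\<in>D. \<forall>a b. (\<lambda>x. a * f x + b * g x) \<in> D \<and>
        (AE x in M. A (\<lambda>x. a * f x + b * g x) x = a * A f x + b * A g x)) \<and>
     (\<forall>f\<in>D. \<forall>g\<in>L2 M. (AE x in M. f x = g x) \<longrightarrow>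
        g \<in> D \<and> (AE x in M. A f x = A g x))"

text \<open>The last conjunct says that the graph of the adjoint equals the graph of \<open>A\<close>.\<close>

definition self_adjoint ::
  "'a measure \<Rightarrow> ('a \<Rightarrow> complex) set \<Rightarrow> (('a \<Rightarrow> complex) \<Rightarrow> 'a \<Rightarrow> complex) \<Rightarrow> bool" where
  "self_adjoint M D A \<longleftrightarrow>
     linear_operator M D A \<and>
     (\<forall>f\<in>L2 M. \<forall>\<epsilon>>0. \<exists>g\<in>D. l2norm M (\<lambda>x. f x - g x) < \<epsilon>) \<and>
     (\<forall>g\<in>L2 M. \<forall>h\<in>L2 M.
        (\<forall>f\<in>D. l2inner M (A f) g = l2inner M f h) \<longleftrightarrow>
        (g \<in> D \<and> (AE x in M. A g x = h x)))"

text \<open>\<open>A - \<zeta>\<close> is a bijection of \<open>D\<close> onto $L_2$ with bounded inverse; injectivity is part of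
  the bound.\<close>

definition in_resolvent_set ::
  "'a measure \<Rightarrow> ('a \<Rightarrow> complex) set \<Rightarrow> (('a \<Rightarrow> complex) \<Rightarrow> 'a \<Rightarrow> complex) \<Rightarrow> complex \<Rightarrow> bool" where
  "in_resolvent_set M D A \<zeta> \<longleftrightarrow>
     (\<forall>f\<in>L2 M. \<exists>u\<in>D. AE x in M. A u x - \<zeta> * u x = f x) \<and>
     (\<exists>C. \<forall>u\<in>D. l2norm M u \<le> C * l2norm M (\<lambda>x. A u x - \<zeta> * u x))"

text \<open>Writing \<open>f j = (A - \<zeta>) (u j)\<close>: the resolvent maps each bounded sequence \<open>f\<close> to a
  sequence \<open>u\<close> with a convergent subsequence.\<close>

definition compact_resolvent ::
  "'a measure \<Rightarrow> ('a \<Rightarrow> complex) set \<Rightarrow> (('a \<Rightarrow> complex) \<Rightarrow> 'a \<Rightarrow> complex) \<Rightarrow> bool" where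
  "compact_resolvent M D A \<longleftrightarrow>
     (\<exists>\<zeta>. in_resolvent_set M D A \<zeta> \<and>
        (\<forall>u :: nat \<Rightarrow> 'a \<Rightarrow> complex.
           (\<forall>j. u j \<in> D) \<and> (\<exists>C. \<forall>j. l2norm M (\<lambda>x. A (u j) x - \<zeta> * u j x) \<le> C) \<longrightarrow>
           (\<exists>r g. strict_mono r \<and> g \<in> L2 M \<and>
              (\<lambda>j. l2norm M (\<lambda>x. u (r j) x - g x)) \<longlonglongrightarrow> 0)))"

text \<open>\<open>\<phi> k\<close> are eigenfunctions for \<open>\<mu> k\<close>, and for every \<open>\<nu>\<close> the whole eigenspace is spanned by
  those \<open>\<phi> k\<close> with \<open>\<mu> k = \<nu>\<close>. For an orthonormal \<open>\<phi>\<close> this makes \<open>\<mu>\<close> list all eigenvalues,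
  each one as often as its multiplicity.\<close>

definition lists_eigenvalues ::
  "'a measure \<Rightarrow> ('a \<Rightarrow> complex) set \<Rightarrow> (('a \<Rightarrow> complex) \<Rightarrow> 'a \<Rightarrow> complex) \<Rightarrow>
   (nat \<Rightarrow> real) \<Rightarrow> (nat \<Rightarrow> 'a \<Rightarrow> complex) \<Rightarrow> bool" where
  "lists_eigenvalues M D A \<mu> \<phi> \<longleftrightarrow>
     (\<forall>k. \<phi> k \<in> D \<and> (AE x in M. A (\<phi> k) x = of_real (\<mu> k) * \<phi> k x)) \<and>
     (\<forall>\<nu> :: complex. \<forall>f\<in>D. (AE x in M. A f x = \<nu> * f x) \<longrightarrow>
        (\<exists>F c. finite F \<and> F \<subseteq> {k. of_real (\<mu> k) = \<nu>} \<and>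
           (AE x in M. f x = (\<Sum>k\<in>F. c k * \<phi> k x))))"

section \<open>The two spectral problems\<close>

definition has_l2_derivative ::
  "'a measure \<Rightarrow> (real \<Rightarrow> 'a \<Rightarrow> complex) \<Rightarrow> ('a \<Rightarrow> complex) \<Rightarrow> real \<Rightarrow> real set \<Rightarrow> bool" where
  "has_l2_derivative M U w t S \<longleftrightarrow>
     (\<forall>s\<in>S. U s \<in> L2 M) \<and> w \<in> L2 M \<and>
     ((\<lambda>s. l2norm M (\<lambda>x. (U s x - U t x) / of_real (s - t) - w x)) \<longlongrightarrow> 0) (at t within S)"

text \<open>The operator acts in $L_2(\Omega)$, so the equation is one between $L_2(\Omega)$-valued
  functions of \<open>t\<close>. Here \<open>w\<close> and \<open>z\<close> are the first and second \<open>t\<close>-derivatives, the former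
  one-sided at \<open>t = 0\<close>.\<close>

definition eigenfunction ::
  "(real ^ 'n) set \<Rightarrow> (real ^ 'n \<Rightarrow> complex) set \<Rightarrow>
   ((real ^ 'n \<Rightarrow> complex) \<Rightarrow> real ^ 'n \<Rightarrow> complex) \<Rightarrow>
   complex \<Rightarrow> ((real ^ 'n) \<times> real \<Rightarrow> complex) \<Rightarrow> bool" where
  "eigenfunction \<Omega> D A \<kappa> u \<longleftrightarrow>
     u \<in> L2 (leb (\<Omega> \<times> {0<..<1})) \<and>
     \<not> (AE p in leb (\<Omega> \<times> {0<..<1}). u p = 0) \<and>
     (\<exists>w z.
        (\<forall>t\<in>{0..<1}. has_l2_derivative (leb \<Omega>) (\<lambda>s x. u (x, s)) (w t) t {0..<1}) \<and>
        (\<forall>t\<in>{0<..<1}. has_l2_derivative (leb \<Omega>) w (z t) t {0<..<1}) \<and>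
        (\<forall>t\<in>{0<..<1}. (\<lambda>x. u (x, t)) \<in> D \<and>
           (AE x in leb \<Omega>. z t x - A (\<lambda>x. u (x, t)) x = \<kappa> * u (x, 1 - t))) \<and>
        (AE x in leb \<Omega>. u (x, 0) = 0) \<and>
        (AE x in leb \<Omega>. w 0 x = 0))"

definition nonzero_ode_solution :: "real \<Rightarrow> complex \<Rightarrow> (real \<Rightarrow> complex) \<Rightarrow> bool" where
  "nonzero_ode_solution \<mu> \<kappa> v \<longleftrightarrow>
     (\<exists>t\<in>{0<..<1}. v t \<noteq> 0) \<and>
     (\<exists>v' v''.
        (\<forall>t\<in>{0..<1}. (v has_vector_derivative v' t) (at t within {0..<1})) \<and>
        (\<forall>t\<in>{0<..<1}. (v' has_vector_derivative v'' t) (at t)) \<and>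
        (\<forall>t\<in>{0<..<1}. v'' t - of_real \<mu> * v t = \<kappa> * v (1 - t)) \<and>
        v 0 = 0 \<and> v' 0 = 0)"

end

theory Submission
  imports Defs "HOL-Complex_Analysis.Great_Picard"
begin

text \<open>
  Fix \<open>k\<close> and write \<open>\<mu> k = s\<^sup>2\<close>. Because the initial data at \<open>t = 0\<close> vanish, variation of
  constants turns \<open>v'' - \<mu> v = \<kappa> v(1 - t)\<close> into \<open>v = \<kappa> T v\<close>, where \<open>T\<close> is a Volterra operator
  composed with the reflection \<open>t \<mapsto> 1 - t\<close>. After the reflection its kernel is a function of
  \<open>t + r - 1\<close> alone, hence symmetric: a Volterra operator, which has no nonzero eigenvalues, has
  become a compact symmetric one. Applying the differential operator to \<open>T x\<close> gives back
  \<open>x(1 - t)\<close>, so \<open>T\<close> is injective, and its range contains every polynomial with a double zero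
  at \<open>0\<close>, so the range is dense. By the Hilbert--Schmidt argument (\<open>eigenbasis_exists\<close>) the
  eigenvectors of \<open>T\<close> form a complete orthonormal system of \<open>L\<^sub>2(0,1)\<close>
  (\<open>eigenbasis_complete\<close>), and the numbers \<open>\<kappa>\<close> are the reciprocals of its eigenvalues.

  The argument takes place in the space of continuous functions with the \<open>L\<^sub>2\<close> inner product.
  That space is not complete, but \<open>T\<close> maps bounded sequences to sequences with uniformly
  convergent subsequences, and these are the only limits that the construction uses.

  For the problem in \<open>\<Omega> \<times> (0,1)\<close>, completeness of the products is Parseval's identity applied
  twice, once in \<open>x\<close> for almost every \<open>t\<close> and once in \<open>t\<close>
  (\<open>complete_orthonormal_system_product\<close>). There are no further eigenvalues: the coefficients
  \<open>(u(\<cdot>, t), \<phi> k)\<close> of an eigenfunction \<open>u\<close> solve the \<open>k\<close>-th ordinary problem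
  (\<open>eigenfunction_projection\<close>), one of them is not identically zero, and a nonzero solution of
  that problem exists only if \<open>\<kappa>\<close> is a reciprocal of an eigenvalue of \<open>T\<close>
  (\<open>ode_eigenvalue_cases\<close>).

  For the asymptotics, the kernel of \<open>T\<close> differs from \<open>exp (s (t + r - 1)) / (2 s)\<close> by at most
  \<open>1 / (2 s)\<close> on the whole square, and the latter kernel has rank one with eigenvalue
  \<open>(exp s - exp (- s)) / (4 s\<^sup>2)\<close>. This is exponentially larger than the error, so it
  determines the eigenvalue of \<open>T\<close> of largest modulus up to the factor \<open>1 + o(1)\<close>
  (\<open>top_eigenvalue_estimate\<close>). Finally \<open>\<mu> k \<longlonglongrightarrow> \<infinity>\<close> since the resolvent is compact.
\<close>

section \<open>Compact symmetric operators on inner product spaces\<close>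

text \<open>The expansion is required for vectors of the form \<open>T x\<close> only: without completeness of the
  space this is what compactness yields, and completeness of the system follows from it once the
  range of \<open>T\<close> is known to be dense. The eigenvalue of index \<open>0\<close> is one of largest modulus.\<close>
definition eigenbasis :: "('a::real_inner \<Rightarrow> 'a) \<Rightarrow> (nat \<Rightarrow> 'a) \<Rightarrow> (nat \<Rightarrow> real) \<Rightarrow> bool" where
  "eigenbasis T v \<rho> \<longleftrightarrow>
     (\<forall>i j. v i \<bullet> v j = (if i = j then 1 else 0)) \<and>
     (\<forall>n. T (v n) = \<rho> n *\<^sub>R v n \<and> \<rho> n \<noteq> 0) \<and>
     (\<forall>x. norm (T x) \<le> \<bar>\<rho> 0\<bar> * norm x) \<and>
     (\<forall>x. (\<lambda>n. \<Sum>i<n. (\<rho> i * (x \<bullet> v i)) *\<^sub>R v i) \<longlonglongrightarrow> T x)"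

text \<open>Eigenvectors will be obtained from limits of \<open>T (x (r n))\<close>; as the space need not be complete,
  total boundedness of the image of the unit ball would not provide such limits.\<close>
locale compact_symmetric =
  fixes T :: "'a::real_inner \<Rightarrow> 'a"
  assumes bounded_linear_T: "bounded_linear T"
    and symmetric_T: "T x \<bullet> y = x \<bullet> T y"
    and compact_T: "\<And>x::nat \<Rightarrow> 'a. (\<And>n. norm (x n) \<le> 1) \<Longrightarrow>
       \<exists>r l. strict_mono (r::nat \<Rightarrow> nat) \<and> (\<lambda>n. T (x (r n))) \<longlonglongrightarrow> l"
begin

interpretation T: bounded_linear T by (rule bounded_linear_T)

text \<open>Let \<open>N\<close> be the norm of \<open>T\<close> on \<open>S\<close> and \<open>w n\<close> unit vectors with \<open>norm (T (w n)) \<longlonglongrightarrow> N\<close>. Symmetry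
  gives \<open>T (T (w n)) - N\<^sup>2 w n \<longlonglongrightarrow> 0\<close>, so compactness makes a subsequence of \<open>w\<close> itself converge,
  to a unit vector \<open>x\<close> with \<open>(T - N) (T + N) x = 0\<close>. Either \<open>(T + N) x = 0\<close>, or \<open>(T + N) x\<close> is
  an eigenvector for \<open>N\<close>.\<close>
lemma extremal_eigenvector:
  assumes S: "subspace S" "closed S" "\<And>x. x \<in> S \<Longrightarrow> T x \<in> S"
    and ex: "x \<in> S" "T x \<noteq> 0"
  shows "\<exists>z\<in>S. \<exists>\<rho>. norm z = 1 \<and> T z = \<rho> *\<^sub>R z \<and> (\<forall>y\<in>S. norm (T y) \<le> \<bar>\<rho>\<bar> * norm y)"
proof -
  define B where "B = {norm (T x) | x. x \<in> S \<and> norm x = 1}"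
  define N where "N = Sup B"
  have unit: "y /\<^sub>R norm y \<in> S" "norm (y /\<^sub>R norm y) = 1" if "y \<in> S" "y \<noteq> 0" for y
    using that S(1) by (auto simp: subspace_scale)
  have "x \<noteq> 0" using ex by auto
  then have nonempty: "B \<noteq> {}" unfolding B_def using unit[OF ex(1)] by blast
  have bdd: "bdd_above B"
  proof (rule bdd_aboveI[of _ "onorm T"])
    fix b assume "b \<in> B"
    then obtain y where "b = norm (T y)" "norm y = 1" by (auto simp: B_def)
    then show "b \<le> onorm T" using onorm[OF bounded_linear_T, of y] by simp
  qed
  have N_upper1: "norm (T y) \<le> N" if "y \<in> S" "norm y = 1" for y
    unfolding N_def by (rule cSup_upper[OF _ bdd]) (use that in \<open>auto simp: B_def\<close>)
  have N_upper: "norm (T y) \<le> N * norm y" if "y \<in> S" for y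
  proof (cases "y = 0")
    case False
    then show ?thesis using N_upper1[OF unit[OF that False]] by (simp add: T.scaleR field_simps)
  qed (simp add: T.zero)
  have "norm (T x) > 0" using ex by simp
  then have Npos: "N > 0" using N_upper[OF ex(1)] \<open>x \<noteq> 0\<close>
    by (metis less_le_trans norm_ge_zero zero_less_mult_pos2 zero_less_norm_iff)
  have "\<exists>u. u \<in> S \<and> norm u = 1 \<and> N - inverse (of_nat (Suc n)) < norm (T u)" for n
  proof -
    have "\<exists>b\<in>B. N - inverse (of_nat (Suc n)) < b"
      by (rule less_cSupD[OF nonempty]) (simp flip: N_def)
    then show ?thesis unfolding B_def by auto
  qed
  then obtain u where u: "\<And>n. u n \<in> S" "\<And>n. norm (u n) = 1"
     "\<And>n. N - inverse (of_nat (Suc n)) < norm (T (u n))" by metis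
  have lim_norm: "(\<lambda>n. norm (T (u n))) \<longlonglongrightarrow> N"
  proof (rule tendsto_sandwich)
    show "(\<lambda>n. N - inverse (of_nat (Suc n))) \<longlonglongrightarrow> N"
      using tendsto_diff[OF tendsto_const LIMSEQ_inverse_real_of_nat] by force
    show "(\<lambda>n. N) \<longlonglongrightarrow> N" by simp
    show "\<forall>\<^sub>F n in sequentially. norm (T (u n)) \<le> N" using N_upper1 u by auto
    show "\<forall>\<^sub>F n in sequentially. N - inverse (real (Suc n)) \<le> norm (T (u n))" 
      by (intro always_eventually allI less_imp_le u(3))
  qed
  obtain r l where r: "strict_mono r" and l: "(\<lambda>n. T (u (r n))) \<longlonglongrightarrow> l"
    using compact_T[of u] u(2) by auto
  define w where "w n = u (r n)" for n
  have w: "w n \<in> S" "norm (w n) = 1" for n using u by (auto simp: w_def)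
  have lim_norm_w: "(\<lambda>n. norm (T (w n))) \<longlonglongrightarrow> N"
    using LIMSEQ_subseq_LIMSEQ[OF lim_norm r] by (simp add: w_def o_def)
  \<comment> \<open>Expand the square and use \<open>T (T w) \<bullet> w = (norm (T w))\<^sup>2\<close>.\<close>
  have residual: "(norm (T (T (w n)) - N\<^sup>2 *\<^sub>R w n))\<^sup>2 \<le> N\<^sup>2 * (N\<^sup>2 - (norm (T (w n)))\<^sup>2)" for n
  proof -
    have "norm (T (T (w n))) \<le> N * norm (T (w n))" using N_upper[OF S(3)[OF w(1)]] .
    then have "(norm (T (T (w n))))\<^sup>2 \<le> N\<^sup>2 * (norm (T (w n)))\<^sup>2"
      by (metis norm_ge_zero power_mono power_mult_distrib)
    moreover have "T (T (w n)) \<bullet> w n = (norm (T (w n)))\<^sup>2"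
      by (simp add: symmetric_T power2_norm_eq_inner)
    moreover have "w n \<bullet> w n = 1" using w(2)[of n] by (simp add: norm_eq_sqrt_inner)
    moreover have "(norm (a - c *\<^sub>R b))\<^sup>2 = (norm a)\<^sup>2 - 2 * c * (a \<bullet> b) + c\<^sup>2 * (b \<bullet> b)" for a b :: 'a and c
      unfolding power2_norm_eq_inner
      by (simp add: inner_diff_left inner_diff_right inner_commute[of b a] power2_eq_square right_diff_distrib)
    ultimately have "(norm (T (T (w n)) - N\<^sup>2 *\<^sub>R w n))\<^sup>2
        \<le> N\<^sup>2 * (norm (T (w n)))\<^sup>2 - 2 * N\<^sup>2 * (norm (T (w n)))\<^sup>2 + (N\<^sup>2)\<^sup>2" by simp
    also have "\<dots> = N\<^sup>2 * (N\<^sup>2 - (norm (T (w n)))\<^sup>2)" by (simp add: right_diff_distrib power2_eq_square)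
    finally show ?thesis .
  qed
  have "(\<lambda>n. N\<^sup>2 * (N\<^sup>2 - (norm (T (w n)))\<^sup>2)) \<longlonglongrightarrow> N\<^sup>2 * (N\<^sup>2 - N\<^sup>2)"
    by (rule tendsto_mult[OF tendsto_const tendsto_diff[OF tendsto_const tendsto_power[OF lim_norm_w]]])
  then have bound0: "(\<lambda>n. N\<^sup>2 * (N\<^sup>2 - (norm (T (w n)))\<^sup>2)) \<longlonglongrightarrow> 0" by simp
  have "(\<lambda>n. (norm (T (T (w n)) - N\<^sup>2 *\<^sub>R w n))\<^sup>2) \<longlonglongrightarrow> 0"
  proof (rule Lim_null_comparison[OF always_eventually[OF allI] bound0])
    fix n show "norm ((norm (T (T (w n)) - N\<^sup>2 *\<^sub>R w n))\<^sup>2) \<le> N\<^sup>2 * (N\<^sup>2 - (norm (T (w n)))\<^sup>2)"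
      using residual[of n] by (simp only: real_norm_def abs_power2)
  qed
  then have "(\<lambda>n. sqrt ((norm (T (T (w n)) - N\<^sup>2 *\<^sub>R w n))\<^sup>2)) \<longlonglongrightarrow> sqrt 0"
    by (rule tendsto_real_sqrt)
  then have res0: "(\<lambda>n. T (T (w n)) - N\<^sup>2 *\<^sub>R w n) \<longlonglongrightarrow> 0"
    by (simp add: tendsto_norm_zero_iff)
  have TTw: "(\<lambda>n. T (T (w n))) \<longlonglongrightarrow> T l"
    using T.tendsto[OF l] by (simp add: w_def)
  have "(\<lambda>n. (T (T (w n)) - (T (T (w n)) - N\<^sup>2 *\<^sub>R w n)) /\<^sub>R N\<^sup>2) \<longlonglongrightarrow> (T l - 0) /\<^sub>R N\<^sup>2"
    by (rule tendsto_scaleR[OF tendsto_const tendsto_diff[OF TTw res0]])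
  then have wlim: "w \<longlonglongrightarrow> T l /\<^sub>R N\<^sup>2" using Npos by simp
  define x0 where "x0 = T l /\<^sub>R N\<^sup>2"
  have wlim: "w \<longlonglongrightarrow> x0" using wlim by (simp add: x0_def)
  have x0S: "x0 \<in> S" using S(2) w(1) wlim closed_sequentially by blast
  have x0n: "norm x0 = 1" using tendsto_norm[OF wlim] w(2) by (simp add: LIMSEQ_const_iff)
  have "(\<lambda>n. T (T (w n)) - N\<^sup>2 *\<^sub>R w n) \<longlonglongrightarrow> T (T x0) - N\<^sup>2 *\<^sub>R x0"
    by (rule tendsto_diff[OF T.tendsto[OF T.tendsto[OF wlim]] tendsto_scaleR[OF tendsto_const wlim]])
  then have TT: "T (T x0) = N\<^sup>2 *\<^sub>R x0" using LIMSEQ_unique[OF res0] by (metis eq_iff_diff_eq_0)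
  show ?thesis
  proof (cases "T x0 = - N *\<^sub>R x0")
    case True
    then show ?thesis using x0S x0n N_upper Npos by (intro bexI[of _ x0] exI[of _ "-N"]) auto
  next
    case False
    define z where "z = T x0 + N *\<^sub>R x0"
    have z0: "z \<noteq> 0" using False by (simp add: z_def eq_neg_iff_add_eq_0)
    have zS: "z \<in> S" unfolding z_def using S x0S by (simp add: subspace_add subspace_scale)
    have Tz: "T z = N *\<^sub>R z" unfolding z_def
      by (simp add: T.add T.scaleR TT scaleR_add_right power2_eq_square)
    show ?thesis using unit[OF zS z0] Tz N_upper Npos
      by (intro bexI[of _ "z /\<^sub>R norm z"] exI[of _ N]) (auto simp: T.scaleR)
  qed
qed

text \<open>The eigenvectors are chosen one after the other, each extremal on the orthogonal complement
  of the earlier ones. The complement never shrinks to zero: otherwise every vector would be a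
  combination of finitely many eigenvectors with nonzero eigenvalues and hence lie in the range.
  The moduli of the eigenvalues decrease, and compactness forces them to tend to zero; since they
  are the norms of \<open>T\<close> on the complements, the remainders of the expansion tend to zero too.\<close>
theorem eigenbasis_exists:
  assumes inj: "\<And>x. T x = 0 \<Longrightarrow> x = 0" and nonsurj: "\<not> surj T"
  shows "\<exists>v \<rho>. eigenbasis T v \<rho>"
proof -
  \<comment> \<open>\<open>P f n r\<close>: the vector \<open>r\<close> is an admissible \<open>n\<close>-th choice after \<open>f 0, \<dots>, f (n - 1)\<close>.\<close>
  define P where "P f n r \<longleftrightarrow> norm r = 1 \<and> (\<forall>i<n. r \<bullet> f i = 0) \<and>
     (\<exists>\<rho>. T r = \<rho> *\<^sub>R r \<and> (\<forall>y. (\<forall>i<n. y \<bullet> f i = 0) \<longrightarrow> norm (T y) \<le> \<bar>\<rho>\<bar> * norm y))"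
     for f :: "nat \<Rightarrow> 'a" and n :: nat and r
  have step: "\<exists>r. P f n r" if IH: "\<And>m. m < n \<Longrightarrow> P f m (f m)" for f n
  proof -
    define S where "S = {y. \<forall>i<n. y \<bullet> f i = 0}"
    have on: "f i \<bullet> f j = (if i = j then 1 else 0)" if "i < n" "j < n" for i j
      using IH[OF that(1)] IH[OF that(2)] unfolding P_def
      by (metis inner_commute nat_neq_iff power2_norm_eq_inner power_one)
    have "\<exists>a. T (f i) = a *\<^sub>R f i" if "i < n" for i
      using IH[OF that] unfolding P_def by blast
    then obtain a where a: "\<And>i. i < n \<Longrightarrow> T (f i) = a i *\<^sub>R f i" by metis
    have a0: "a i \<noteq> 0" if "i < n" for i
      using a[OF that] inj[of "f i"] on[OF that that] by auto
    have sub: "subspace S" unfolding S_def by (auto simp: subspace_def inner_add_left)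
    have "S = (\<Inter>i\<in>{..<n}. {y. y \<bullet> f i = 0})" by (auto simp: S_def)
    then have clo: "closed S" by (auto intro!: closed_INT closed_Collect_eq continuous_intros)
    have inv: "T y \<in> S" if "y \<in> S" for y
      using that a by (auto simp: S_def symmetric_T)
    obtain x where x: "x \<in> S" "x \<noteq> 0"
    proof (rule ccontr)
      assume neg: "\<not> thesis"
      have "y \<in> range T" for y
      proof -
        have "y - (\<Sum>i<n. (y \<bullet> f i) *\<^sub>R f i) \<in> S"
          unfolding S_def by (auto simp: inner_diff_left inner_sum_left on if_distrib sum.delta cong: if_cong)
        then have "y - (\<Sum>i<n. (y \<bullet> f i) *\<^sub>R f i) = 0" using neg that by blast
        then have "y = (\<Sum>i<n. (y \<bullet> f i) *\<^sub>R f i)" by simp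
        also have "\<dots> = T (\<Sum>i<n. ((y \<bullet> f i) / a i) *\<^sub>R f i)"
          by (simp add: T.sum T.scaleR a a0)
        finally show ?thesis by blast
      qed
      then show False using nonsurj by blast
    qed
    have "T x \<noteq> 0" using inj x by blast
    from extremal_eigenvector[OF sub clo inv x(1) this]
    show ?thesis unfolding P_def S_def by blast
  qed
  have "\<exists>v. \<forall>n. P v n (v n)"
    by (rule dependent_wellorder_choice[of P]) (use step in \<open>auto simp: P_def\<close>)
  then obtain v where v: "\<And>n. P v n (v n)" by blast
  have "\<exists>\<rho>. T (v n) = \<rho> *\<^sub>R v n \<and> (\<forall>y. (\<forall>i<n. y \<bullet> v i = 0) \<longrightarrow> norm (T y) \<le> \<bar>\<rho>\<bar> * norm y)" for n
    using v[of n] unfolding P_def by blast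
  then obtain \<rho> where rho: "\<And>n. T (v n) = \<rho> n *\<^sub>R v n"
     and bound: "\<And>n y. (\<forall>i<n. y \<bullet> v i = 0) \<Longrightarrow> norm (T y) \<le> \<bar>\<rho> n\<bar> * norm y" by metis
  have on: "v i \<bullet> v j = (if i = j then 1 else 0)" for i j
    using v[of i] v[of j] unfolding P_def
    by (metis inner_commute nat_neq_iff power2_norm_eq_inner power_one)
  have nv: "norm (v i) = 1" for i using v[of i] by (simp add: P_def)
  have rho0: "\<rho> n \<noteq> 0" for n using rho[of n] inj[of "v n"] on[of n n] by auto
  have mono: "\<bar>\<rho> n\<bar> \<le> \<bar>\<rho> m\<bar>" if "m \<le> n" for m n
    using bound[of m "v n"] that by (simp add: rho nv on)
  \<comment> \<open>Images of distinct eigenvectors are orthogonal, so a lower bound for the moduli keeps them apart.\<close>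
  have small: "\<exists>n. \<bar>\<rho> n\<bar> < \<delta>" if d: "\<delta> > 0" for \<delta>
  proof (rule ccontr)
    assume "\<not> ?thesis"
    then have big: "\<bar>\<rho> n\<bar> \<ge> \<delta>" for n by (auto simp: not_less)
    obtain r l where r: "strict_mono r" and l: "(\<lambda>n. T (v (r n))) \<longlonglongrightarrow> l"
      using compact_T[of v] nv by auto
    then have "Cauchy (\<lambda>n. T (v (r n)))" by (simp add: LIMSEQ_imp_Cauchy)
    then obtain M where M: "\<And>m n. m \<ge> M \<Longrightarrow> n \<ge> M \<Longrightarrow> norm (T (v (r m)) - T (v (r n))) < \<delta>"
      using d by (meson CauchyD)
    have ne: "r M \<noteq> r (Suc M)" using r by (metis lessI less_irrefl strict_mono_less)
    have "(norm (T (v (r M)) - T (v (r (Suc M)))))\<^sup>2 = (\<rho> (r M))\<^sup>2 + (\<rho> (r (Suc M)))\<^sup>2"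
      unfolding power2_norm_eq_inner rho using ne ne[symmetric]
      by (simp add: inner_diff on power2_eq_square)
    also have "\<dots> \<ge> \<delta>\<^sup>2"
      using power_mono[OF big[of "r M"], of 2] d by (simp add: add_increasing2)
    finally have "norm (T (v (r M)) - T (v (r (Suc M)))) \<ge> \<delta>" by (rule power2_le_imp_le) simp
    then show False using M[of M "Suc M"] by simp
  qed
  have rho_lim: "(\<lambda>n. \<bar>\<rho> n\<bar>) \<longlonglongrightarrow> 0"
  proof (rule LIMSEQ_I)
    fix e :: real assume "e > 0"
    from small[OF this] obtain n where "\<bar>\<rho> n\<bar> < e" by blast
    then show "\<exists>no. \<forall>n\<ge>no. norm (\<bar>\<rho> n\<bar> - 0) < e"
      using mono by (intro exI[of _ n]) (auto intro: le_less_trans)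
  qed
  have conv: "(\<lambda>n. \<Sum>i<n. (\<rho> i * (x \<bullet> v i)) *\<^sub>R v i) \<longlonglongrightarrow> T x" for x
  proof -
    define p where "p n = x - (\<Sum>i<n. (x \<bullet> v i) *\<^sub>R v i)" for n
    have orth: "p n \<bullet> v i = 0" if "i < n" for n i
      using that unfolding p_def by (simp add: inner_diff_left inner_sum_left on if_distrib sum.delta cong: if_cong)
    have "(norm (p n))\<^sup>2 \<le> (norm x)\<^sup>2" for n
    proof -
      have "p n \<bullet> (\<Sum>i<n. (x \<bullet> v i) *\<^sub>R v i) = 0" by (simp add: inner_sum_right orth)
      then have "x \<bullet> x = p n \<bullet> p n + (\<Sum>i<n. (x \<bullet> v i) *\<^sub>R v i) \<bullet> (\<Sum>i<n. (x \<bullet> v i) *\<^sub>R v i)"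
        unfolding p_def by (simp add: inner_diff inner_commute)
      then show ?thesis unfolding power2_norm_eq_inner using inner_ge_zero by (metis le_add_same_cancel1)
    qed
    then have np: "norm (p n) \<le> norm x" for n by (meson norm_ge_zero power2_le_imp_le)
    have "norm (T (p n)) \<le> \<bar>\<rho> n\<bar> * norm x" for n
      using bound[of n "p n"] orth np[of n] by (smt (verit) abs_ge_zero mult_left_mono)
    moreover have "(\<lambda>n. \<bar>\<rho> n\<bar> * norm x) \<longlonglongrightarrow> 0" using tendsto_mult_left_zero[OF rho_lim] by simp
    ultimately have "(\<lambda>n. T (p n)) \<longlonglongrightarrow> 0"
      by (intro Lim_null_comparison[of "\<lambda>n. T (p n)"]) auto
    then have "(\<lambda>n. T x - T (p n)) \<longlonglongrightarrow> T x - 0" by (intro tendsto_intros)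
    moreover have "T x - T (p n) = (\<Sum>i<n. (\<rho> i * (x \<bullet> v i)) *\<^sub>R v i)" for n
      unfolding p_def by (simp add: T.diff T.sum T.scaleR rho mult.commute)
    ultimately show ?thesis by simp
  qed
  show ?thesis
    unfolding eigenbasis_def using on rho rho0 bound[of 0] conv
    by (intro exI[of _ v] exI[of _ \<rho>] conjI allI) auto
qed

end

section \<open>Continuous functions with the $L_2$ inner product\<close>

text \<open>Functions on the unit interval, continued by zero so that two of them are equal as soon as they
  agree on the interval.\<close>
typedef ctsfun = "{f :: real \<Rightarrow> real. continuous_on {0..1} f \<and> (\<forall>t. t \<notin> {0..1} \<longrightarrow> f t = 0)}"
  morphisms fn Abs_ctsfun
  by (rule exI[of _ "\<lambda>_. 0"]) auto

setup_lifting type_definition_ctsfun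

lemma continuous_on_zero_extension:
  "continuous_on S f \<Longrightarrow> continuous_on S (\<lambda>t. if t \<in> S then f t else 0)"
  by (rule continuous_on_eq) auto

lift_definition ctsfun_of :: "(real \<Rightarrow> real) \<Rightarrow> ctsfun"
  is "\<lambda>f. if continuous_on {0..1} f then (\<lambda>t. if t \<in> {0..1} then f t else 0) else (\<lambda>_. 0)"
  by (auto simp del: atLeastAtMost_iff intro: continuous_on_zero_extension)

lemma fn_ctsfun_of [simp]: "continuous_on {0..1} f \<Longrightarrow> t \<in> {0..1} \<Longrightarrow> fn (ctsfun_of f) t = f t"
  by transfer auto

lemma continuous_on_fn: "continuous_on {0..1} (fn x)"
  using fn[of x] by simp

lemma continuous_on_fn_compose [continuous_intros]:
  "continuous_on S f \<Longrightarrow> f ` S \<subseteq> {0..1} \<Longrightarrow> continuous_on S (\<lambda>t. fn x (f t))"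
  by (rule continuous_on_compose2[OF continuous_on_fn])

lemma fn_outside: "t \<notin> {0..1} \<Longrightarrow> fn x t = 0"
  using fn[of x] by simp

lemma fn_eqI:
  assumes "\<And>t. t \<in> {0..1} \<Longrightarrow> fn x t = fn y t"
  shows "x = y"
proof -
  have "fn x t = fn y t" for t
    using assms[of t] fn_outside[of t x] fn_outside[of t y] by argo
  then show ?thesis by (simp add: fn_inject[symmetric] fun_eq_iff)
qed

instantiation ctsfun :: real_vector
begin

lift_definition zero_ctsfun :: ctsfun is "\<lambda>_. 0" by auto
lift_definition plus_ctsfun :: "ctsfun \<Rightarrow> ctsfun \<Rightarrow> ctsfun" is "\<lambda>f g t. f t + g t"
  by (auto intro: continuous_intros)
lift_definition minus_ctsfun :: "ctsfun \<Rightarrow> ctsfun \<Rightarrow> ctsfun" is "\<lambda>f g t. f t - g t"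
  by (auto intro: continuous_intros)
lift_definition uminus_ctsfun :: "ctsfun \<Rightarrow> ctsfun" is "\<lambda>f t. - f t"
  by (auto intro: continuous_intros)
lift_definition scaleR_ctsfun :: "real \<Rightarrow> ctsfun \<Rightarrow> ctsfun" is "\<lambda>c f t. c * f t"
  by (auto intro: continuous_intros)

instance
  by standard (transfer; auto simp: algebra_simps fun_eq_iff)+

end

instantiation ctsfun :: real_inner
begin

definition inner_ctsfun :: "ctsfun \<Rightarrow> ctsfun \<Rightarrow> real" where
  "inner_ctsfun x y = integral {0..1} (\<lambda>t. fn x t * fn y t)"
definition norm_ctsfun :: "ctsfun \<Rightarrow> real" where
  "norm_ctsfun x = sqrt (x \<bullet> x)"
definition dist_ctsfun :: "ctsfun \<Rightarrow> ctsfun \<Rightarrow> real" where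
  "dist_ctsfun x y = norm (x - y)"
definition sgn_ctsfun :: "ctsfun \<Rightarrow> ctsfun" where
  "sgn_ctsfun x = x /\<^sub>R norm x"
definition uniformity_ctsfun :: "(ctsfun \<times> ctsfun) filter" where
  "uniformity_ctsfun = (INF e\<in>{0<..}. principal {(x, y). dist x y < e})"
definition open_ctsfun :: "ctsfun set \<Rightarrow> bool" where
  "open_ctsfun U \<longleftrightarrow> (\<forall>x\<in>U. \<forall>\<^sub>F (x', y) in uniformity. x' = x \<longrightarrow> y \<in> U)"

lemma integrable_fn_mult: "(\<lambda>t. fn x t * fn y t) integrable_on {0..1}"
  by (intro integrable_continuous_interval continuous_intros) auto

instance
proof
  fix x y z :: ctsfun and r :: real
  show "x \<bullet> y = y \<bullet> x" by (simp add: inner_ctsfun_def mult.commute)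
  show "(x + y) \<bullet> z = x \<bullet> z + y \<bullet> z"
    using integral_add[OF integrable_fn_mult[of x z] integrable_fn_mult[of y z]]
    by (simp add: inner_ctsfun_def plus_ctsfun.rep_eq distrib_right)
  show "(r *\<^sub>R x) \<bullet> y = r * (x \<bullet> y)"
    by (simp add: inner_ctsfun_def scaleR_ctsfun.rep_eq mult.assoc)
  show "0 \<le> x \<bullet> x" unfolding inner_ctsfun_def by (intro integral_nonneg integrable_fn_mult) auto
  have "x \<bullet> x = 0 \<longleftrightarrow> (\<forall>t\<in>{0..1}. fn x t * fn x t = 0)"
    unfolding inner_ctsfun_def by (intro integral_eq_0_iff continuous_intros) auto
  also have "\<dots> \<longleftrightarrow> x = 0" by (auto intro!: fn_eqI simp: zero_ctsfun.rep_eq)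
  finally show "x \<bullet> x = 0 \<longleftrightarrow> x = 0" .
qed (simp_all add: norm_ctsfun_def dist_ctsfun_def sgn_ctsfun_def uniformity_ctsfun_def open_ctsfun_def)

end

lemmas fn_simps [simp] =
  zero_ctsfun.rep_eq plus_ctsfun.rep_eq minus_ctsfun.rep_eq uminus_ctsfun.rep_eq scaleR_ctsfun.rep_eq

lemma fn_sum [simp]: "fn (\<Sum>i\<in>I. f i) t = (\<Sum>i\<in>I. fn (f i) t)"
  by (induction I rule: infinite_finite_induct) auto

lemma norm_le_sup:
  assumes "\<And>t. t \<in> {0..1} \<Longrightarrow> \<bar>fn x t\<bar> \<le> B"
  shows "norm x \<le> B"
proof -
  have "0 \<le> B" using assms[of 0] by force
  have "(norm x)\<^sup>2 = integral {0..1} (\<lambda>t. fn x t * fn x t)"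
    unfolding power2_norm_eq_inner by (simp add: inner_ctsfun_def)
  also have "\<dots> \<le> integral {0..1} (\<lambda>t::real. B\<^sup>2)"
  proof (rule Henstock_Kurzweil_Integration.integral_le[OF integrable_fn_mult])
    show "(\<lambda>t::real. B\<^sup>2) integrable_on {0..1}" by (rule integrable_const_ivl)
    show "fn x t * fn x t \<le> B\<^sup>2" if "t \<in> {0..1}" for t
      using power_mono[OF assms[OF that] abs_ge_zero, of 2] by (simp add: power2_eq_square)
  qed
  finally have "(norm x)\<^sup>2 \<le> B\<^sup>2" by simp
  then show ?thesis using \<open>0 \<le> B\<close> by (rule power2_le_imp_le)
qed

text \<open>Cauchy--Schwarz, in the form in which it bounds values of integral operators by the \<open>L\<^sub>2\<close> norm.\<close>
lemma integral_mult_fn_bound: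
  assumes "continuous_on {0..1} k" "\<And>r. r \<in> {0..1} \<Longrightarrow> \<bar>k r\<bar> \<le> B"
  shows "\<bar>integral {0..1} (\<lambda>r. k r * fn x r)\<bar> \<le> B * norm x"
proof -
  have "integral {0..1} (\<lambda>r. k r * fn x r) = ctsfun_of k \<bullet> x"
    unfolding inner_ctsfun_def by (intro integral_cong) (simp add: assms)
  moreover have "\<bar>ctsfun_of k \<bullet> x\<bar> \<le> norm (ctsfun_of k) * norm x" by (rule Cauchy_Schwarz_ineq2)
  moreover have "norm (ctsfun_of k) \<le> B" by (rule norm_le_sup) (simp add: assms)
  ultimately show ?thesis using mult_right_mono[OF _ norm_ge_zero, of "norm (ctsfun_of k)" B x] by linarith
qed

lemma integrable_mult_fn:
  "continuous_on {0..1} k \<Longrightarrow> (\<lambda>r. k r * fn x r) integrable_on {0..1}"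
  by (intro integrable_continuous_interval continuous_intros) auto

lemma integral_flip_unit:
  fixes f :: "real \<Rightarrow> real"
  assumes "continuous_on {0..1} f"
  shows "integral {0..1} (\<lambda>r. f (1 - r)) = integral {0..1} f"
proof -
  have "(f has_integral integral {0..1} f) (cbox 0 1)"
    using integrable_continuous_interval[OF assms] by (simp add: integrable_integral)
  from has_integral_affinity[OF this, of "-1" 1]
  have "((\<lambda>r. f (1 - r)) has_integral integral {0..1} f) ((\<lambda>x. 1 - x) ` {0..1})"
    by (simp add: cbox_interval)
  moreover have "(\<lambda>x. 1 - x) ` {0..1::real} = {0..1}" by (simp add: image_diff_atLeastAtMost)
  ultimately show ?thesis by (simp add: integral_unique)
qed

section \<open>Integral operators with a continuous kernel\<close>

definition int_op :: "(real \<Rightarrow> real \<Rightarrow> real) \<Rightarrow> ctsfun \<Rightarrow> ctsfun" where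
  "int_op k x = ctsfun_of (\<lambda>t. integral {0..1} (\<lambda>r. k t r * fn x r))"

context
  fixes k :: "real \<Rightarrow> real \<Rightarrow> real"
  assumes k: "continuous_on ({0..1} \<times> {0..1}) (\<lambda>(t, r). k t r)"
begin

lemma continuous_on_kernel_section: "t \<in> {0..1} \<Longrightarrow> continuous_on {0..1} (k t)"
  by (rule continuous_on_compose2[OF k, of "{0..1}" "\<lambda>r. (t, r)", simplified])
     (auto intro!: continuous_intros)

lemma fn_int_op:
  assumes "t \<in> {0..1}"
  shows "fn (int_op k x) t = integral {0..1} (\<lambda>r. k t r * fn x r)"
proof -
  have "continuous_on ({0..1} \<times> cbox 0 1) (\<lambda>(t, r). k t r * fn x r)"
    using k by (auto simp: split_beta cbox_interval intro!: continuous_intros)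
  from integral_continuous_on_param[OF this]
  show ?thesis using assms unfolding int_op_def by (simp add: cbox_interval)
qed

lemma norm_int_op_le:
  assumes "\<And>t r. t \<in> {0..1} \<Longrightarrow> r \<in> {0..1} \<Longrightarrow> \<bar>k t r\<bar> \<le> B"
  shows "norm (int_op k x) \<le> B * norm x"
  by (rule norm_le_sup)
     (auto simp: fn_int_op intro!: integral_mult_fn_bound continuous_on_kernel_section assms)

lemma kernel_bounded: "\<exists>B. \<forall>t\<in>{0..1}. \<forall>r\<in>{0..1}. \<bar>k t r\<bar> \<le> B"
proof -
  have "compact ((\<lambda>(t, r). k t r) ` ({0..1} \<times> {0..1}))"
    by (intro compact_continuous_image k compact_Times compact_Icc)
  from compact_imp_bounded[OF this] show ?thesis by (force simp: bounded_iff)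
qed

lemma bounded_linear_int_op: "bounded_linear (int_op k)"
proof -
  obtain B where B: "\<And>t r. t \<in> {0..1} \<Longrightarrow> r \<in> {0..1} \<Longrightarrow> \<bar>k t r\<bar> \<le> B"
    using kernel_bounded by blast
  show ?thesis
  proof (rule bounded_linear_intro[of _ B])
    fix x y :: ctsfun and c :: real
    show "int_op k (x + y) = int_op k x + int_op k y"
    proof (rule fn_eqI)
      fix t :: real assume t: "t \<in> {0..1}"
      note i = integrable_mult_fn[OF continuous_on_kernel_section[OF t]]
      show "fn (int_op k (x + y)) t = fn (int_op k x + int_op k y) t"
        using t integral_add[OF i[of x] i[of y]] by (simp add: fn_int_op distrib_left)
    qed
    show "int_op k (c *\<^sub>R x) = c *\<^sub>R int_op k x"
      by (rule fn_eqI) (simp add: fn_int_op mult.left_commute)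
    show "norm (int_op k x) \<le> norm x * B"
      using norm_int_op_le[OF B, of x] by (simp add: mult.commute)
  qed
qed

lemma int_op_symmetric:
  assumes sym: "\<And>t r. t \<in> {0..1} \<Longrightarrow> r \<in> {0..1} \<Longrightarrow> k t r = k r t"
  shows "int_op k x \<bullet> y = x \<bullet> int_op k y"
proof -
  have "continuous_on ({0..1} \<times> {0..1}) (\<lambda>(t, r). k t r * fn x r * fn y t)"
    using k by (auto simp: split_beta intro!: continuous_intros)
  then have c: "continuous_on (cbox (0, 0) (1, 1)) (\<lambda>(t, r). k t r * fn x r * fn y t)"
    by (simp only: cbox_Pair_eq) (simp add: cbox_interval)
  have "int_op k x \<bullet> y = integral {0..1} (\<lambda>t. integral {0..1} (\<lambda>r. k t r * fn x r * fn y t))"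
    unfolding inner_ctsfun_def by (intro integral_cong) (simp add: fn_int_op)
  also have "\<dots> = integral {0..1} (\<lambda>r. integral {0..1} (\<lambda>t. k t r * fn x r * fn y t))"
    using integral_swap_continuous[OF c] by (simp add: cbox_interval)
  also have "\<dots> = x \<bullet> int_op k y"
    unfolding inner_ctsfun_def
  proof (intro integral_cong)
    fix r :: real assume r: "r \<in> {0..1}"
    have "integral {0..1} (\<lambda>t. k t r * fn x r * fn y t) = integral {0..1} (\<lambda>t. fn x r * (k r t * fn y t))"
    proof (intro integral_cong)
      fix t :: real assume "t \<in> {0..1}"
      from sym[OF this r] show "k t r * fn x r * fn y t = fn x r * (k r t * fn y t)"
        by (simp only: mult_ac)
    qed
    then show "integral {0..1} (\<lambda>t. k t r * fn x r * fn y t) = fn x r * fn (int_op k y) r"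
      using r by (simp add: fn_int_op)
  qed
  finally show ?thesis .
qed

text \<open>Values and increments of \<open>int_op k x\<close> are controlled by those of the kernel and the \<open>L\<^sub>2\<close> norm of
  \<open>x\<close>, so the unit ball has a bounded equicontinuous image. Arzela--Ascoli provides uniform
  convergence of a subsequence, hence convergence in \<open>L\<^sub>2\<close> to a continuous function.\<close>
lemma int_op_compact:
  fixes x :: "nat \<Rightarrow> ctsfun"
  assumes x: "\<And>n. norm (x n) \<le> 1"
  shows "\<exists>r l. strict_mono (r :: nat \<Rightarrow> nat) \<and> (\<lambda>n. int_op k (x (r n))) \<longlonglongrightarrow> l"
proof -
  obtain B where B: "\<And>t r. t \<in> {0..1} \<Longrightarrow> r \<in> {0..1} \<Longrightarrow> \<bar>k t r\<bar> \<le> B"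
    using kernel_bounded by blast
  have B0: "0 \<le> B" using B[of 0 0] by force
  have bound: "norm (fn (int_op k (x n)) t) \<le> B" if "t \<in> {0..1}" for n t
  proof -
    have "norm (fn (int_op k (x n)) t) \<le> B * norm (x n)"
      using integral_mult_fn_bound[OF continuous_on_kernel_section[OF that] B[OF that]] that
      by (simp add: fn_int_op)
    then show ?thesis using mult_left_mono[OF x[of n] B0] by simp
  qed
  have "uniformly_continuous_on ({0..1} \<times> {0..1}) (\<lambda>(t, r). k t r)"
    by (intro compact_uniformly_continuous k compact_Times compact_Icc)
  then have uc: "\<exists>d>0. \<forall>p\<in>{0..1} \<times> {0..1}. \<forall>q\<in>{0..1} \<times> {0..1}.
      dist q p < d \<longrightarrow> dist (case q of (t, r) \<Rightarrow> k t r) (case p of (t, r) \<Rightarrow> k t r) < e" if "e > 0" for e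
    using that unfolding uniformly_continuous_on_def by blast
  have equi: "\<exists>d>0. \<forall>n u. u \<in> {0..1} \<and> norm (t - u) < d \<longrightarrow>
      norm (fn (int_op k (x n)) t - fn (int_op k (x n)) u) < e" if t: "t \<in> {0..1}" and e: "e > 0" for t e :: real
  proof -
    have "e/2 > 0" using e by simp
    from uc[OF this] obtain d where d: "d > 0"
      and K: "\<forall>p\<in>{0..1} \<times> {0..1}. \<forall>q\<in>{0..1} \<times> {0..1}.
        dist q p < d \<longrightarrow> dist (case q of (t, r) \<Rightarrow> k t r) (case p of (t, r) \<Rightarrow> k t r) < e/2" by blast
    have close: "\<bar>k t r - k u r\<bar> \<le> e/2" if "u \<in> {0..1}" "\<bar>t - u\<bar> < d" "r \<in> {0..1}" for u r
      using bspec[OF bspec[OF K, of "(u, r)"], of "(t, r)"] that t by (simp add: dist_Pair_Pair dist_real_def)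
    have "norm (fn (int_op k (x n)) t - fn (int_op k (x n)) u) < e" if u: "u \<in> {0..1}" "\<bar>t - u\<bar> < d" for n u
    proof -
      note i = integrable_mult_fn[OF continuous_on_kernel_section[OF t], of "x n"]
        integrable_mult_fn[OF continuous_on_kernel_section[OF u(1)], of "x n"]
      have "fn (int_op k (x n)) t - fn (int_op k (x n)) u = integral {0..1} (\<lambda>r. (k t r - k u r) * fn (x n) r)"
        using integral_diff[OF i] t u(1) by (simp add: fn_int_op left_diff_distrib)
      also have "\<bar>\<dots>\<bar> \<le> e/2 * norm (x n)"
        by (intro integral_mult_fn_bound continuous_intros continuous_on_kernel_section t u(1) close u(2))
      also have "\<dots> \<le> e/2" using x[of n] e by (simp add: mult_left_le)
      also have "\<dots> < e" using e by simp
      finally show ?thesis by simp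
    qed
    then show ?thesis using d by (intro exI[of _ d]) simp
  qed
  show ?thesis
  proof (rule Arzela_Ascoli[of "{0..1::real}" "\<lambda>n. fn (int_op k (x n))" B, OF compact_Icc bound equi])
    fix g :: "real \<Rightarrow> real" and r :: "nat \<Rightarrow> nat"
    assume g: "continuous_on {0..1} g" and r: "strict_mono r"
      and unif: "\<And>e. 0 < e \<Longrightarrow> \<exists>N. \<forall>n t. n \<ge> N \<and> t \<in> {0..1} \<longrightarrow> norm (fn (int_op k (x (r n))) t - g t) < e"
    have "(\<lambda>n. int_op k (x (r n))) \<longlonglongrightarrow> ctsfun_of g"
    proof (rule LIMSEQ_I)
      fix e :: real assume "0 < e"
      then obtain N where N: "\<And>n t. n \<ge> N \<Longrightarrow> t \<in> {0..1} \<Longrightarrow> norm (fn (int_op k (x (r n))) t - g t) < e/2"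
        using unif[of "e/2"] by auto
      have "norm (int_op k (x (r n)) - ctsfun_of g) \<le> e/2" if "n \<ge> N" for n
        by (rule norm_le_sup) (use N[OF that] g in \<open>auto intro: less_imp_le\<close>)
      then show "\<exists>N. \<forall>n\<ge>N. norm (int_op k (x (r n)) - ctsfun_of g) < e"
        using \<open>0 < e\<close> by (intro exI[of _ N]) force
    qed
    then show ?thesis using r by blast
  qed
qed

end

section \<open>The initial value problem and its solution operator\<close>

text \<open>For \<open>s \<noteq> 0\<close>, the solution of \<open>G'' = s\<^sup>2 G\<close>, \<open>G 0 = 0\<close>, \<open>G' 0 = 1\<close>, continued by zero to the left. The
  continuation is continuous, which makes the Volterra operator an integral operator with a
  continuous kernel on the whole square.\<close>
definition propagator :: "real \<Rightarrow> real \<Rightarrow> real" where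
  "propagator s z = sinh (s * max 0 z) / s"

text \<open>The function \<open>x\<close> is sent to the solution \<open>y\<close> of \<open>y'' = s\<^sup>2 y + x(1 - t)\<close> with \<open>y 0 = y' 0 = 0\<close>.
  The reflection of \<open>x\<close> makes the kernel symmetric in \<open>t\<close> and \<open>r\<close>.\<close>
definition reflected_volterra :: "real \<Rightarrow> ctsfun \<Rightarrow> ctsfun" where
  "reflected_volterra s = int_op (\<lambda>t r. propagator s (t + r - 1))"

lemma continuous_on_propagator [continuous_intros]:
  "continuous_on S f \<Longrightarrow> continuous_on S (\<lambda>z. propagator s (f z))"
  unfolding propagator_def by (cases "s = 0") (auto intro!: continuous_intros)

lemma continuous_kernel: "continuous_on ({0..1} \<times> {0..1}) (\<lambda>(t, r). propagator s (t + r - 1))"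
  by (auto simp: split_beta intro!: continuous_intros)

lemma fn_reflected_volterra_integral:
  "t \<in> {0..1} \<Longrightarrow> fn (reflected_volterra s x) t = integral {0..1} (\<lambda>r. propagator s (t + r - 1) * fn x r)"
  unfolding reflected_volterra_def by (rule fn_int_op[OF continuous_kernel])

text \<open>The substitution \<open>q = 1 - r\<close> restores the Volterra form, and the addition theorem for
  \<open>sinh\<close> takes \<open>t\<close> out of the integrands, so that the fundamental theorem of calculus applies.\<close>
lemma fn_reflected_volterra:
  assumes t: "t \<in> {0..1}"
  shows "fn (reflected_volterra s x) t =
    (sinh (s * t) * integral {0..t} (\<lambda>q. cosh (s * q) * fn x (1 - q))
      - cosh (s * t) * integral {0..t} (\<lambda>q. sinh (s * q) * fn x (1 - q))) / s"
proof -
  have c: "continuous_on {0..1} (\<lambda>r. propagator s (t + r - 1) * fn x r)"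
    by (intro continuous_intros) auto
  have c': "(\<lambda>q. propagator s (t - q) * fn x (1 - q)) integrable_on {0..1}"
    by (intro integrable_continuous_interval continuous_intros) auto
  have ii: "(\<lambda>q. f q * fn x (1 - q)) integrable_on {0..t}" if "continuous_on {0..t} f" for f
    using t that by (intro integrable_continuous_interval continuous_intros) auto
  have "fn (reflected_volterra s x) t = integral {0..1} (\<lambda>q. propagator s (t - q) * fn x (1 - q))"
    using integral_flip_unit[OF c] t by (simp add: fn_reflected_volterra_integral)
  also have "\<dots> = integral {0..t} (\<lambda>q. propagator s (t - q) * fn x (1 - q))
      + integral {t..1} (\<lambda>q. propagator s (t - q) * fn x (1 - q))"
    using t c' by (simp add: Henstock_Kurzweil_Integration.integral_combine)
  also have "integral {t..1} (\<lambda>q. propagator s (t - q) * fn x (1 - q)) = integral {t..1} (\<lambda>q. 0)"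
    by (intro integral_cong) (auto simp: propagator_def)
  also have "integral {0..t} (\<lambda>q. propagator s (t - q) * fn x (1 - q)) =
      integral {0..t} (\<lambda>q. sinh (s * t) / s * (cosh (s * q) * fn x (1 - q))
         - cosh (s * t) / s * (sinh (s * q) * fn x (1 - q)))"
    by (intro integral_cong)
       (simp add: propagator_def right_diff_distrib sinh_diff diff_divide_distrib left_diff_distrib)
  also have "\<dots> = sinh (s * t) / s * integral {0..t} (\<lambda>q. cosh (s * q) * fn x (1 - q))
         - cosh (s * t) / s * integral {0..t} (\<lambda>q. sinh (s * q) * fn x (1 - q))"
    using Henstock_Kurzweil_Integration.integral_diff
      [OF integrable_on_cmult_left[OF ii[of "\<lambda>q. cosh (s * q)"], of "sinh (s * t) / s"]
          integrable_on_cmult_left[OF ii[of "\<lambda>q. sinh (s * q)"], of "cosh (s * t) / s"]]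
    by (simp add: continuous_intros)
  finally show ?thesis by (simp add: diff_divide_distrib)
qed

definition reflected_volterra_deriv :: "real \<Rightarrow> ctsfun \<Rightarrow> real \<Rightarrow> real" where
  "reflected_volterra_deriv s x t =
    cosh (s * t) * integral {0..t} (\<lambda>q. cosh (s * q) * fn x (1 - q))
      - sinh (s * t) * integral {0..t} (\<lambda>q. sinh (s * q) * fn x (1 - q))"

lemma reflected_volterra_0 [simp]: "fn (reflected_volterra s x) 0 = 0"
  by (simp add: fn_reflected_volterra)

lemma reflected_volterra_deriv_0 [simp]: "reflected_volterra_deriv s x 0 = 0"
  by (simp add: reflected_volterra_deriv_def)

lemma reflected_volterra_ode:
  assumes s: "s \<noteq> 0" and t: "t \<in> {0..1}"
  shows reflected_volterra_has_deriv:
    "(fn (reflected_volterra s x) has_real_derivative reflected_volterra_deriv s x t) (at t within {0..1})"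
    and reflected_volterra_deriv_has_deriv:
    "(reflected_volterra_deriv s x has_real_derivative
      s\<^sup>2 * fn (reflected_volterra s x) t + fn x (1 - t)) (at t within {0..1})"
proof -
  define C where "C t = integral {0..t} (\<lambda>q. cosh (s * q) * fn x (1 - q))" for t
  define S where "S t = integral {0..t} (\<lambda>q. sinh (s * q) * fn x (1 - q))" for t
  define y where "y t = (sinh (s * t) * C t - cosh (s * t) * S t) / s" for t
  define D where "D = reflected_volterra_deriv s x"
  have D_def': "D = (\<lambda>t. cosh (s * t) * C t - sinh (s * t) * S t)"
    unfolding D_def C_def S_def by (simp add: reflected_volterra_deriv_def fun_eq_iff)
  have y: "fn (reflected_volterra s x) t = y t" if "t \<in> {0..1}" for t
    unfolding y_def C_def S_def by (rule fn_reflected_volterra[OF that])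
  have dC: "(C has_real_derivative cosh (s * t) * fn x (1 - t)) (at t within {0..1})" if "t \<in> {0..1}" for t
    unfolding C_def by (rule integral_has_real_derivative[OF _ that]) (auto intro!: continuous_intros)
  have dS: "(S has_real_derivative sinh (s * t) * fn x (1 - t)) (at t within {0..1})" if "t \<in> {0..1}" for t
    unfolding S_def by (rule integral_has_real_derivative[OF _ that]) (auto intro!: continuous_intros)
  have dy: "(y has_real_derivative D t) (at t within {0..1})" if "t \<in> {0..1}" for t
    unfolding y_def D_def'
    by (rule derivative_eq_intros dC[OF that] dS[OF that] refl s)+ (use s in \<open>simp add: field_simps\<close>)
  have cs: "cosh (s * t) * cosh (s * t) - sinh (s * t) * sinh (s * t) = 1" for t
    using cosh_square_eq[of "s * t"] by (simp add: power2_eq_square)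
  have dD: "(D has_real_derivative s\<^sup>2 * y t + fn x (1 - t)) (at t within {0..1})" if "t \<in> {0..1}" for t
  proof -
    have "(D has_real_derivative s * (sinh (s * t) * C t) - s * (cosh (s * t) * S t)
        + (cosh (s * t) * cosh (s * t) - sinh (s * t) * sinh (s * t)) * fn x (1 - t)) (at t within {0..1})"
      unfolding D_def'
      by (rule derivative_eq_intros dC[OF that] dS[OF that] refl)+ (simp add: algebra_simps)
    moreover have "s\<^sup>2 * y t = s * (sinh (s * t) * C t) - s * (cosh (s * t) * S t)"
      using s by (simp add: y_def power2_eq_square field_simps)
    ultimately show ?thesis unfolding cs by simp
  qed
  show "(fn (reflected_volterra s x) has_real_derivative reflected_volterra_deriv s x t) (at t within {0..1})"
    unfolding D_def[symmetric]
    by (rule has_field_derivative_transform_within[OF dy[OF t] zero_less_one t]) (simp add: y)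
  show "(reflected_volterra_deriv s x has_real_derivative
      s\<^sup>2 * fn (reflected_volterra s x) t + fn x (1 - t)) (at t within {0..1})"
    using dD[OF t] y[OF t] unfolding D_def by simp
qed

text \<open>The differential equation recovers \<open>x\<close> from its image.\<close>
lemma reflected_volterra_injective:
  assumes s: "s \<noteq> 0" and zero: "reflected_volterra s x = 0"
  shows "x = 0"
proof -
  define D where "D = reflected_volterra_deriv s x"
  note D = reflected_volterra_ode[OF s, of _ x, folded D_def]
  have unique: "a = b" if "(f has_real_derivative a) (at t within {0..1})"
     "(f has_real_derivative b) (at t within {0..1})" "t \<in> {0..1}" for f a b t
    using vector_derivative_unique_within_closed_interval[of 0 1 t f a b] that
    by (simp add: has_real_derivative_iff_has_vector_derivative cbox_interval)
  have fn0: "fn 0 = (\<lambda>_. 0)" by auto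
  have D0: "D t = 0" if t: "t \<in> {0..1}" for t
    by (rule unique[OF D(1)[OF t] _ t]) (unfold zero fn0, rule DERIV_const)
  have "fn x (1 - t) = 0" if t: "t \<in> {0..1}" for t
  proof -
    have "(D has_real_derivative 0) (at t within {0..1})"
      by (rule has_field_derivative_transform_within[OF DERIV_const zero_less_one t]) (simp add: D0)
    from unique[OF D(2)[OF t] this t] show ?thesis by (simp add: zero)
  qed
  from this[of "1 - t" for t] show ?thesis by (intro fn_eqI) simp
qed

text \<open>All functions in the range vanish at \<open>0\<close>.\<close>
lemma reflected_volterra_not_surj: "\<not> surj (reflected_volterra s)"
proof
  assume "surj (reflected_volterra s)"
  then obtain x where "ctsfun_of (\<lambda>_. 1) = reflected_volterra s x" by (metis surjD)
  moreover have "fn (reflected_volterra s x) 0 = 0" by simp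
  moreover have "fn (ctsfun_of (\<lambda>_. 1)) 0 = 1" by (rule fn_ctsfun_of) (auto intro: continuous_intros)
  ultimately show False by simp
qed

lemma compact_symmetric_reflected_volterra: "compact_symmetric (reflected_volterra s)"
  unfolding reflected_volterra_def
  by (intro compact_symmetric.intro bounded_linear_int_op int_op_symmetric int_op_compact continuous_kernel)
     (simp_all add: add.commute)

text \<open>The two combinations \<open>cosh d - sinh d' / s\<close> and \<open>cosh d' / s - sinh d\<close> have derivative zero;
  they are the coefficients \<open>A\<close> and \<open>B\<close>.\<close>
lemma homogeneous_solution:
  fixes d :: "real \<Rightarrow> real"
  assumes s: "s \<noteq> 0"
    and d: "\<And>t. t \<in> {a<..<b} \<Longrightarrow> (d has_real_derivative d' t) (at t)"
    and d': "\<And>t. t \<in> {a<..<b} \<Longrightarrow> (d' has_real_derivative s\<^sup>2 * d t) (at t)"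
  obtains A B where "\<And>t. t \<in> {a<..<b} \<Longrightarrow> d t = A * cosh (s * t) + B * sinh (s * t)"
proof -
  have "\<exists>A. \<forall>t\<in>{a<..<b}. cosh (s * t) * d t - sinh (s * t) * d' t / s = A"
  proof (rule has_field_derivative_zero_constant)
    fix t assume t: "t \<in> {a<..<b}"
    have "((\<lambda>t. cosh (s * t) * d t - sinh (s * t) * d' t / s) has_real_derivative 0) (at t)"
      by (rule derivative_eq_intros d[OF t] d'[OF t] refl s)+
         (use s in \<open>simp add: field_simps power2_eq_square\<close>)
    then show "((\<lambda>t. cosh (s * t) * d t - sinh (s * t) * d' t / s) has_real_derivative 0) (at t within {a<..<b})"
      by (rule DERIV_subset) simp
  qed simp
  then obtain A where A: "\<And>t. t \<in> {a<..<b} \<Longrightarrow> cosh (s * t) * d t - sinh (s * t) * d' t / s = A" by blast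
  have "\<exists>B. \<forall>t\<in>{a<..<b}. cosh (s * t) * d' t / s - sinh (s * t) * d t = B"
  proof (rule has_field_derivative_zero_constant)
    fix t assume t: "t \<in> {a<..<b}"
    have "((\<lambda>t. cosh (s * t) * d' t / s - sinh (s * t) * d t) has_real_derivative 0) (at t)"
      by (rule derivative_eq_intros d[OF t] d'[OF t] refl s)+
         (use s in \<open>simp add: field_simps power2_eq_square\<close>)
    then show "((\<lambda>t. cosh (s * t) * d' t / s - sinh (s * t) * d t) has_real_derivative 0) (at t within {a<..<b})"
      by (rule DERIV_subset) simp
  qed simp
  then obtain B where B: "\<And>t. t \<in> {a<..<b} \<Longrightarrow> cosh (s * t) * d' t / s - sinh (s * t) * d t = B" by blast
  show ?thesis
  proof (rule that)
    fix t assume t: "t \<in> {a<..<b}"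
    have "A * cosh (s * t) + B * sinh (s * t) = d t * ((cosh (s * t))\<^sup>2 - (sinh (s * t))\<^sup>2)"
      unfolding A[OF t, symmetric] B[OF t, symmetric] by (simp add: algebra_simps power2_eq_square)
    then show "d t = A * cosh (s * t) + B * sinh (s * t)" by (simp add: cosh_square_eq)
  qed
qed

text \<open>The derivative \<open>d'\<close> is not assumed to be continuous at \<open>0\<close>, so the initial conditions cannot
  be inserted into the constants of motion directly. The explicit form on the open interval shows
  what the value and the one-sided difference quotient at \<open>0\<close> mean for \<open>A\<close> and \<open>B\<close>.\<close>
lemma homogeneous_ivp_unique:
  fixes d :: "real \<Rightarrow> real"
  assumes s: "s \<noteq> 0"
    and d: "\<And>t. t \<in> {0<..<1} \<Longrightarrow> (d has_real_derivative d' t) (at t)"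
    and d': "\<And>t. t \<in> {0<..<1} \<Longrightarrow> (d' has_real_derivative s\<^sup>2 * d t) (at t)"
    and init: "d 0 = 0" "(d has_real_derivative 0) (at 0 within {0..<1})"
    and t: "t \<in> {0..<1}"
  shows "d t = 0"
proof -
  obtain A B where AB: "\<And>t. t \<in> {0<..<1} \<Longrightarrow> d t = A * cosh (s * t) + B * sinh (s * t)"
    using homogeneous_solution[OF s d d'] by blast
  have at0: "at 0 within {0..<1} = at_right (0::real)"
    by (rule at_within_nhd[of 0 "{-1<..<1}"]) auto
  have ev: "\<forall>\<^sub>F t in at_right 0. t \<in> {0<..<1::real}"
    by (rule eventually_at_right_real) simp
  have "(d \<longlongrightarrow> d 0) (at_right 0)"
    using DERIV_continuous[OF init(2)] unfolding at0 continuous_within .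
  then have "((\<lambda>t. A * cosh (s * t) + B * sinh (s * t)) \<longlongrightarrow> 0) (at_right 0)"
    unfolding init(1) by (rule Lim_transform_eventually) (use ev AB in \<open>auto elim!: eventually_mono\<close>)
  moreover have "((\<lambda>t. A * cosh (s * t) + B * sinh (s * t)) \<longlongrightarrow> A * cosh (s * 0) + B * sinh (s * 0)) (at_right 0)"
    by (intro tendsto_intros)
  ultimately have A: "A = 0" using tendsto_unique[OF trivial_limit_at_right_real] by fastforce
  have "((\<lambda>t. B * sinh (s * t)) has_real_derivative B * s) (at 0 within {0<..})"
    by (auto intro!: derivative_eq_intros)
  moreover have "((\<lambda>t. B * sinh (s * t)) has_real_derivative 0) (at 0 within {0<..})"
  proof -
    have "((\<lambda>t. (d t - d 0) / (t - 0)) \<longlongrightarrow> 0) (at_right 0)"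
      using init(2) unfolding at0 has_field_derivative_iff .
    then have "((\<lambda>t. (B * sinh (s * t) - B * sinh (s * 0)) / (t - 0)) \<longlongrightarrow> 0) (at_right 0)"
      by (rule Lim_transform_eventually) (use ev AB A init(1) in \<open>auto elim!: eventually_mono\<close>)
    then show ?thesis unfolding has_field_derivative_iff .
  qed
  ultimately have "B * s = 0"
    unfolding has_field_derivative_iff using tendsto_unique[OF trivial_limit_at_right_real] by blast
  then have "B = 0" using s by simp
  then show ?thesis using AB[of t] A t init(1) by (cases "t = 0") auto
qed

lemma reflected_volterra_ode_interior:
  assumes s: "s \<noteq> 0" and t: "t \<in> {0<..<1}"
  shows "(fn (reflected_volterra s x) has_real_derivative reflected_volterra_deriv s x t) (at t)"
    and "(reflected_volterra_deriv s x has_real_derivative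
      s\<^sup>2 * fn (reflected_volterra s x) t + fn x (1 - t)) (at t)"
proof -
  have "at t within {0..1} = at t" by (rule at_within_interior) (use t in simp)
  then show "(fn (reflected_volterra s x) has_real_derivative reflected_volterra_deriv s x t) (at t)"
    "(reflected_volterra_deriv s x has_real_derivative
      s\<^sup>2 * fn (reflected_volterra s x) t + fn x (1 - t)) (at t)"
    using reflected_volterra_ode[OF s, of t x] t by auto
qed

lemma reflected_volterra_has_deriv_half_open:
  assumes "s \<noteq> 0" "t \<in> {0..<1}"
  shows "(fn (reflected_volterra s x) has_real_derivative reflected_volterra_deriv s x t) (at t within {0..<1})"
  by (rule DERIV_subset[OF reflected_volterra_has_deriv]) (use assms in auto)

theorem ivp_solution_unique:
  fixes f F :: "real \<Rightarrow> real"
  assumes s: "s \<noteq> 0"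
    and f: "\<And>t. t \<in> {0<..<1} \<Longrightarrow> (f has_real_derivative f' t) (at t)"
    and f': "\<And>t. t \<in> {0<..<1} \<Longrightarrow> (f' has_real_derivative s\<^sup>2 * f t + F (1 - t)) (at t)"
    and init: "f 0 = 0" "(f has_real_derivative 0) (at 0 within {0..<1})"
    and F: "continuous_on {0..1} F" and t: "t \<in> {0..<1}"
  shows "f t = fn (reflected_volterra s (ctsfun_of F)) t"
proof -
  define D where "D = reflected_volterra_deriv s (ctsfun_of F)"
  note D = reflected_volterra_ode_interior[OF s, of _ "ctsfun_of F", folded D_def]
  have D_0: "(fn (reflected_volterra s (ctsfun_of F)) has_real_derivative 0) (at 0 within {0..<1})"
    using reflected_volterra_has_deriv_half_open[OF s, of 0 "ctsfun_of F"] by simp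
  have "f t - fn (reflected_volterra s (ctsfun_of F)) t = 0"
  proof (rule homogeneous_ivp_unique[OF s _ _ _ _ t, of _ "\<lambda>t. f' t - D t"])
    fix t :: real assume t: "t \<in> {0<..<1}"
    show "((\<lambda>t. f t - fn (reflected_volterra s (ctsfun_of F)) t) has_real_derivative f' t - D t) (at t)"
      by (intro derivative_intros f D t)
    have "((\<lambda>t. f' t - D t) has_real_derivative (s\<^sup>2 * f t + F (1 - t))
        - (s\<^sup>2 * fn (reflected_volterra s (ctsfun_of F)) t + fn (ctsfun_of F) (1 - t))) (at t)"
      by (intro derivative_intros f' D t)
    then show "((\<lambda>t. f' t - D t) has_real_derivative s\<^sup>2 * (f t - fn (reflected_volterra s (ctsfun_of F)) t)) (at t)"
      using t F by (simp add: right_diff_distrib)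
  next
    show "((\<lambda>t. f t - fn (reflected_volterra s (ctsfun_of F)) t) has_real_derivative 0) (at 0 within {0..<1})"
      using DERIV_diff[OF init(2) D_0] by simp
  qed (use init in simp)
  then show ?thesis by simp
qed

text \<open>Solutions on a half-open interval extend continuously to its right end. For \<open>t\<close> near \<open>1\<close> the
  reflected argument \<open>1 - t\<close> is near \<open>0\<close>; therefore continuity of \<open>F\<close> on the left half of the
  interval is enough, and \<open>F\<close> may be a multiple of \<open>f\<close> itself.\<close>
lemma inhomogeneous_solution_limit:
  fixes f F :: "real \<Rightarrow> real"
  assumes s: "s \<noteq> 0"
    and f: "\<And>t. t \<in> {1/2<..<1} \<Longrightarrow> (f has_real_derivative f' t) (at t)"
    and f': "\<And>t. t \<in> {1/2<..<1} \<Longrightarrow> (f' has_real_derivative s\<^sup>2 * f t + F (1 - t)) (at t)"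
    and F: "continuous_on {0..1/2} F"
  shows "\<exists>l. (f \<longlongrightarrow> l) (at_left 1)"
proof -
  \<comment> \<open>A continuous function on the whole interval with \<open>G (1 - t) = F (1 - t)\<close> for \<open>t > 1/2\<close>: the
    difference between \<open>f\<close> and the solution for \<open>G\<close> is a combination of \<open>cosh\<close> and \<open>sinh\<close> there.\<close>
  define G where "G r = F (min (1/2) r)" for r
  have G: "continuous_on {0..1} G" unfolding G_def
    by (rule continuous_on_compose2[OF F]) (auto intro!: continuous_intros)
  define y where "y = fn (reflected_volterra s (ctsfun_of G))"
  define D where "D = reflected_volterra_deriv s (ctsfun_of G)"
  note D = reflected_volterra_ode_interior[OF s, of _ "ctsfun_of G", folded D_def y_def]
  obtain A B where AB: "\<And>t. t \<in> {1/2<..<1} \<Longrightarrow> f t - y t = A * cosh (s * t) + B * sinh (s * t)"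
  proof (rule homogeneous_solution[OF s, of "1/2" 1 "\<lambda>t. f t - y t" "\<lambda>t. f' t - D t"])
    fix t :: real assume t: "t \<in> {1/2<..<1}"
    then have t': "t \<in> {0<..<1}" by auto
    show "((\<lambda>t. f t - y t) has_real_derivative f' t - D t) (at t)"
      by (intro derivative_intros f D t t')
    have "((\<lambda>t. f' t - D t) has_real_derivative (s\<^sup>2 * f t + F (1 - t)) - (s\<^sup>2 * y t + fn (ctsfun_of G) (1 - t))) (at t)"
      by (intro derivative_intros f' D t t')
    moreover have "fn (ctsfun_of G) (1 - t) = F (1 - t)" using t G by (simp add: G_def)
    ultimately show "((\<lambda>t. f' t - D t) has_real_derivative s\<^sup>2 * (f t - y t)) (at t)"
      by (simp add: right_diff_distrib)
  qed blast
  have "continuous_on {0..1} y" unfolding y_def by (rule continuous_on_fn)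
  then have "(y \<longlongrightarrow> y 1) (at 1 within {0..1})" by (simp add: continuous_on_def)
  then have yl: "(y \<longlongrightarrow> y 1) (at_left 1)" by (simp add: at_within_Icc_at_left)
  have "((\<lambda>t. y t + (A * cosh (s * t) + B * sinh (s * t))) \<longlongrightarrow> y 1 + (A * cosh (s * 1) + B * sinh (s * 1))) (at_left 1)"
    by (intro tendsto_intros yl)
  moreover have "\<forall>\<^sub>F t in at_left 1. t \<in> {1/2<..<1::real}"
    by (rule eventually_at_left_real) simp
  then have "\<forall>\<^sub>F t in at_left 1. y t + (A * cosh (s * t) + B * sinh (s * t)) = f t"
    by eventually_elim (use AB in \<open>auto simp: algebra_simps\<close>)
  ultimately show ?thesis using Lim_transform_eventually by blast
qed

section \<open>Square integrable functions\<close>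

lemma L2_measurable: "f \<in> L2 M \<Longrightarrow> f \<in> borel_measurable M"
  and L2_integrable: "f \<in> L2 M \<Longrightarrow> integrable M (\<lambda>x. (cmod (f x))\<^sup>2)"
  by (simp_all add: L2_def)

lemma borel_measurable_cnj [measurable (raw)]:
  "f \<in> borel_measurable M \<Longrightarrow> (\<lambda>x. cnj (f x)) \<in> borel_measurable M"
  by (rule measurable_compose[OF _ borel_measurable_continuous_onI]) (auto intro: continuous_intros)

lemma cmod_mult_cnj_le: "cmod (a * cnj b) \<le> (cmod a)\<^sup>2 + (cmod b)\<^sup>2"
proof -
  have "0 \<le> (cmod a - cmod b)\<^sup>2" by simp
  then have "2 * (cmod a * cmod b) \<le> (cmod a)\<^sup>2 + (cmod b)\<^sup>2"
    by (simp add: power2_diff)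
  moreover have "0 \<le> cmod a * cmod b" by simp
  ultimately have "cmod a * cmod b \<le> (cmod a)\<^sup>2 + (cmod b)\<^sup>2" by linarith
  then show ?thesis by (simp add: norm_mult)
qed

text \<open>This weak form of the triangle inequality holds pointwise and survives integration, which
  is all that the approximation arguments need.\<close>
lemma cmod_add_squared_le: "(cmod (a + b))\<^sup>2 \<le> 2 * (cmod a)\<^sup>2 + 2 * (cmod b)\<^sup>2"
proof -
  have "(cmod (a + b))\<^sup>2 \<le> (cmod a + cmod b)\<^sup>2" by (intro power_mono norm_triangle_ineq) simp
  moreover have "0 \<le> (cmod a - cmod b)\<^sup>2" by simp
  ultimately show ?thesis unfolding power2_sum power2_diff by linarith
qed

lemma L2_zero [simp]: "(\<lambda>_. 0) \<in> L2 M"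
  by (simp add: L2_def)

lemma L2_mult_left: "f \<in> L2 M \<Longrightarrow> (\<lambda>x. c * f x) \<in> L2 M"
  by (auto simp: L2_def norm_mult power_mult_distrib)

lemma L2_add:
  assumes "f \<in> L2 M" "g \<in> L2 M"
  shows "(\<lambda>x. f x + g x) \<in> L2 M"
proof -
  note [measurable] = assms[THEN L2_measurable]
  have "integrable M (\<lambda>x. (cmod (f x + g x))\<^sup>2)"
    by (rule Bochner_Integration.integrable_bound[of M "\<lambda>x. 2 * (cmod (f x))\<^sup>2 + 2 * (cmod (g x))\<^sup>2"])
       (use assms in \<open>auto simp: L2_integrable intro: cmod_add_squared_le\<close>)
  then show ?thesis by (simp add: L2_def)
qed

lemma L2_diff: "f \<in> L2 M \<Longrightarrow> g \<in> L2 M \<Longrightarrow> (\<lambda>x. f x - g x) \<in> L2 M"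
  using L2_add[of f M "\<lambda>x. (-1) * g x"] L2_mult_left[of g M "-1"] by simp

lemma L2_sum: "(\<And>i. i \<in> I \<Longrightarrow> f i \<in> L2 M) \<Longrightarrow> (\<lambda>x. \<Sum>i\<in>I. f i x) \<in> L2 M"
  by (induction I rule: infinite_finite_induct) (auto intro: L2_add)

lemma L2_bounded:
  assumes "finite_measure M" "f \<in> borel_measurable M" "\<And>x. x \<in> space M \<Longrightarrow> cmod (f x) \<le> B"
  shows "f \<in> L2 M"
proof -
  have "integrable M (\<lambda>x. (cmod (f x))\<^sup>2)"
    by (rule finite_measure.integrable_const_bound[of M _ "B\<^sup>2"])
       (use assms in \<open>auto intro!: AE_I2 power_mono\<close>)
  then show ?thesis using assms by (simp add: L2_def)
qed

lemma integrable_l2inner: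
  assumes "f \<in> L2 M" "g \<in> L2 M"
  shows "integrable M (\<lambda>x. f x * cnj (g x))"
proof -
  note [measurable] = assms[THEN L2_measurable]
  show ?thesis
    by (rule Bochner_Integration.integrable_bound[of M "\<lambda>x. (cmod (f x))\<^sup>2 + (cmod (g x))\<^sup>2"])
       (use assms in \<open>auto simp: L2_integrable simp del: complex_mod_cnj norm_mult intro: cmod_mult_cnj_le\<close>)
qed

lemma l2inner_add_left:
  "f \<in> L2 M \<Longrightarrow> g \<in> L2 M \<Longrightarrow> h \<in> L2 M \<Longrightarrow>
    l2inner M (\<lambda>x. f x + g x) h = l2inner M f h + l2inner M g h"
  by (simp add: l2inner_def distrib_right integrable_l2inner)

lemma l2inner_diff_left:
  "f \<in> L2 M \<Longrightarrow> g \<in> L2 M \<Longrightarrow> h \<in> L2 M \<Longrightarrow>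
    l2inner M (\<lambda>x. f x - g x) h = l2inner M f h - l2inner M g h"
  by (simp add: l2inner_def left_diff_distrib integrable_l2inner)

lemma l2inner_mult_left: "l2inner M (\<lambda>x. c * f x) h = c * l2inner M f h"
  by (simp add: l2inner_def mult.assoc)

lemma l2inner_cnj: "cnj (l2inner M f g) = l2inner M g f"
proof -
  have "l2inner M g f = (LINT x|M. cnj (f x * cnj (g x)))"
    by (simp add: l2inner_def mult.commute del: Bochner_Integration.integral_cnj)
  also have "\<dots> = cnj (l2inner M f g)" unfolding l2inner_def by (rule Bochner_Integration.integral_cnj)
  finally show ?thesis by simp
qed

lemma l2inner_sum_left:
  assumes "\<And>i. i \<in> I \<Longrightarrow> f i \<in> L2 M" "h \<in> L2 M"
  shows "l2inner M (\<lambda>x. \<Sum>i\<in>I. f i x) h = (\<Sum>i\<in>I. l2inner M (f i) h)"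
  unfolding l2inner_def using assms by (simp add: sum_distrib_right integrable_l2inner)

lemma l2inner_cong_AE:
  assumes "f \<in> borel_measurable M" "f' \<in> borel_measurable M" "g \<in> borel_measurable M"
    and "AE x in M. f x = f' x"
  shows "l2inner M f g = l2inner M f' g"
proof -
  note [measurable] = assms(1-3)
  show ?thesis unfolding l2inner_def by (rule integral_cong_AE) (use assms(4) in auto)
qed

lemma l2norm_nonneg: "0 \<le> l2norm M f"
  by (simp add: l2norm_def)

lemma l2norm_squared: "(l2norm M f)\<^sup>2 = (LINT x|M. (cmod (f x))\<^sup>2)"
  by (simp add: l2norm_def)

lemma l2norm_squared_eq_l2inner: "complex_of_real ((l2norm M f)\<^sup>2) = l2inner M f f"
  unfolding l2norm_squared l2inner_def
  by (subst integral_complex_of_real[symmetric]) (simp only: complex_norm_square)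

lemma l2norm_cong_AE:
  assumes "f \<in> borel_measurable M" "f' \<in> borel_measurable M" "AE x in M. f x = f' x"
  shows "l2norm M f = l2norm M f'"
  unfolding l2norm_def by (rule arg_cong[of _ _ sqrt], rule integral_cong_AE) (use assms in auto)

lemma l2norm_mult_left: "l2norm M (\<lambda>x. c * f x) = cmod c * l2norm M f"
  by (simp add: l2norm_def norm_mult power_mult_distrib real_sqrt_mult)

lemma l2norm_add_squared_le:
  assumes "f \<in> L2 M" "g \<in> L2 M"
  shows "(l2norm M (\<lambda>x. f x + g x))\<^sup>2 \<le> 2 * (l2norm M f)\<^sup>2 + 2 * (l2norm M g)\<^sup>2"
proof -
  have "(LINT x|M. (cmod (f x + g x))\<^sup>2) \<le> (LINT x|M. 2 * (cmod (f x))\<^sup>2 + 2 * (cmod (g x))\<^sup>2)"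
    by (intro integral_mono cmod_add_squared_le) (use assms L2_add[OF assms] in \<open>auto simp: L2_integrable\<close>)
  then show ?thesis using assms by (simp add: l2norm_squared L2_integrable)
qed

lemma l2norm_zero_AE:
  assumes "f \<in> L2 M" "l2norm M f = 0"
  shows "AE x in M. f x = 0"
proof -
  have "(LINT x|M. (cmod (f x))\<^sup>2) = 0" using assms(2) l2norm_squared[of M f] by simp
  then show ?thesis
    using integral_nonneg_eq_0_iff_AE[OF L2_integrable[OF assms(1)]] by simp
qed

section \<open>Orthonormal systems\<close>

definition orthonormal_system :: "'a measure \<Rightarrow> ('i \<Rightarrow> 'a \<Rightarrow> complex) \<Rightarrow> bool" where
  "orthonormal_system M \<phi> \<longleftrightarrow>
     (\<forall>i. \<phi> i \<in> L2 M) \<and> (\<forall>i j. l2inner M (\<phi> i) (\<phi> j) = (if i = j then 1 else 0))"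

lemma complete_orthonormal_system_imp: "complete_orthonormal_system M \<phi> \<Longrightarrow> orthonormal_system M \<phi>"
  by (simp add: complete_orthonormal_system_def orthonormal_system_def)

lemma orthonormal_system_L2: "orthonormal_system M \<phi> \<Longrightarrow> \<phi> i \<in> L2 M"
  by (simp add: orthonormal_system_def)

lemma orthonormal_system_l2norm: "orthonormal_system M \<phi> \<Longrightarrow> l2norm M (\<phi> i) = 1"
proof -
  assume "orthonormal_system M \<phi>"
  then have "complex_of_real ((l2norm M (\<phi> i))\<^sup>2) = 1"
    unfolding l2norm_squared_eq_l2inner by (simp add: orthonormal_system_def)
  then have "(l2norm M (\<phi> i))\<^sup>2 = 1" by (metis of_real_eq_1_iff)
  then show ?thesis using l2norm_nonneg[of M "\<phi> i"] by (simp add: power2_eq_1_iff)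
qed

text \<open>Pythagoras with explicit error terms. It shows both that the Fourier coefficients give the
  best approximation and what the distance to the finite-dimensional span is.\<close>
theorem l2norm_diff_sum_squared:
  assumes on: "orthonormal_system M \<phi>" and f: "f \<in> L2 M" and F: "finite F"
  shows "(l2norm M (\<lambda>x. f x - (\<Sum>i\<in>F. c i * \<phi> i x)))\<^sup>2 =
    (l2norm M f)\<^sup>2 - (\<Sum>i\<in>F. (cmod (l2inner M f (\<phi> i)))\<^sup>2) + (\<Sum>i\<in>F. (cmod (c i - l2inner M f (\<phi> i)))\<^sup>2)"
proof -
  define S where "S x = (\<Sum>i\<in>F. c i * \<phi> i x)" for x
  define a where "a i = l2inner M f (\<phi> i)" for i
  have S: "S \<in> L2 M" unfolding S_def by (intro L2_sum L2_mult_left orthonormal_system_L2[OF on])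
  have sl: "l2inner M S h = (\<Sum>i\<in>F. c i * l2inner M (\<phi> i) h)" if "h \<in> L2 M" for h
    unfolding S_def
    by (subst l2inner_sum_left)
       (auto intro: L2_mult_left orthonormal_system_L2[OF on] that simp: l2inner_mult_left)
  have Sf: "l2inner M S f = (\<Sum>i\<in>F. c i * cnj (a i))"
    unfolding a_def l2inner_cnj by (rule sl[OF f])
  have fS: "l2inner M f S = (\<Sum>i\<in>F. cnj (c i) * a i)"
    unfolding l2inner_cnj[of M S f, symmetric] Sf by simp
  have phiS: "l2inner M (\<phi> i) S = cnj (c i)" if "i \<in> F" for i
  proof -
    have "l2inner M S (\<phi> i) = (\<Sum>j\<in>F. c j * (if j = i then 1 else 0))"
      unfolding sl[OF orthonormal_system_L2[OF on]] using on by (simp add: orthonormal_system_def)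
    also have "\<dots> = c i" using that F by (simp add: if_distrib cong: if_cong)
    finally show ?thesis unfolding l2inner_cnj[of M S "\<phi> i", symmetric] by simp
  qed
  have SS: "l2inner M S S = (\<Sum>i\<in>F. c i * cnj (c i))"
    unfolding sl[OF S] by (simp add: phiS)
  have "complex_of_real ((l2norm M (\<lambda>x. f x - S x))\<^sup>2)
      = l2inner M f (\<lambda>x. f x - S x) - l2inner M S (\<lambda>x. f x - S x)"
    unfolding l2norm_squared_eq_l2inner by (rule l2inner_diff_left[OF f S L2_diff[OF f S]])
  also have "l2inner M f (\<lambda>x. f x - S x) = l2inner M f f - l2inner M f S"
    using arg_cong[OF l2inner_diff_left[OF f S f], of cnj] by (simp add: l2inner_cnj)
  also have "l2inner M S (\<lambda>x. f x - S x) = l2inner M S f - l2inner M S S"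
    using arg_cong[OF l2inner_diff_left[OF f S S], of cnj] by (simp add: l2inner_cnj)
  also have "l2inner M f f - l2inner M f S - (l2inner M S f - l2inner M S S)
     = complex_of_real ((l2norm M f)\<^sup>2) + (\<Sum>i\<in>F. c i * cnj (c i) - cnj (c i) * a i - c i * cnj (a i))"
    unfolding l2norm_squared_eq_l2inner fS Sf SS by (simp add: sum_subtractf)
  also have "\<dots> = complex_of_real ((l2norm M f)\<^sup>2) + (\<Sum>i\<in>F. of_real ((cmod (c i - a i))\<^sup>2 - (cmod (a i))\<^sup>2))"
    by (rule arg_cong2[of _ _ _ _ "(+)", OF refl], rule sum.cong)
       (simp_all add: complex_norm_square algebra_simps del: of_real_power)
  also have "\<dots> = of_real ((l2norm M f)\<^sup>2 + (\<Sum>i\<in>F. (cmod (c i - a i))\<^sup>2 - (cmod (a i))\<^sup>2))" by simp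
  finally have "(l2norm M (\<lambda>x. f x - S x))\<^sup>2 = (l2norm M f)\<^sup>2 + (\<Sum>i\<in>F. (cmod (c i - a i))\<^sup>2 - (cmod (a i))\<^sup>2)"
    unfolding of_real_eq_iff .
  then show ?thesis unfolding S_def a_def by (simp add: sum_subtractf)
qed

lemma bessel_inequality:
  assumes "orthonormal_system M \<phi>" "f \<in> L2 M" "finite F"
  shows "(\<Sum>i\<in>F. (cmod (l2inner M f (\<phi> i)))\<^sup>2) \<le> (l2norm M f)\<^sup>2"
  using l2norm_diff_sum_squared[OF assms, of "\<lambda>i. l2inner M f (\<phi> i)"]
    zero_le_power2[of "l2norm M (\<lambda>x. f x - (\<Sum>i\<in>F. l2inner M f (\<phi> i) * \<phi> i x))"]
  by simp

lemma cmod_l2inner_le: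
  assumes "orthonormal_system M \<phi>" "f \<in> L2 M"
  shows "cmod (l2inner M f (\<phi> i)) \<le> l2norm M f"
  by (rule power2_le_imp_le[OF _ l2norm_nonneg]) (use bessel_inequality[OF assms, of "{i}"] in simp)

text \<open>Completeness in terms of coefficients alone. Unlike approximation by finite combinations, this
  form can be integrated over a parameter, and it does not refer to limits in \<open>L\<^sub>2\<close>.\<close>
theorem complete_iff_parseval:
  "complete_orthonormal_system M \<phi> \<longleftrightarrow> orthonormal_system M \<phi> \<and>
    (\<forall>f\<in>L2 M. \<forall>\<epsilon>>0. \<exists>F. finite F \<and> (l2norm M f)\<^sup>2 - \<epsilon> < (\<Sum>i\<in>F. (cmod (l2inner M f (\<phi> i)))\<^sup>2))"
  (is "_ \<longleftrightarrow> _ \<and> ?parseval")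
proof (intro iffI conjI)
  assume c: "complete_orthonormal_system M \<phi>"
  then show on: "orthonormal_system M \<phi>" by (rule complete_orthonormal_system_imp)
  show ?parseval
  proof (intro ballI allI impI)
    fix f and \<epsilon> :: real assume f: "f \<in> L2 M" and e: "\<epsilon> > 0"
    then have "\<exists>F c. finite F \<and> l2norm M (\<lambda>x. f x - (\<Sum>i\<in>F. c i * \<phi> i x)) < sqrt \<epsilon>"
      using c[unfolded complete_orthonormal_system_def, THEN conjunct2, THEN conjunct2, rule_format, of f "sqrt \<epsilon>"]
      by simp
    then obtain F c where F: "finite F" "l2norm M (\<lambda>x. f x - (\<Sum>i\<in>F. c i * \<phi> i x)) < sqrt \<epsilon>"
      by blast
    have "(l2norm M (\<lambda>x. f x - (\<Sum>i\<in>F. c i * \<phi> i x)))\<^sup>2 < (sqrt \<epsilon>)\<^sup>2"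
      by (rule power_strict_mono[OF F(2) l2norm_nonneg]) simp
    moreover have "0 \<le> (\<Sum>i\<in>F. (cmod (c i - l2inner M f (\<phi> i)))\<^sup>2)" by (simp add: sum_nonneg)
    ultimately have "(l2norm M f)\<^sup>2 - \<epsilon> < (\<Sum>i\<in>F. (cmod (l2inner M f (\<phi> i)))\<^sup>2)"
      using l2norm_diff_sum_squared[OF on f F(1), of c] e by simp
    then show "\<exists>F. finite F \<and> (l2norm M f)\<^sup>2 - \<epsilon> < (\<Sum>i\<in>F. (cmod (l2inner M f (\<phi> i)))\<^sup>2)"
      using F(1) by blast
  qed
next
  assume a: "orthonormal_system M \<phi> \<and> ?parseval"
  then have on: "orthonormal_system M \<phi>" by blast
  show "complete_orthonormal_system M \<phi>"
    unfolding complete_orthonormal_system_def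
  proof (intro conjI ballI allI impI)
    fix f and \<epsilon> :: real assume f: "f \<in> L2 M" and e: "\<epsilon> > 0"
    then have "\<epsilon>\<^sup>2 > 0" by simp
    then obtain F where F: "finite F" "(l2norm M f)\<^sup>2 - \<epsilon>\<^sup>2 < (\<Sum>i\<in>F. (cmod (l2inner M f (\<phi> i)))\<^sup>2)"
      using a f by blast
    have "(l2norm M (\<lambda>x. f x - (\<Sum>i\<in>F. l2inner M f (\<phi> i) * \<phi> i x)))\<^sup>2 < \<epsilon>\<^sup>2"
      using l2norm_diff_sum_squared[OF on f F(1), of "\<lambda>i. l2inner M f (\<phi> i)"] F(2) by simp
    then have "l2norm M (\<lambda>x. f x - (\<Sum>i\<in>F. l2inner M f (\<phi> i) * \<phi> i x)) < \<epsilon>"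
      using e by (meson less_imp_le power2_less_imp_less)
    then show "\<exists>F c. finite F \<and> l2norm M (\<lambda>x. f x - (\<Sum>i\<in>F. c i * \<phi> i x)) < \<epsilon>"
      by (intro exI[of _ F] exI[of _ "\<lambda>i. l2inner M f (\<phi> i)"] conjI F(1))
  qed (use on in \<open>auto simp: orthonormal_system_def\<close>)
qed

lemma complete_orthogonal_zero:
  assumes c: "complete_orthonormal_system M \<phi>" and f: "f \<in> L2 M" and "\<And>i. l2inner M f (\<phi> i) = 0"
  shows "AE x in M. f x = 0"
proof -
  have "(l2norm M f)\<^sup>2 \<le> 0 + \<epsilon>" if "\<epsilon> > 0" for \<epsilon>
    using c f that assms(3) unfolding complete_iff_parseval by force
  then have "(l2norm M f)\<^sup>2 \<le> 0" by (rule field_le_epsilon)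
  then show ?thesis by (intro l2norm_zero_AE f) simp
qed

lemma parseval_tendsto:
  fixes \<phi> :: "nat \<Rightarrow> 'a \<Rightarrow> complex"
  assumes c: "complete_orthonormal_system M \<phi>" and f: "f \<in> L2 M"
  shows "(\<lambda>n. \<Sum>i<n. (cmod (l2inner M f (\<phi> i)))\<^sup>2) \<longlonglongrightarrow> (l2norm M f)\<^sup>2"
proof (rule LIMSEQ_I)
  fix e :: real assume "e > 0"
  then obtain F where F: "finite F" "(l2norm M f)\<^sup>2 - e < (\<Sum>i\<in>F. (cmod (l2inner M f (\<phi> i)))\<^sup>2)"
    using c f unfolding complete_iff_parseval by blast
  obtain N where N: "F \<subseteq> {..<N}" using F(1) finite_nat_iff_bounded by blast
  have "norm ((\<Sum>i<n. (cmod (l2inner M f (\<phi> i)))\<^sup>2) - (l2norm M f)\<^sup>2) < e" if "n \<ge> N" for n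
  proof -
    have "F \<subseteq> {..<n}" using N that by auto
    then have "(\<Sum>i\<in>F. (cmod (l2inner M f (\<phi> i)))\<^sup>2) \<le> (\<Sum>i<n. (cmod (l2inner M f (\<phi> i)))\<^sup>2)"
      by (intro sum_mono2) auto
    moreover have "(\<Sum>i<n. (cmod (l2inner M f (\<phi> i)))\<^sup>2) \<le> (l2norm M f)\<^sup>2"
      by (rule bessel_inequality[OF complete_orthonormal_system_imp[OF c] f]) simp
    ultimately show ?thesis using F(2) by simp
  qed
  then show "\<exists>N. \<forall>n\<ge>N. norm ((\<Sum>i<n. (cmod (l2inner M f (\<phi> i)))\<^sup>2) - (l2norm M f)\<^sup>2) < e" by blast
qed

section \<open>Density of continuous functions in $L_2(0,1)$\<close>

lemma finite_measure_unit_interval: "finite_measure (leb {0<..<1::real})"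
proof (rule finite_measureI)
  have "emeasure (leb {0<..<1::real}) (space (leb {0<..<1})) = emeasure lborel {0<..<1::real}"
    by (subst emeasure_restrict_space) (auto simp: space_restrict_space)
  then show "emeasure (leb {0<..<1::real}) (space (leb {0<..<1})) \<noteq> \<infinity>" by simp
qed

lemma integral_unit_interval:
  fixes g :: "real \<Rightarrow> real"
  assumes g: "continuous_on {0..1} g"
  shows "integrable (leb {0<..<1}) g"
    and "(LINT t|leb {0<..<1}. g t) = integral {0..1} g"
proof -
  have "set_integrable lborel {0<..<1} g"
    by (rule set_integrable_subset[OF borel_integrable_atLeastAtMost'[OF g]]) auto
  then show "integrable (leb {0<..<1}) g" "(LINT t|leb {0<..<1}. g t) = integral {0..1} g"
    using set_borel_integral_eq_integral(2)[of "{0<..<1}" g]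
    by (simp_all add: integrable_restrict_space integral_restrict_space set_integrable_def
        set_lebesgue_integral_def integral_open_interval_real)
qed

lemma borel_measurable_unit_interval:
  assumes "continuous_on {0<..<1} f"
  shows "f \<in> borel_measurable (leb {0<..<1::real})"
proof -
  have "sets (leb {0<..<1::real}) = sets (restrict_space borel {0<..<1})"
    by (rule sets_restrict_space_cong) simp
  from measurable_cong_sets[OF this refl] show ?thesis
    using borel_measurable_continuous_on_restrict[OF assms] by blast
qed

text \<open>Radial retraction of the plane onto the disc of radius \<open>n\<close>.\<close>
definition clamp_norm :: "real \<Rightarrow> complex \<Rightarrow> complex" where
  "clamp_norm n z = of_real (n / max n (cmod z)) * z"

lemma clamp_norm:
  assumes "n > 0"
  shows "cmod (clamp_norm n z) \<le> n" "cmod z \<le> n \<Longrightarrow> clamp_norm n z = z"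
    "continuous_on S (clamp_norm n)"
proof -
  show "cmod (clamp_norm n z) \<le> n"
  proof -
    have "cmod (clamp_norm n z) = n * (cmod z / max n (cmod z))"
      using assms by (simp add: clamp_norm_def norm_mult norm_divide abs_of_pos max.strict_coboundedI1)
    also have "\<dots> \<le> n * 1" by (intro mult_left_mono) (use assms in \<open>auto simp: divide_le_eq_1 max_def\<close>)
    finally show ?thesis by simp
  qed
  show "cmod z \<le> n \<Longrightarrow> clamp_norm n z = z"
    using assms by (simp add: clamp_norm_def max_absorb1)
  show "continuous_on S (clamp_norm n)"
    unfolding clamp_norm_def using assms by (intro continuous_intros) auto
qed

lemma L2_truncation:
  assumes f: "f \<in> L2 M" and e: "0 < e"
  obtains n where "n > 0" "(l2norm M (\<lambda>x. f x - (if cmod (f x) \<le> n then f x else 0)))\<^sup>2 < e"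
proof -
  note [measurable] = L2_measurable[OF f]
  define g where "g n x = (if cmod (f x) \<le> real (Suc n) then f x else 0)" for n x
  have "(\<lambda>n. LINT x|M. (cmod (f x - g n x))\<^sup>2) \<longlonglongrightarrow> (LINT x|M. 0)"
  proof (rule integral_dominated_convergence[OF _ _ L2_integrable[OF f]])
    show "(\<lambda>x. (cmod (f x - g n x))\<^sup>2) \<in> borel_measurable M" for n
      unfolding g_def by measurable
    show "AE x in M. (\<lambda>n. (cmod (f x - g n x))\<^sup>2) \<longlonglongrightarrow> 0"
    proof (rule AE_I2, rule tendsto_eventually)
      fix x
      obtain N where N: "cmod (f x) \<le> real N" using real_arch_simple by blast
      show "\<forall>\<^sub>F n in sequentially. (cmod (f x - g n x))\<^sup>2 = 0"
        using eventually_ge_at_top[of N] by eventually_elim (use N in \<open>auto simp: g_def\<close>)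
    qed
    show "AE x in M. norm ((cmod (f x - g n x))\<^sup>2) \<le> (cmod (f x))\<^sup>2" for n
      by (rule AE_I2) (simp add: g_def)
  qed simp
  then have "(\<lambda>n. (l2norm M (\<lambda>x. f x - g n x))\<^sup>2) \<longlonglongrightarrow> 0"
    by (simp add: l2norm_squared)
  from order_tendstoD(2)[OF this e]
  obtain n where "(l2norm M (\<lambda>x. f x - g n x))\<^sup>2 < e"
    by (auto dest: eventually_happens)
  then show ?thesis using that[of "real (Suc n)"] by (simp add: g_def)
qed

text \<open>A measurable function is almost everywhere a limit of continuous ones. Composing these with
  the retraction onto a disc makes them uniformly bounded, as dominated convergence requires.\<close>
lemma bounded_limit_of_continuous:
  fixes g :: "real \<Rightarrow> complex"
  assumes g: "g \<in> borel_measurable (leb {0<..<1})" and n: "n > 0" and b: "\<And>x. cmod (g x) \<le> n"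
  obtains h where "\<And>m::nat. continuous_on UNIV (h m)" "\<And>m x. cmod (h m x) \<le> n"
    "AE x in leb {0<..<1}. (\<lambda>m. h m x) \<longlonglongrightarrow> g x"
proof -
  let ?I = "{0<..<1::real}"
  have "(\<lambda>x. indicator ?I x *\<^sub>R g x) \<in> borel_measurable lborel"
    using g by (simp add: borel_measurable_restrict_space_iff)
  then have "(\<lambda>x. indicator ?I x *\<^sub>R g x) \<in> borel_measurable lebesgue"
    by (rule measurable_completion)
  then have "g \<in> borel_measurable (lebesgue_on ?I)"
    by (simp add: borel_measurable_restrict_space_iff)
  then have "g measurable_on ?I" by (simp add: measurable_on_iff_borel_measurable)
  then obtain N k where N: "negligible N" and k: "\<And>m. continuous_on UNIV (k m)"
    and lim: "\<And>x. x \<notin> N \<Longrightarrow> (\<lambda>m. k m x) \<longlonglongrightarrow> (if x \<in> ?I then g x else 0)"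
    unfolding measurable_on_def by blast
  have "AE x in lebesgue. x \<notin> N" using N by (intro AE_not_in) (simp add: negligible_iff_null_sets)
  then have N': "AE x in lborel. x \<notin> N" by (simp add: AE_completion_iff)
  show ?thesis
  proof (rule that[of "\<lambda>m x. clamp_norm n (k m x)"])
    show "continuous_on UNIV (\<lambda>x. clamp_norm n (k m x))" for m
      by (rule continuous_on_compose2[OF clamp_norm(3)[OF n, of UNIV] k]) simp
    show "cmod (clamp_norm n (k m x)) \<le> n" for m x by (rule clamp_norm(1)[OF n])
    have "(\<lambda>m. clamp_norm n (k m x)) \<longlonglongrightarrow> g x" if "x \<in> ?I" "x \<notin> N" for x
    proof -
      have "isCont (clamp_norm n) (g x)"
        using clamp_norm(3)[OF n, of UNIV] by (simp add: continuous_on_eq_continuous_at)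
      moreover have "(\<lambda>m. k m x) \<longlonglongrightarrow> g x" using lim[OF that(2)] that(1) by simp
      ultimately have "(\<lambda>m. clamp_norm n (k m x)) \<longlonglongrightarrow> clamp_norm n (g x)"
        by (rule isCont_tendsto_compose)
      then show ?thesis using clamp_norm(2)[OF n b] by simp
    qed
    then show "AE x in leb ?I. (\<lambda>m. clamp_norm n (k m x)) \<longlonglongrightarrow> g x"
      using N' by (subst AE_restrict_space_iff) auto
  qed
qed

text \<open>First truncate, then approximate the bounded function; both steps are dominated convergence.\<close>
theorem continuous_dense_L2:
  assumes f: "f \<in> L2 (leb {0<..<1::real})" and e: "0 < e"
  obtains h where "continuous_on UNIV h" "(l2norm (leb {0<..<1}) (\<lambda>x. f x - h x))\<^sup>2 < e"
proof -
  let ?M = "leb {0<..<1::real}"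
  interpret finite_measure ?M by (rule finite_measure_unit_interval)
  note [measurable] = L2_measurable[OF f]
  obtain n where n: "n > 0" and small: "(l2norm ?M (\<lambda>x. f x - (if cmod (f x) \<le> n then f x else 0)))\<^sup>2 < e / 4"
    by (rule L2_truncation[OF f, of "e / 4"]) (use e in auto)
  define g where "g x = (if cmod (f x) \<le> n then f x else 0)" for x
  have g [measurable]: "g \<in> borel_measurable ?M" unfolding g_def by measurable
  have gb: "cmod (g x) \<le> n" for x using n by (simp add: g_def)
  obtain h where h: "\<And>m::nat. continuous_on UNIV (h m)" "\<And>m x. cmod (h m x) \<le> n"
    "AE x in ?M. (\<lambda>m. h m x) \<longlonglongrightarrow> g x"
    using bounded_limit_of_continuous[OF g n gb] by metis
  have [measurable]: "h m \<in> borel_measurable ?M" for m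
    by (rule borel_measurable_unit_interval) (rule continuous_on_subset[OF h(1)], simp)
  have "(\<lambda>m. LINT x|?M. (cmod (g x - h m x))\<^sup>2) \<longlonglongrightarrow> (LINT x|?M. 0)"
  proof (rule integral_dominated_convergence[where w = "\<lambda>_. (2 * n)\<^sup>2"])
    show "AE x in ?M. (\<lambda>m. (cmod (g x - h m x))\<^sup>2) \<longlonglongrightarrow> 0"
      using h(3)
    proof eventually_elim
      case (elim x)
      have "(\<lambda>m. (cmod (g x - h m x))\<^sup>2) \<longlonglongrightarrow> (cmod (g x - g x))\<^sup>2"
        by (intro tendsto_power tendsto_norm tendsto_diff tendsto_const elim)
      then show ?case by simp
    qed
    show "AE x in ?M. norm ((cmod (g x - h m x))\<^sup>2) \<le> (2 * n)\<^sup>2" for m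
    proof (rule AE_I2)
      fix x
      have "cmod (g x - h m x) \<le> 2 * n" using norm_triangle_ineq4[of "g x" "h m x"] gb[of x] h(2)[of m x] by linarith
      then show "norm ((cmod (g x - h m x))\<^sup>2) \<le> (2 * n)\<^sup>2" using power_mono[of _ "2 * n" 2] by simp
    qed
  qed (auto simp: integrable_const)
  then have "(\<lambda>m. (l2norm ?M (\<lambda>x. g x - h m x))\<^sup>2) \<longlonglongrightarrow> 0" by (simp add: l2norm_squared)
  from order_tendstoD(2)[OF this, of "e / 4"] e
  obtain m where m: "(l2norm ?M (\<lambda>x. g x - h m x))\<^sup>2 < e / 4" by (auto dest: eventually_happens)
  have gL: "g \<in> L2 ?M" by (rule L2_bounded[OF finite_measure_unit_interval g gb])
  have hL: "h m \<in> L2 ?M" by (rule L2_bounded[OF finite_measure_unit_interval _ h(2)]) measurable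
  have "(l2norm ?M (\<lambda>x. (f x - g x) + (g x - h m x)))\<^sup>2
      \<le> 2 * (l2norm ?M (\<lambda>x. f x - g x))\<^sup>2 + 2 * (l2norm ?M (\<lambda>x. g x - h m x))\<^sup>2"
    by (intro l2norm_add_squared_le L2_diff f gL hL)
  also have "\<dots> < e" using small m unfolding g_def by linarith
  finally show ?thesis using that[OF h(1)[of m]] by simp
qed

section \<open>The range of the solution operator is dense\<close>

lemma fn_eqI_interior:
  assumes "\<And>t. t \<in> {0<..<1} \<Longrightarrow> fn x t = fn y t"
  shows "x = y"
proof (rule fn_eqI)
  fix t :: real assume t: "t \<in> {0..1}"
  have "continuous_on (closure {0<..<1}) (\<lambda>t. fn x t - fn y t)"
    by (auto intro!: continuous_intros)
  from continuous_constant_on_closure[OF this, of 0 t] have "fn x t - fn y t = 0"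
    using assms t by auto
  then show "fn x t = fn y t" by simp
qed

lemma real_polynomial_function_continuous: "real_polynomial_function p \<Longrightarrow> continuous_on S p"
  for p :: "real \<Rightarrow> real"
  by (intro continuous_at_imp_continuous_on ballI continuous_real_polymonial_function)

text \<open>A polynomial with a double zero at \<open>0\<close> solves the initial value problem whose right-hand side
  is computed from it.\<close>
lemma polynomial_in_range:
  fixes q :: "real \<Rightarrow> real"
  assumes s: "s \<noteq> 0" and q: "real_polynomial_function q" "q 0 = 0" "(q has_real_derivative 0) (at 0)"
  shows "ctsfun_of q \<in> range (reflected_volterra s)"
proof -
  obtain q' where q': "real_polynomial_function q'" "\<And>t. (q has_real_derivative q' t) (at t)"
    using has_real_derivative_polynomial_function[OF q(1)] by blast
  obtain q'' where q'': "real_polynomial_function q''" "\<And>t. (q' has_real_derivative q'' t) (at t)"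
    using has_real_derivative_polynomial_function[OF q'(1)] by blast
  define F where "F r = q'' (1 - r) - s\<^sup>2 * q (1 - r)" for r
  have flip: "continuous_on {0..1} (\<lambda>r. p (1 - r))" if "real_polynomial_function p" for p :: "real \<Rightarrow> real"
    by (rule continuous_on_compose2[OF real_polynomial_function_continuous[OF that, of UNIV]])
       (auto intro: continuous_intros)
  have F: "continuous_on {0..1} F"
    unfolding F_def[abs_def] by (intro continuous_on_diff continuous_on_mult_left flip q(1) q''(1))
  have "ctsfun_of q = reflected_volterra s (ctsfun_of F)"
  proof (rule fn_eqI_interior)
    fix t :: real assume t: "t \<in> {0<..<1}"
    have "q t = fn (reflected_volterra s (ctsfun_of F)) t"
    proof (rule ivp_solution_unique[OF s, where f' = q'])
      show "(q' has_real_derivative s\<^sup>2 * q t + F (1 - t)) (at t)" for t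
        using q''(2)[of t] by (simp add: F_def)
      show "(q has_real_derivative 0) (at 0 within {0..<1})" by (rule DERIV_subset[OF q(3)]) simp
    qed (use q' q(2) F t in auto)
    then show "fn (ctsfun_of q) t = fn (reflected_volterra s (ctsfun_of F)) t"
      using t real_polynomial_function_continuous[OF q(1)] by simp
  qed
  then show ?thesis by blast
qed

lemma integral_power_flip: "integral {0..1} (\<lambda>t::real. (1 - t) ^ n) = 1 / (real n + 1)"
proof -
  define c where "c = - 1 / (1 + real n)"
  have c: "c * ((1 + real n) * ((0 - 1) * z)) = z" for z
    by (simp add: c_def)
  have "((\<lambda>t. (1 - t) ^ n) has_integral (c * (1 - 1) ^ Suc n - c * (1 - 0) ^ Suc n)) {0..1::real}"
  proof (rule fundamental_theorem_of_calculus)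
    fix t :: real
    have "((\<lambda>t. c * (1 - t) ^ Suc n) has_real_derivative c * ((1 + real n) * ((0 - 1) * (1 - t) ^ n)))
        (at t within {0..1})"
      by (rule DERIV_cmult[OF DERIV_power_Suc[OF DERIV_diff[OF DERIV_const DERIV_ident]]])
    then show "((\<lambda>t. c * (1 - t) ^ Suc n) has_vector_derivative (1 - t) ^ n) (at t within {0..1})"
      unfolding c by (simp only: has_real_derivative_iff_has_vector_derivative)
  qed simp
  then have "integral {0..1} (\<lambda>t::real. (1 - t) ^ n) = - c" by (simp add: integral_unique)
  then show ?thesis by (simp add: c_def add.commute)
qed

text \<open>Polynomials are dense by Weierstrass. Multiplying \<open>p\<close> by \<open>(1 - (1 - t)\<^sup>n)\<^sup>2\<close> creates the double
  zero at \<open>0\<close>, and for large \<open>n\<close> changes \<open>p\<close> only near \<open>0\<close>, hence little in \<open>L\<^sub>2\<close>.\<close>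
theorem reflected_volterra_dense_range:
  assumes s: "s \<noteq> 0" and e: "e > 0"
  shows "\<exists>x. norm (y - reflected_volterra s x) < e"
proof -
  obtain p where p: "real_polynomial_function p" and close: "\<And>t. t \<in> {0..1} \<Longrightarrow> \<bar>fn y t - p t\<bar> < e / 2"
    by (rule Stone_Weierstrass_real_polynomial_function[OF compact_Icc continuous_on_fn, of "e / 2" y])
       (use e in auto)
  have pc: "continuous_on S p" for S by (rule real_polynomial_function_continuous[OF p])
  have "bounded (p ` {0..1})" by (rule compact_imp_bounded[OF compact_continuous_image[OF pc compact_Icc]])
  then obtain B where B: "\<And>t. t \<in> {0..1} \<Longrightarrow> \<bar>p t\<bar> \<le> B" by (force simp: bounded_iff)
  have B0: "0 \<le> B" using B[of 0] by force
  \<comment> \<open>The squared distance from \<open>p\<close> to \<open>q\<close> will be at most \<open>(2 B)\<^sup>2 / (2 n + 1)\<close>.\<close>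
  obtain n where n: "(2 * B)\<^sup>2 / (e / 2)\<^sup>2 < real n" using reals_Archimedean2 by blast
  have n0: "n > 0" using n e by (cases n) (auto simp: divide_less_0_iff not_less)
  define q where "q t = p t * (1 - (1 - t) ^ n)\<^sup>2" for t
  have q: "real_polynomial_function q"
    unfolding q_def[abs_def] by (intro real_polynomial_function.intros real_polynomial_function_diff
        real_polynomial_function_power p bounded_linear_ident)
  obtain p' where p': "\<And>t. (p has_real_derivative p' t) (at t)"
    using has_real_derivative_polynomial_function[OF p] by blast
  have dq: "(q has_real_derivative 0) (at 0)"
    unfolding q_def[abs_def] by (auto intro!: derivative_eq_intros p')
  have "ctsfun_of q \<in> range (reflected_volterra s)"
    using n0 by (intro polynomial_in_range s q dq) (simp add: q_def)
  then obtain x where x: "ctsfun_of q = reflected_volterra s x" by blast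
  have qc: "continuous_on {0..1} q" by (rule real_polynomial_function_continuous[OF q])
  have near: "norm (y - ctsfun_of p) \<le> e / 2"
    by (rule norm_le_sup) (use close pc in \<open>auto intro: less_imp_le\<close>)
  have bnd: "\<bar>p t - q t\<bar> \<le> 2 * B * (1 - t) ^ n" if t: "t \<in> {0..1}" for t
  proof -
    define r where "r = (1 - t) ^ n"
    have r: "0 \<le> r" "r \<le> 1" using t by (auto simp: r_def power_le_one)
    have "p t - q t = p t * (r * (2 - r))"
      by (simp add: q_def r_def[symmetric] power2_eq_square algebra_simps)
    then have "\<bar>p t - q t\<bar> = \<bar>p t\<bar> * (r * (2 - r))" using r by (simp add: abs_mult)
    also have "\<dots> \<le> B * (r * 2)" by (intro mult_mono B t) (use r B0 in auto)
    finally show ?thesis by (simp add: r_def mult.commute mult.left_commute)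
  qed
  have "(norm (ctsfun_of p - ctsfun_of q))\<^sup>2 = integral {0..1} (\<lambda>t. fn (ctsfun_of p - ctsfun_of q) t * fn (ctsfun_of p - ctsfun_of q) t)"
    unfolding power2_norm_eq_inner by (simp add: inner_ctsfun_def)
  also have "\<dots> \<le> integral {0..1} (\<lambda>t. (2 * B)\<^sup>2 * (1 - t) ^ (2 * n))"
  proof (rule Henstock_Kurzweil_Integration.integral_le[OF integrable_fn_mult])
    show "(\<lambda>t. (2 * B)\<^sup>2 * (1 - t) ^ (2 * n)) integrable_on {0..1}"
      by (intro integrable_continuous_interval continuous_intros)
    fix t :: real assume t: "t \<in> {0..1}"
    have "(p t - q t)\<^sup>2 \<le> (2 * B * (1 - t) ^ n)\<^sup>2"
      using power_mono[OF bnd[OF t] abs_ge_zero, of 2] by simp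
    then show "fn (ctsfun_of p - ctsfun_of q) t * fn (ctsfun_of p - ctsfun_of q) t \<le> (2 * B)\<^sup>2 * (1 - t) ^ (2 * n)"
      using t pc qc by (simp add: power2_eq_square power_mult power_mult_distrib mult_ac)
  qed
  also have "\<dots> = (2 * B)\<^sup>2 / (real (2 * n) + 1)" by (simp add: integral_power_flip)
  also have "\<dots> < (e / 2)\<^sup>2"
  proof -
    have "(2 * B)\<^sup>2 < real n * (e / 2)\<^sup>2" using n e by (simp add: pos_divide_less_eq)
    also have "\<dots> \<le> (real (2 * n) + 1) * (e / 2)\<^sup>2" by (intro mult_right_mono) auto
    finally show ?thesis by (simp add: divide_less_eq mult.commute)
  qed
  finally have "norm (ctsfun_of p - ctsfun_of q) < e / 2" using e by (meson half_gt_zero less_imp_le power2_less_imp_less)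
  then have "norm (y - ctsfun_of q) < e"
    using norm_triangle_ineq[of "y - ctsfun_of p" "ctsfun_of p - ctsfun_of q"] near by simp
  then show ?thesis using x by auto
qed

section \<open>The eigenfunctions of the solution operator\<close>

lemma l2norm_fn_squared:
  "(l2norm (leb {0<..<1}) (\<lambda>t. Complex (fn x t) (fn y t)))\<^sup>2 = (norm x)\<^sup>2 + (norm y)\<^sup>2"
proof -
  have i: "continuous_on {0..1} (\<lambda>t. fn x t * fn x t)" "continuous_on {0..1} (\<lambda>t. fn y t * fn y t)"
    by (intro continuous_on_mult continuous_on_fn)+
  have sq: "(cmod (Complex a b))\<^sup>2 = a * a + b * b" for a b
    unfolding cmod_power2 by (simp add: power2_eq_square)
  show ?thesis
    unfolding l2norm_squared sq power2_norm_eq_inner[of x] power2_norm_eq_inner[of y] inner_ctsfun_def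
    using integral_unit_interval[OF i(1)] integral_unit_interval[OF i(2)]
    by simp
qed

lemma L2_fn: "(\<lambda>t. Complex (fn x t) (fn y t)) \<in> L2 (leb {0<..<1})"
proof -
  have c: "continuous_on {0<..<1} (\<lambda>t. Complex (fn x t) (fn y t))"
    unfolding Complex_eq
    by (intro continuous_on_add continuous_on_mult continuous_on_const continuous_on_of_real
        continuous_on_subset[OF continuous_on_fn]) auto
  have i: "continuous_on {0..1} (\<lambda>t. (fn x t)\<^sup>2 + (fn y t)\<^sup>2)"
    by (intro continuous_on_add continuous_on_power continuous_on_fn)
  show ?thesis
    using borel_measurable_unit_interval[OF c] integral_unit_interval(1)[OF i]
    by (simp add: L2_def cmod_power2)
qed

lemma l2inner_fn:
  "l2inner (leb {0<..<1}) (\<lambda>t. complex_of_real (fn x t)) (\<lambda>t. complex_of_real (fn y t)) = of_real (x \<bullet> y)"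
proof -
  have i: "continuous_on {0..1} (\<lambda>t. fn x t * fn y t)" by (intro continuous_on_mult continuous_on_fn)
  have "complex_of_real a * cnj (complex_of_real b) = of_real (a * b)" for a b by simp
  then show ?thesis
    unfolding l2inner_def inner_ctsfun_def using integral_unit_interval(2)[OF i]
    by (simp only: integral_complex_of_real)
qed

theorem reflected_volterra_eigenbasis:
  assumes s: "s \<noteq> 0"
  shows "\<exists>v \<rho>. eigenbasis (reflected_volterra s) v \<rho>"
proof -
  interpret compact_symmetric "reflected_volterra s" by (rule compact_symmetric_reflected_volterra)
  show ?thesis
    by (rule eigenbasis_exists[OF reflected_volterra_injective[OF s] reflected_volterra_not_surj])
qed

text \<open>The expansion of \<open>T x\<close> has only zero terms, and \<open>T\<close> is injective.\<close>
lemma eigenbasis_orthogonal_zero: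
  assumes s: "s \<noteq> 0" and eb: "eigenbasis (reflected_volterra s) v \<rho>" and x: "\<And>n. x \<bullet> v n = 0"
  shows "x = 0"
proof -
  have "(\<lambda>n. \<Sum>i<n. (\<rho> i * (x \<bullet> v i)) *\<^sub>R v i) \<longlonglongrightarrow> reflected_volterra s x"
    using eb unfolding eigenbasis_def by blast
  then have "reflected_volterra s x = 0" by (simp add: x LIMSEQ_const_iff)
  then show ?thesis by (rule reflected_volterra_injective[OF s])
qed

text \<open>Real and imaginary part of a continuous function are approximated by elements of the range,
  which the eigenvector expansion approximates in turn; continuous functions are dense.\<close>
theorem eigenbasis_complete:
  assumes s: "s \<noteq> 0" and eb: "eigenbasis (reflected_volterra s) v \<rho>"
  shows "complete_orthonormal_system (leb {0<..<1}) (\<lambda>n t. complex_of_real (fn (v n) t))"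
proof -
  let ?M = "leb {0<..<1::real}"
  have on: "v i \<bullet> v j = (if i = j then 1 else 0)" for i j
    using eb unfolding eigenbasis_def by blast
  have lim: "(\<lambda>n. \<Sum>i<n. (\<rho> i * (x \<bullet> v i)) *\<^sub>R v i) \<longlonglongrightarrow> reflected_volterra s x" for x
    using eb unfolding eigenbasis_def by blast
  have approx: "\<exists>n c. norm (y - (\<Sum>i<n. c i *\<^sub>R v i)) < e" if e: "e > 0" for y :: ctsfun and e
  proof -
    obtain x where x: "norm (y - reflected_volterra s x) < e / 2"
      using reflected_volterra_dense_range[OF s, of "e / 2"] e by auto
    obtain n where n: "norm ((\<Sum>i<n. (\<rho> i * (x \<bullet> v i)) *\<^sub>R v i) - reflected_volterra s x) < e / 2"
      using LIMSEQ_D[OF lim[of x], of "e / 2"] e by auto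
    have "norm (y - (\<Sum>i<n. (\<rho> i * (x \<bullet> v i)) *\<^sub>R v i)) < e"
      using norm_triangle_lt[of "y - reflected_volterra s x"
          "reflected_volterra s x - (\<Sum>i<n. (\<rho> i * (x \<bullet> v i)) *\<^sub>R v i)" e] x n
      by (simp add: norm_minus_commute)
    then show ?thesis by (intro exI[of _ n] exI[of _ "\<lambda>i. \<rho> i * (x \<bullet> v i)"])
  qed
  define V where "V n t = complex_of_real (fn (v n) t)" for n t
  have V_L2: "V n \<in> L2 ?M" for n
    using L2_fn[of "v n" 0] by (simp add: V_def[abs_def] complex_of_real_def)
  have "complete_orthonormal_system ?M V"
    unfolding complete_orthonormal_system_def
  proof (intro conjI allI ballI impI V_L2)
    show "l2inner ?M (V i) (V j) = (if i = j then 1 else 0)" for i j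
      by (simp add: V_def[abs_def] l2inner_fn on)
    fix f and \<epsilon> :: real assume f: "f \<in> L2 ?M" and e: "0 < \<epsilon>"
    then obtain h where h: "continuous_on UNIV h" and fh: "(l2norm ?M (\<lambda>x. f x - h x))\<^sup>2 < \<epsilon>\<^sup>2 / 4"
      using continuous_dense_L2[OF f, of "\<epsilon>\<^sup>2 / 4"] by auto
    have hc: "continuous_on {0..1} (\<lambda>t. Re (h t))" "continuous_on {0..1} (\<lambda>t. Im (h t))"
      using continuous_on_subset[OF h] by (auto intro!: continuous_intros)
    have e8: "sqrt (\<epsilon>\<^sup>2 / 8) > 0" using e by simp
    obtain n c where c: "norm (ctsfun_of (\<lambda>t. Re (h t)) - (\<Sum>i<n. c i *\<^sub>R v i)) < sqrt (\<epsilon>\<^sup>2 / 8)"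
      using approx[OF e8] by blast
    obtain m d where d: "norm (ctsfun_of (\<lambda>t. Im (h t)) - (\<Sum>i<m. d i *\<^sub>R v i)) < sqrt (\<epsilon>\<^sup>2 / 8)"
      using approx[OF e8] by blast
    define N where "N = max n m"
    define c' where "c' i = Complex (if i < n then c i else 0) (if i < m then d i else 0)" for i
    define a where "a = ctsfun_of (\<lambda>t. Re (h t)) - (\<Sum>i<n. c i *\<^sub>R v i)"
    define b where "b = ctsfun_of (\<lambda>t. Im (h t)) - (\<Sum>i<m. d i *\<^sub>R v i)"
    have sum_ext: "(\<Sum>i<N. (if i < k then g i else 0) * y i) = (\<Sum>i<k. g i * y i)"
      if "k \<le> N" for k and g y :: "nat \<Rightarrow> real"
      by (rule sum.mono_neutral_cong_right) (use that in auto)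
    have ab: "h t - (\<Sum>i<N. c' i * V i t) = Complex (fn a t) (fn b t)" if "t \<in> {0..1}" for t
    proof (rule complex_eqI)
      have "(\<Sum>i<N. Re (c' i * V i t)) = (\<Sum>i<n. c i * fn (v i) t)"
        by (subst sum_ext[of n c, symmetric]) (simp_all add: N_def c'_def V_def)
      then show "Re (h t - (\<Sum>i<N. c' i * V i t)) = Re (Complex (fn a t) (fn b t))"
        using that hc(1) by (simp add: a_def)
      have "(\<Sum>i<N. Im (c' i * V i t)) = (\<Sum>i<m. d i * fn (v i) t)"
        by (subst sum_ext[of m d, symmetric]) (simp_all add: N_def c'_def V_def)
      then show "Im (h t - (\<Sum>i<N. c' i * V i t)) = Im (Complex (fn a t) (fn b t))"
        using that hc(2) by (simp add: b_def)
    qed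
    have "(l2norm ?M (\<lambda>t. h t - (\<Sum>i<N. c' i * V i t)))\<^sup>2 = (l2norm ?M (\<lambda>t. Complex (fn a t) (fn b t)))\<^sup>2"
      unfolding l2norm_squared
      by (rule Bochner_Integration.integral_cong) (use ab in \<open>auto simp: space_restrict_space\<close>)
    also have "\<dots> = (norm a)\<^sup>2 + (norm b)\<^sup>2" by (rule l2norm_fn_squared)
    also have "\<dots> < \<epsilon>\<^sup>2 / 8 + \<epsilon>\<^sup>2 / 8"
      using power_strict_mono[OF c norm_ge_zero, of 2] power_strict_mono[OF d norm_ge_zero, of 2]
      unfolding a_def b_def by simp
    finally have hS: "(l2norm ?M (\<lambda>t. h t - (\<Sum>i<N. c' i * V i t)))\<^sup>2 < \<epsilon>\<^sup>2 / 4" by simp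
    have "h \<in> borel_measurable ?M"
      by (rule borel_measurable_unit_interval) (rule continuous_on_subset[OF h], simp)
    moreover obtain K where "\<And>t. t \<in> {0..1} \<Longrightarrow> cmod (h t) \<le> K"
      using compact_imp_bounded[OF compact_continuous_image[OF continuous_on_subset[OF h], of "{0..1}"]]
      by (force simp: bounded_iff)
    ultimately have hL: "h \<in> L2 ?M"
      by (intro L2_bounded[OF finite_measure_unit_interval, of h K]) (auto simp: space_restrict_space)
    have SL: "(\<lambda>t. \<Sum>i<N. c' i * V i t) \<in> L2 ?M" by (intro L2_sum L2_mult_left V_L2)
    have "(l2norm ?M (\<lambda>t. (f t - h t) + (h t - (\<Sum>i<N. c' i * V i t))))\<^sup>2
        \<le> 2 * (l2norm ?M (\<lambda>x. f x - h x))\<^sup>2 + 2 * (l2norm ?M (\<lambda>t. h t - (\<Sum>i<N. c' i * V i t)))\<^sup>2"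
      by (intro l2norm_add_squared_le L2_diff f hL SL)
    also have "\<dots> < \<epsilon>\<^sup>2" using fh hS by linarith
    finally have "l2norm ?M (\<lambda>t. f t - (\<Sum>i<N. c' i * V i t)) < \<epsilon>"
      using e by (simp add: power2_less_imp_less)
    then show "\<exists>F c. finite F \<and> l2norm ?M (\<lambda>t. f t - (\<Sum>i\<in>F. c i * V i t)) < \<epsilon>"
      by (intro exI[of _ "{..<N}"] exI[of _ c'] conjI) auto
  qed
  then show ?thesis by (simp only: V_def[abs_def])
qed

section \<open>Eigenvalues of the ordinary differential equation\<close>

context
  fixes s :: real and v :: "nat \<Rightarrow> ctsfun" and \<rho> :: "nat \<Rightarrow> real"
  assumes s: "s \<noteq> 0" and eb: "eigenbasis (reflected_volterra s) v \<rho>"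
begin

lemma eigenbasis_eq: "reflected_volterra s (v n) = \<rho> n *\<^sub>R v n" and eigenbasis_nonzero: "\<rho> n \<noteq> 0"
  using eb unfolding eigenbasis_def by blast+

lemma eigenbasis_norm: "norm (v n) = 1"
  using eb unfolding eigenbasis_def by (simp add: norm_eq_sqrt_inner)

lemma fn_eigenbasis: "fn (v n) = (\<lambda>t. fn (reflected_volterra s (v n)) t / \<rho> n)"
  using eigenbasis_nonzero[of n] by (simp add: eigenbasis_eq fun_eq_iff)

definition eigenbasis_deriv :: "nat \<Rightarrow> real \<Rightarrow> real" where
  "eigenbasis_deriv n t = reflected_volterra_deriv s (v n) t / \<rho> n"

lemma eigenbasis_has_deriv:
  assumes "t \<in> {0..<1}"
  shows "(fn (v n) has_real_derivative eigenbasis_deriv n t) (at t within {0..<1})"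
  unfolding eigenbasis_deriv_def
  by (subst fn_eigenbasis) (rule DERIV_cdivide[OF reflected_volterra_has_deriv_half_open[OF s assms]])

lemma eigenbasis_deriv_has_deriv:
  assumes "t \<in> {0<..<1}"
  shows "(eigenbasis_deriv n has_real_derivative s\<^sup>2 * fn (v n) t + fn (v n) (1 - t) / \<rho> n) (at t)"
proof -
  have "(eigenbasis_deriv n has_real_derivative
      (s\<^sup>2 * fn (reflected_volterra s (v n)) t + fn (v n) (1 - t)) / \<rho> n) (at t)"
    unfolding eigenbasis_deriv_def[abs_def]
    by (rule DERIV_cdivide[OF reflected_volterra_ode_interior(2)[OF s assms]])
  moreover have "(s\<^sup>2 * fn (reflected_volterra s (v n)) t + fn (v n) (1 - t)) / \<rho> n
      = s\<^sup>2 * fn (v n) t + fn (v n) (1 - t) / \<rho> n"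
    using eigenbasis_nonzero[of n] by (simp add: eigenbasis_eq add_divide_distrib)
  ultimately show ?thesis by simp
qed

lemma eigenbasis_initial: "fn (v n) 0 = 0" "eigenbasis_deriv n 0 = 0"
  by (subst fn_eigenbasis) (simp_all add: eigenbasis_deriv_def)

lemma eigenbasis_nonzero_ode_solution:
  "nonzero_ode_solution (s\<^sup>2) (of_real (1 / \<rho> n)) (\<lambda>t. complex_of_real (fn (v n) t))"
  unfolding nonzero_ode_solution_def
proof (intro conjI exI ballI)
  show "\<exists>t\<in>{0<..<1}. complex_of_real (fn (v n) t) \<noteq> 0"
  proof (rule ccontr)
    assume "\<not> ?thesis"
    then have "v n = 0" by (intro fn_eqI_interior) auto
    then show False using eigenbasis_norm[of n] by simp
  qed
  show "((\<lambda>t. complex_of_real (fn (v n) t)) has_vector_derivative complex_of_real (eigenbasis_deriv n t))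
      (at t within {0..<1})" if "t \<in> {0..<1}" for t
    using eigenbasis_has_deriv[OF that] by (simp add: has_vector_derivative_complex_iff)
  show "((\<lambda>t. complex_of_real (eigenbasis_deriv n t)) has_vector_derivative
      complex_of_real (s\<^sup>2 * fn (v n) t + fn (v n) (1 - t) / \<rho> n)) (at t)" if "t \<in> {0<..<1}" for t
    using eigenbasis_deriv_has_deriv[OF that] by (simp add: has_vector_derivative_complex_iff)
qed (simp_all add: eigenbasis_initial)

end

text \<open>Only continuity on the half-open interval is available for solutions of the spectral problem;
  this turns a limit at \<open>1\<close> into an element of the space of continuous functions.\<close>
lemma continuous_extension_left:
  fixes f :: "real \<Rightarrow> real"
  assumes f: "continuous_on {0..<1} f" and l: "(f \<longlongrightarrow> l) (at_left 1)"
  shows "continuous_on {0..1} (\<lambda>t. if t < 1 then f t else l)"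
proof -
  let ?g = "\<lambda>t. if t < 1 then f t else l"
  have at0: "at 0 within {0..<1} = at_right (0::real)"
    by (rule at_within_nhd[of 0 "{-1<..<1}"]) auto
  have right: "(?g \<longlongrightarrow> ?g 0) (at_right 0)"
  proof (rule Lim_transform_eventually)
    show "(f \<longlongrightarrow> ?g 0) (at_right 0)"
      using f unfolding continuous_on_def at0[symmetric] by simp
    show "\<forall>\<^sub>F t in at_right 0. f t = ?g t"
      using eventually_at_right_real[of 0 "1::real"] by (auto elim: eventually_mono)
  qed
  have left: "(?g \<longlongrightarrow> ?g 1) (at_left 1)"
  proof (rule Lim_transform_eventually)
    show "(f \<longlongrightarrow> ?g 1) (at_left 1)" using l by simp
    show "\<forall>\<^sub>F t in at_left 1. f t = ?g t"
      using eventually_at_left_real[of 0 "1::real"] by (auto elim: eventually_mono)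
  qed
  have mid: "(?g \<longlongrightarrow> ?g t) (at t)" if t: "0 < t" "t < 1" for t
  proof (rule Lim_transform_eventually)
    have "at t within {0..<1} = at t" by (rule at_within_interior) (use t in simp)
    then show "(f \<longlongrightarrow> ?g t) (at t)" using f t unfolding continuous_on_def by (metis atLeastLessThan_iff less_imp_le)
    have "\<forall>\<^sub>F u in at t. u \<in> {..<1::real}" by (rule eventually_at_in_open') (use t in auto)
    then show "\<forall>\<^sub>F u in at t. f u = ?g u" by eventually_elim auto
  qed
  show ?thesis by (rule continuous_on_IccI) (use right left mid in auto)
qed

text \<open>The hypotheses say nothing about \<open>f\<close> near \<open>1\<close>, but the equation does: there its right-hand side
  involves \<open>f\<close> near \<open>0\<close>, where \<open>f\<close> is continuous. So \<open>f\<close> extends continuously to \<open>1\<close>, and the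
  extension satisfies \<open>f = \<kappa> T f\<close>. Since \<open>T\<close> is symmetric, each coefficient \<open>c n\<close> of \<open>f\<close> satisfies
  \<open>c n = \<rho> n \<kappa> c n\<close>, and not all coefficients vanish.\<close>
theorem ode_eigenvalue_cases:
  fixes f f' :: "real \<Rightarrow> complex" and \<kappa> :: complex
  assumes s: "s \<noteq> 0" and eb: "eigenbasis (reflected_volterra s) v \<rho>"
    and f: "\<And>t. t \<in> {0<..<1} \<Longrightarrow> (f has_vector_derivative f' t) (at t)"
    and f': "\<And>t. t \<in> {0<..<1} \<Longrightarrow> (f' has_vector_derivative of_real (s\<^sup>2) * f t + \<kappa> * f (1 - t)) (at t)"
    and init: "f 0 = 0" "(f has_vector_derivative 0) (at 0 within {0..<1})"
    and nz: "\<exists>t\<in>{0<..<1}. f t \<noteq> 0"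
  shows "\<exists>n. \<kappa> = of_real (1 / \<rho> n)"
proof -
  have cont: "continuous_on {0..<1} f"
    unfolding continuous_on_eq_continuous_within
  proof
    fix t :: real assume t: "t \<in> {0..<1}"
    show "continuous (at t within {0..<1}) f"
    proof (cases "t = 0")
      case True
      then show ?thesis using has_vector_derivative_continuous[OF init(2)] by simp
    next
      case False
      then show ?thesis using has_vector_derivative_continuous[OF f[of t]] t
        by (simp add: continuous_at_imp_continuous_at_within)
    qed
  qed
  have cont_Re: "continuous_on {0..<1} (\<lambda>t. Re (f t))" and cont_Im: "continuous_on {0..<1} (\<lambda>t. Im (f t))"
    using cont by (auto intro: continuous_on_Re continuous_on_Im)
  have cont_half: "continuous_on {0..1/2} f" by (rule continuous_on_subset[OF cont]) auto
  have F_Re: "continuous_on {0..1/2} (\<lambda>r. Re (\<kappa> * f r))"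
    and F_Im: "continuous_on {0..1/2} (\<lambda>r. Im (\<kappa> * f r))"
    by (intro continuous_on_Re continuous_on_Im continuous_on_mult_left cont_half)+
  have dRe: "((\<lambda>t. Re (f t)) has_real_derivative Re (f' t)) (at t)"
    and dIm: "((\<lambda>t. Im (f t)) has_real_derivative Im (f' t)) (at t)"
    and dRe': "((\<lambda>t. Re (f' t)) has_real_derivative s\<^sup>2 * Re (f t) + Re (\<kappa> * f (1 - t))) (at t)"
    and dIm': "((\<lambda>t. Im (f' t)) has_real_derivative s\<^sup>2 * Im (f t) + Im (\<kappa> * f (1 - t))) (at t)"
    if "t \<in> {0<..<1}" for t
    using f[OF that] f'[OF that] by (simp_all add: has_vector_derivative_complex_iff)
  obtain l1 where l1: "((\<lambda>t. Re (f t)) \<longlongrightarrow> l1) (at_left 1)"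
  proof -
    have "\<exists>l. ((\<lambda>t. Re (f t)) \<longlongrightarrow> l) (at_left 1)"
      by (rule inhomogeneous_solution_limit[OF s, where F = "\<lambda>r. Re (\<kappa> * f r)" and f' = "\<lambda>t. Re (f' t)"])
         (use dRe dRe' F_Re in auto)
    then show ?thesis using that by blast
  qed
  obtain l2 where l2: "((\<lambda>t. Im (f t)) \<longlongrightarrow> l2) (at_left 1)"
  proof -
    have "\<exists>l. ((\<lambda>t. Im (f t)) \<longlongrightarrow> l) (at_left 1)"
      by (rule inhomogeneous_solution_limit[OF s, where F = "\<lambda>r. Im (\<kappa> * f r)" and f' = "\<lambda>t. Im (f' t)"])
         (use dIm dIm' F_Im in auto)
    then show ?thesis using that by blast
  qed
  define a where "a t = (if t < 1 then Re (f t) else l1)" for t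
  define b where "b t = (if t < 1 then Im (f t) else l2)" for t
  have a: "continuous_on {0..1} a" unfolding a_def[abs_def] by (rule continuous_extension_left[OF cont_Re l1])
  have b: "continuous_on {0..1} b" unfolding b_def[abs_def] by (rule continuous_extension_left[OF cont_Im l2])
  have x: "ctsfun_of a = reflected_volterra s (ctsfun_of (\<lambda>r. Re \<kappa> * a r - Im \<kappa> * b r))"
  proof (rule fn_eqI_interior)
    fix t :: real assume t: "t \<in> {0<..<1}"
    have "Re (f t) = fn (reflected_volterra s (ctsfun_of (\<lambda>r. Re \<kappa> * a r - Im \<kappa> * b r))) t"
    proof (rule ivp_solution_unique[OF s, where f' = "\<lambda>t. Re (f' t)"])
      show "((\<lambda>t. Re (f' t)) has_real_derivative s\<^sup>2 * Re (f t) + (Re \<kappa> * a (1 - t) - Im \<kappa> * b (1 - t))) (at t)"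
        if "t \<in> {0<..<1}" for t
        using dRe'[OF that] that by (simp add: a_def b_def)
      show "((\<lambda>t. Re (f t)) has_real_derivative 0) (at 0 within {0..<1})"
        using init(2) by (simp add: has_vector_derivative_complex_iff)
      show "continuous_on {0..1} (\<lambda>r. Re \<kappa> * a r - Im \<kappa> * b r)"
        by (intro continuous_on_diff continuous_on_mult_left a b)
    qed (use dRe init t in auto)
    then show "fn (ctsfun_of a) t = fn (reflected_volterra s (ctsfun_of (\<lambda>r. Re \<kappa> * a r - Im \<kappa> * b r))) t"
      using a t by (simp add: a_def)
  qed
  have y: "ctsfun_of b = reflected_volterra s (ctsfun_of (\<lambda>r. Re \<kappa> * b r + Im \<kappa> * a r))"
  proof (rule fn_eqI_interior)
    fix t :: real assume t: "t \<in> {0<..<1}"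
    have "Im (f t) = fn (reflected_volterra s (ctsfun_of (\<lambda>r. Re \<kappa> * b r + Im \<kappa> * a r))) t"
    proof (rule ivp_solution_unique[OF s, where f' = "\<lambda>t. Im (f' t)"])
      show "((\<lambda>t. Im (f' t)) has_real_derivative s\<^sup>2 * Im (f t) + (Re \<kappa> * b (1 - t) + Im \<kappa> * a (1 - t))) (at t)"
        if "t \<in> {0<..<1}" for t
        using dIm'[OF that] that by (simp add: a_def b_def)
      show "((\<lambda>t. Im (f t)) has_real_derivative 0) (at 0 within {0..<1})"
        using init(2) by (simp add: has_vector_derivative_complex_iff)
      show "continuous_on {0..1} (\<lambda>r. Re \<kappa> * b r + Im \<kappa> * a r)"
        by (intro continuous_on_add continuous_on_mult_left a b)
    qed (use dIm init t in auto)
    then show "fn (ctsfun_of b) t = fn (reflected_volterra s (ctsfun_of (\<lambda>r. Re \<kappa> * b r + Im \<kappa> * a r))) t"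
      using b t by (simp add: b_def)
  qed
  have mk_Re: "ctsfun_of (\<lambda>r. Re \<kappa> * a r - Im \<kappa> * b r) = Re \<kappa> *\<^sub>R ctsfun_of a - Im \<kappa> *\<^sub>R ctsfun_of b"
    by (rule fn_eqI) (simp add: a b continuous_on_diff continuous_on_mult_left)
  have mk_Im: "ctsfun_of (\<lambda>r. Re \<kappa> * b r + Im \<kappa> * a r) = Re \<kappa> *\<^sub>R ctsfun_of b + Im \<kappa> *\<^sub>R ctsfun_of a"
    by (rule fn_eqI) (simp add: a b continuous_on_add continuous_on_mult_left)
  interpret compact_symmetric "reflected_volterra s" by (rule compact_symmetric_reflected_volterra)
  define c where "c n = Complex (ctsfun_of a \<bullet> v n) (ctsfun_of b \<bullet> v n)" for n
  have c: "c n = of_real (\<rho> n) * \<kappa> * c n" for n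
  proof (rule complex_eqI)
    have "ctsfun_of a \<bullet> v n = (Re \<kappa> *\<^sub>R ctsfun_of a - Im \<kappa> *\<^sub>R ctsfun_of b) \<bullet> reflected_volterra s (v n)"
      by (subst x, unfold mk_Re) (rule symmetric_T)
    then show "Re (c n) = Re (of_real (\<rho> n) * \<kappa> * c n)"
      by (simp add: eigenbasis_eq[OF s eb] c_def inner_diff_left algebra_simps)
    have "ctsfun_of b \<bullet> v n = (Re \<kappa> *\<^sub>R ctsfun_of b + Im \<kappa> *\<^sub>R ctsfun_of a) \<bullet> reflected_volterra s (v n)"
      by (subst y, unfold mk_Im) (rule symmetric_T)
    then show "Im (c n) = Im (of_real (\<rho> n) * \<kappa> * c n)"
      by (simp add: eigenbasis_eq[OF s eb] c_def inner_add_left algebra_simps)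
  qed
  show ?thesis
  proof (rule ccontr)
    assume no: "\<nexists>n. \<kappa> = of_real (1 / \<rho> n)"
    have c0: "c n = 0" for n
    proof (rule ccontr)
      assume "c n \<noteq> 0"
      then have "of_real (\<rho> n) * \<kappa> = 1" using c[of n] by (metis mult_cancel_right1)
      then have "\<kappa> = of_real (1 / \<rho> n)" using eigenbasis_nonzero[OF s eb, of n]
        by (simp add: field_simps)
      then show False using no by blast
    qed
    have "ctsfun_of a = 0" by (rule eigenbasis_orthogonal_zero[OF s eb]) (use c0 in \<open>simp add: c_def complex_eq_iff\<close>)
    moreover have "ctsfun_of b = 0" by (rule eigenbasis_orthogonal_zero[OF s eb]) (use c0 in \<open>simp add: c_def complex_eq_iff\<close>)
    ultimately have "f t = 0" if "t \<in> {0<..<1}" for t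
      using fn_ctsfun_of[OF a, of t] fn_ctsfun_of[OF b, of t] that by (simp add: a_def b_def complex_eq_iff)
    then show False using nz by blast
  qed
qed

section \<open>Asymptotics of the largest eigenvalue\<close>

text \<open>Here \<open>T x = c (x \<bullet> e) e + R x\<close> with \<open>e = exp (s t)\<close>, \<open>c = exp (- s) / (2 s)\<close> and
  \<open>norm R \<le> 1 / (2 s)\<close>; the rank one part has the eigenvalue \<open>m = (exp s - exp (- s)) / (4 s\<^sup>2)\<close>.
  Testing with the eigenvector gives \<open>- 1 / (2 s) \<le> \<rho> 0 \<le> m + 1 / (2 s)\<close>; testing
  with \<open>e\<close> bounds its modulus from below. The hypothesis \<open>1 / s < m\<close> excludes a negative \<open>\<rho> 0\<close>.\<close>
theorem top_eigenvalue_estimate: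
  assumes s: "s > 0" and eb: "eigenbasis (reflected_volterra s) v \<rho>"
    and large: "1 / s < (exp s - exp (- s)) / (4 * s\<^sup>2)"
  shows "\<bar>\<rho> 0 - (exp s - exp (- s)) / (4 * s\<^sup>2)\<bar> \<le> 1 / (2 * s)"
proof -
  define e where "e = ctsfun_of (\<lambda>t. exp (s * t))"
  define c where "c = exp (- s) / (2 * s)"
  define R where "R = int_op (\<lambda>t r. propagator s (t + r - 1) - exp (s * (t + r - 1)) / (2 * s))"
  define m where "m = (exp s - exp (- s)) / (4 * s\<^sup>2)"
  have s0: "s \<noteq> 0" using s by simp
  have ec: "continuous_on {0..1} (\<lambda>t. exp (s * t))" by (intro continuous_intros)
  have Rc: "continuous_on ({0..1} \<times> {0..1}) (\<lambda>(t, r). propagator s (t + r - 1) - exp (s * (t + r - 1)) / (2 * s))"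
    using s by (auto simp: split_beta intro!: continuous_intros)
  have kernel_bound: "\<bar>propagator s z - exp (s * z) / (2 * s)\<bar> \<le> 1 / (2 * s)" for z
  proof (cases "z \<ge> 0")
    case True
    then have "propagator s z - exp (s * z) / (2 * s) = - exp (- (s * z)) / (2 * s)"
      using s by (simp add: propagator_def max_def sinh_field_def field_simps)
    moreover have "exp (- (s * z)) \<le> 1" using True s by simp
    ultimately show ?thesis using s by (simp add: divide_right_mono)
  next
    case False
    then have "propagator s z = 0" by (simp add: propagator_def)
    moreover have "exp (s * z) \<le> 1" using False s by (simp add: mult_nonneg_nonpos)
    ultimately show ?thesis using s by (simp add: divide_right_mono)
  qed
  have Rb: "norm (R x) \<le> norm x / (2 * s)" for x
    using norm_int_op_le[OF Rc kernel_bound, of x] by (simp add: R_def)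
  have T: "reflected_volterra s x = (c * (x \<bullet> e)) *\<^sub>R e + R x" for x
  proof (rule fn_eqI)
    fix t :: real assume t: "t \<in> {0..1}"
    have i: "(\<lambda>r. k r * fn x r) integrable_on {0..1}" if "continuous_on {0..1} k" for k
      by (rule integrable_mult_fn[OF that])
    have c1: "continuous_on {0..1} (\<lambda>r. propagator s (t + r - 1))"
      "continuous_on {0..1} (\<lambda>r. exp (s * (t + r - 1)) / (2 * s))"
      using s by (auto intro!: continuous_intros)
    have "fn (R x) t = integral {0..1} (\<lambda>r. (propagator s (t + r - 1) - exp (s * (t + r - 1)) / (2 * s)) * fn x r)"
      unfolding R_def by (rule fn_int_op[OF Rc t])
    also have "\<dots> = integral {0..1} (\<lambda>r. propagator s (t + r - 1) * fn x r)
        - integral {0..1} (\<lambda>r. exp (s * (t + r - 1)) / (2 * s) * fn x r)"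
      using Henstock_Kurzweil_Integration.integral_diff[OF i[OF c1(1)] i[OF c1(2)]]
      by (simp add: left_diff_distrib)
    also have "integral {0..1} (\<lambda>r. exp (s * (t + r - 1)) / (2 * s) * fn x r)
        = integral {0..1} (\<lambda>r. c * exp (s * t) * (fn x r * fn e r))"
    proof (rule integral_cong)
      fix r :: real assume r: "r \<in> {0..1}"
      have "exp (s * (t + r - 1)) = exp (s * t) * (exp (s * r) * exp (- s))"
        by (simp add: mult_exp_exp algebra_simps)
      then show "exp (s * (t + r - 1)) / (2 * s) * fn x r = c * exp (s * t) * (fn x r * fn e r)"
        using fn_ctsfun_of[OF ec r] by (simp add: c_def e_def)
    qed
    also have "\<dots> = c * exp (s * t) * (x \<bullet> e)"
      unfolding inner_ctsfun_def by (rule integral_mult_right)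
    also have "exp (s * t) = fn e t" unfolding e_def by (rule fn_ctsfun_of[OF ec t, symmetric])
    finally show "fn (reflected_volterra s x) t = fn ((c * (x \<bullet> e)) *\<^sub>R e + R x) t"
      using fn_reflected_volterra_integral[OF t, of s x] by (simp add: mult_ac)
  qed
  have ee: "c * (e \<bullet> e) = m"
  proof -
    have "((\<lambda>t. exp (2 * s * t)) has_integral exp (2 * s * 1) / (2 * s) - exp (2 * s * 0) / (2 * s)) {0..1}"
    proof (rule fundamental_theorem_of_calculus)
      fix t :: real
      have "((\<lambda>t. exp (2 * s * t) / (2 * s)) has_real_derivative exp (2 * s * t) * (2 * s) / (2 * s)) (at t within {0..1})"
        by (auto intro!: derivative_eq_intros)
      then show "((\<lambda>t. exp (2 * s * t) / (2 * s)) has_vector_derivative exp (2 * s * t)) (at t within {0..1})"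
        using s by (simp add: has_real_derivative_iff_has_vector_derivative)
    qed simp
    moreover have "e \<bullet> e = integral {0..1} (\<lambda>t. exp (2 * s * t))"
      unfolding inner_ctsfun_def e_def
      by (rule integral_cong) (simp add: fn_ctsfun_of[OF ec] mult_exp_exp)
    ultimately have "e \<bullet> e = (exp (2 * s) - 1) / (2 * s)"
      by (simp add: integral_unique diff_divide_distrib)
    moreover have "exp (- s) * (exp (2 * s) - 1) = exp s - exp (- s)"
      by (simp add: right_diff_distrib mult_exp_exp)
    ultimately show ?thesis by (simp add: c_def m_def power2_eq_square)
  qed
  have c0: "c > 0" using s by (simp add: c_def)
  have m_large: "1 / s < m" using large by (simp add: m_def)
  then have m0: "m > 0" using s by (meson divide_pos_pos less_trans zero_less_one)
  have ene: "norm e > 0" using ee m0 by auto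
  have v1: "norm (v 0) = 1" by (rule eigenbasis_norm[OF s0 eb])
  have "\<rho> 0 = reflected_volterra s (v 0) \<bullet> v 0"
    using v1 by (simp add: eigenbasis_eq[OF s0 eb] norm_eq_1)
  then have rho: "\<rho> 0 = c * (v 0 \<bullet> e)\<^sup>2 + R (v 0) \<bullet> v 0"
    by (simp add: T inner_add_left power2_eq_square inner_commute[of e "v 0"])
  have "\<bar>R (v 0) \<bullet> v 0\<bar> \<le> norm (R (v 0)) * norm (v 0)" by (rule Cauchy_Schwarz_ineq2)
  then have Rv: "\<bar>R (v 0) \<bullet> v 0\<bar> \<le> 1 / (2 * s)" using Rb[of "v 0"] v1 by simp
  have "(v 0 \<bullet> e)\<^sup>2 \<le> e \<bullet> e"
    using Cauchy_Schwarz_ineq[of "v 0" e] v1 by (simp add: norm_eq_1)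
  then have cv: "c * (v 0 \<bullet> e)\<^sup>2 \<le> m" using c0 ee by (metis mult_left_mono less_imp_le)
  have cv0: "0 \<le> c * (v 0 \<bullet> e)\<^sup>2" using c0 by simp
  have "m * norm e - norm e / (2 * s) \<le> norm (m *\<^sub>R e) - norm (R e)" using Rb[of e] m0 by simp
  also have "\<dots> \<le> norm (reflected_volterra s e)"
    using norm_diff_ineq[of "m *\<^sub>R e" "R e"] by (simp add: T ee)
  also have "\<dots> \<le> \<bar>\<rho> 0\<bar> * norm e" using eb unfolding eigenbasis_def by blast
  finally have "(m - 1 / (2 * s)) * norm e \<le> \<bar>\<rho> 0\<bar> * norm e" by (simp add: left_diff_distrib)
  then have lower: "m - 1 / (2 * s) \<le> \<bar>\<rho> 0\<bar>" using ene by simp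
  have half: "1 / s = 1 / (2 * s) + 1 / (2 * s)" using s by (simp add: field_simps)
  have "\<bar>\<rho> 0 - m\<bar> \<le> 1 / (2 * s)"
    using rho Rv cv cv0 lower m_large half by linarith
  then show ?thesis by (simp add: m_def)
qed

text \<open>The estimate is multiplied by \<open>w = 4 s\<^sup>2 exp (- s)\<close>, which makes the main term
  \<open>1 - exp (- 2 s)\<close> and the error \<open>2 s exp (- s)\<close>.\<close>
theorem eigenvalue_asymptotics:
  fixes s :: "nat \<Rightarrow> real" and \<rho> :: "nat \<Rightarrow> nat \<Rightarrow> real"
  assumes s: "\<And>k. s k > 0" and lim: "filterlim s at_top sequentially"
    and eb: "\<And>k. eigenbasis (reflected_volterra (s k)) (v k) (\<rho> k)"
  shows "(\<lambda>k. 1 / \<rho> k 0 / (4 * (s k)\<^sup>2 * exp (- s k))) \<longlonglongrightarrow> 1"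
proof -
  have p: "(\<lambda>k. s k * exp (- s k)) \<longlonglongrightarrow> 0"
    using filterlim_compose[OF tendsto_power_div_exp_0[of 1] lim] by (simp add: exp_minus divide_inverse)
  have q: "(\<lambda>k. exp (- s k)) \<longlonglongrightarrow> 0"
    using filterlim_compose[OF tendsto_power_div_exp_0[of 0] lim] by (simp add: exp_minus divide_inverse)
  have "(\<lambda>k. 1 - exp (- s k) * exp (- s k) - 4 * (s k * exp (- s k))) \<longlonglongrightarrow> 1 - 0 * 0 - 4 * 0"
    by (rule tendsto_diff[OF tendsto_diff[OF tendsto_const tendsto_mult[OF q q]] tendsto_mult[OF tendsto_const p]])
  then have ev: "\<forall>\<^sub>F k in sequentially. 1 - exp (- s k) * exp (- s k) - 4 * (s k * exp (- s k)) > 0"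
    by (rule order_tendstoD) simp
  define w where "w k = 4 * (s k)\<^sup>2 * exp (- s k)" for k
  have w0: "w k > 0" for k using s[of k] by (simp add: w_def)
  have est: "\<forall>\<^sub>F k in sequentially. norm (w k * \<rho> k 0 - (1 - exp (- s k) * exp (- s k))) \<le> 2 * (s k * exp (- s k))"
    using ev
  proof eventually_elim
    case (elim k)
    have main: "w k * ((exp (s k) - exp (- s k)) / (4 * (s k)\<^sup>2)) = 1 - exp (- s k) * exp (- s k)"
    proof -
      have "w k * (z / (4 * (s k)\<^sup>2)) = exp (- s k) * z" for z
        using s[of k] by (simp add: w_def)
      moreover have "exp (- s k) * exp (s k) = 1" by (simp add: mult_exp_exp)
      ultimately show ?thesis by (simp only: right_diff_distrib)
    qed
    have wk: "w k * (1 / s k) = 4 * (s k * exp (- s k))"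
      using s[of k] by (simp add: w_def power2_eq_square)
    have "w k * (1 / s k) < w k * ((exp (s k) - exp (- s k)) / (4 * (s k)\<^sup>2))"
      unfolding main wk using elim by simp
    then have "1 / s k < (exp (s k) - exp (- s k)) / (4 * (s k)\<^sup>2)"
      using w0[of k] by (simp only: mult_less_cancel_left_pos)
    from top_eigenvalue_estimate[OF s eb this]
    have "w k * \<bar>\<rho> k 0 - (exp (s k) - exp (- s k)) / (4 * (s k)\<^sup>2)\<bar> \<le> w k * (1 / (2 * s k))"
      using w0[of k] by (intro mult_left_mono) auto
    moreover have "w k * (1 / (2 * s k)) = 2 * (s k * exp (- s k))" using wk by simp
    moreover have "w k * \<bar>\<rho> k 0 - (exp (s k) - exp (- s k)) / (4 * (s k)\<^sup>2)\<bar>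
        = \<bar>w k * \<rho> k 0 - w k * ((exp (s k) - exp (- s k)) / (4 * (s k)\<^sup>2))\<bar>"
      using w0[of k] unfolding right_diff_distrib[symmetric] abs_mult by simp
    ultimately show ?case unfolding main by simp
  qed
  have "(\<lambda>k. 2 * (s k * exp (- s k))) \<longlonglongrightarrow> 0"
    using tendsto_mult_left[OF p, of 2] by simp
  from Lim_null_comparison[OF est this]
  have "(\<lambda>k. w k * \<rho> k 0 - (1 - exp (- s k) * exp (- s k)) + (1 - exp (- s k) * exp (- s k))) \<longlonglongrightarrow> 0 + (1 - 0 * 0)"
    by (rule tendsto_add[OF _ tendsto_diff[OF tendsto_const tendsto_mult[OF q q]]])
  then have "(\<lambda>k. w k * \<rho> k 0) \<longlonglongrightarrow> 1" unfolding diff_add_cancel by simp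
  then have "(\<lambda>k. inverse (w k * \<rho> k 0)) \<longlonglongrightarrow> inverse 1" by (rule tendsto_inverse) simp
  moreover have "inverse (w k * \<rho> k 0) = 1 / \<rho> k 0 / w k" for k
    by (simp add: divide_inverse)
  ultimately have "(\<lambda>k. 1 / \<rho> k 0 / w k) \<longlonglongrightarrow> 1" by (simp only: inverse_1)
  then show ?thesis by (simp only: w_def)
qed

section \<open>Product systems\<close>

text \<open>Both measures agree on rectangles; that the \<open>\<sigma>\<close>-algebras agree is seen from the measurability
  of the inclusion map.\<close>
lemma restrict_pair_measure:
  fixes M :: "'a measure" and N :: "'b measure"
  assumes sf: "sigma_finite_measure M" "sigma_finite_measure N" and A: "A \<in> sets M" and B: "B \<in> sets N"
  shows "restrict_space M A \<Otimes>\<^sub>M restrict_space N B = restrict_space (M \<Otimes>\<^sub>M N) (A \<times> B)"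
proof (rule pair_measure_eqI)
  show "sigma_finite_measure (restrict_space M A)" "sigma_finite_measure (restrict_space N B)"
    by (intro sigma_finite_measure_restrict_space sf A B)+
  interpret N: sigma_finite_measure N by (rule sf)
  have AB: "A \<times> B \<in> sets (M \<Otimes>\<^sub>M N)" using A B by (rule pair_measureI)
  have As: "A \<inter> space M = A" "B \<inter> space N = B"
    using A B sets.sets_into_space by auto
  have sub: "X \<in> sets (restrict_space M A) \<longleftrightarrow> X \<subseteq> A \<and> X \<in> sets M" for X
    using A by (intro sets_restrict_space_iff) (simp add: As)
  have sub': "X \<in> sets (restrict_space N B) \<longleftrightarrow> X \<subseteq> B \<and> X \<in> sets N" for X
    using B by (intro sets_restrict_space_iff) (simp add: As)
  have subP: "X \<in> sets (restrict_space (M \<Otimes>\<^sub>M N) (A \<times> B)) \<longleftrightarrow> X \<subseteq> A \<times> B \<and> X \<in> sets (M \<Otimes>\<^sub>M N)" for X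
    using AB by (intro sets_restrict_space_iff) (metis sets.Int_space_eq2)
  show "sets (restrict_space M A \<Otimes>\<^sub>M restrict_space N B) = sets (restrict_space (M \<Otimes>\<^sub>M N) (A \<times> B))"
  proof (rule antisym)
    show "sets (restrict_space M A \<Otimes>\<^sub>M restrict_space N B) \<subseteq> sets (restrict_space (M \<Otimes>\<^sub>M N) (A \<times> B))"
      by (rule sets_pair_in_sets) (auto simp: sub sub' subP intro: pair_measureI)
    have "(\<lambda>p. (fst p, snd p)) \<in> measurable (restrict_space M A \<Otimes>\<^sub>M restrict_space N B) (M \<Otimes>\<^sub>M N)"
      by (intro measurable_Pair measurable_compose[OF measurable_fst] measurable_compose[OF measurable_snd]
          measurable_restrict_space1 measurable_ident_sets refl)
    then have id: "(\<lambda>p. p) \<in> measurable (restrict_space M A \<Otimes>\<^sub>M restrict_space N B) (M \<Otimes>\<^sub>M N)" by simp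
    show "sets (restrict_space (M \<Otimes>\<^sub>M N) (A \<times> B)) \<subseteq> sets (restrict_space M A \<Otimes>\<^sub>M restrict_space N B)"
    proof
      fix X assume "X \<in> sets (restrict_space (M \<Otimes>\<^sub>M N) (A \<times> B))"
      then have X: "X \<subseteq> A \<times> B" "X \<in> sets (M \<Otimes>\<^sub>M N)" by (simp_all add: subP)
      have "(\<lambda>p. p) -` X \<inter> space (restrict_space M A \<Otimes>\<^sub>M restrict_space N B)
          \<in> sets (restrict_space M A \<Otimes>\<^sub>M restrict_space N B)"
        by (rule measurable_sets[OF id X(2)])
      moreover have "(\<lambda>p. p) -` X \<inter> space (restrict_space M A \<Otimes>\<^sub>M restrict_space N B) = X"
        using X(1) by (auto simp: space_pair_measure space_restrict_space As)
      ultimately show "X \<in> sets (restrict_space M A \<Otimes>\<^sub>M restrict_space N B)" by simp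
    qed
  qed
  fix X Y assume "X \<in> sets (restrict_space M A)" "Y \<in> sets (restrict_space N B)"
  then have X: "X \<subseteq> A" "X \<in> sets M" and Y: "Y \<subseteq> B" "Y \<in> sets N" by (simp_all add: sub sub')
  have "emeasure (restrict_space M A) X = emeasure M X"
    by (rule emeasure_restrict_space) (simp_all add: As A X)
  moreover have "emeasure (restrict_space N B) Y = emeasure N Y"
    by (rule emeasure_restrict_space) (simp_all add: As B Y)
  moreover have "emeasure (restrict_space (M \<Otimes>\<^sub>M N) (A \<times> B)) (X \<times> Y) = emeasure (M \<Otimes>\<^sub>M N) (X \<times> Y)"
    by (rule emeasure_restrict_space) (use AB X Y in \<open>auto simp: sets.Int_space_eq2\<close>)
  moreover have "emeasure (M \<Otimes>\<^sub>M N) (X \<times> Y) = emeasure M X * emeasure N Y"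
    by (rule N.emeasure_pair_measure_Times[OF X(2) Y(2)])
  ultimately show "emeasure (restrict_space M A) X * emeasure (restrict_space N B) Y
      = emeasure (restrict_space (M \<Otimes>\<^sub>M N) (A \<times> B)) (X \<times> Y)" by simp
qed

context pair_sigma_finite
begin

text \<open>Tonelli's theorem for \<open>(cmod u)\<^sup>2\<close>.\<close>
lemma L2_section:
  assumes u: "u \<in> L2 (M1 \<Otimes>\<^sub>M M2)"
  shows "AE t in M2. (\<lambda>x. u (x, t)) \<in> L2 M1"
    and "integrable M2 (\<lambda>t. (l2norm M1 (\<lambda>x. u (x, t)))\<^sup>2)"
    and "(LINT t|M2. (l2norm M1 (\<lambda>x. u (x, t)))\<^sup>2) = (l2norm (M1 \<Otimes>\<^sub>M M2) u)\<^sup>2"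
proof -
  note [measurable] = L2_measurable[OF u]
  have i: "integrable (M1 \<Otimes>\<^sub>M M2) (case_prod (\<lambda>x t. (cmod (u (x, t)))\<^sup>2))"
    using L2_integrable[OF u] by (simp add: case_prod_beta')
  show "AE t in M2. (\<lambda>x. u (x, t)) \<in> L2 M1"
    using AE_integrable_snd[OF i] AE_space by eventually_elim (simp add: L2_def)
  show "integrable M2 (\<lambda>t. (l2norm M1 (\<lambda>x. u (x, t)))\<^sup>2)"
    unfolding l2norm_squared by (rule integrable_snd[OF i])
  show "(LINT t|M2. (l2norm M1 (\<lambda>x. u (x, t)))\<^sup>2) = (l2norm (M1 \<Otimes>\<^sub>M M2) u)\<^sup>2"
    unfolding l2norm_squared using integral_snd[OF i] by (simp add: case_prod_beta')
qed

lemma borel_measurable_l2inner_section: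
  assumes u: "u \<in> L2 (M1 \<Otimes>\<^sub>M M2)" and \<phi>: "\<phi> \<in> L2 M1"
  shows "(\<lambda>t. l2inner M1 (\<lambda>x. u (x, t)) \<phi>) \<in> borel_measurable M2"
proof -
  note [measurable] = L2_measurable[OF u] L2_measurable[OF \<phi>]
  show ?thesis unfolding l2inner_def by (rule M1.borel_measurable_lebesgue_integral) measurable
qed

lemma L2_product:
  assumes \<phi>: "\<phi> \<in> L2 M1" and \<psi>: "\<psi> \<in> L2 M2"
  shows "(\<lambda>(x, t). \<phi> x * \<psi> t) \<in> L2 (M1 \<Otimes>\<^sub>M M2)"
proof -
  note [measurable] = L2_measurable[OF \<phi>] L2_measurable[OF \<psi>]
  have "integrable (M1 \<Otimes>\<^sub>M M2) (\<lambda>p. (cmod (\<phi> (fst p)))\<^sup>2 * (cmod (\<psi> (snd p)))\<^sup>2)"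
    by (rule Fubini_integrable) (use \<phi> \<psi> in \<open>auto simp: L2_integrable\<close>)
  then show ?thesis by (simp add: L2_def case_prod_beta' norm_mult power_mult_distrib)
qed

lemma l2inner_product:
  assumes u: "u \<in> L2 (M1 \<Otimes>\<^sub>M M2)" and \<phi>: "\<phi> \<in> L2 M1" and \<psi>: "\<psi> \<in> L2 M2"
  shows "l2inner (M1 \<Otimes>\<^sub>M M2) u (\<lambda>(x, t). \<phi> x * \<psi> t) = l2inner M2 (\<lambda>t. l2inner M1 (\<lambda>x. u (x, t)) \<phi>) \<psi>"
proof -
  have i: "integrable (M1 \<Otimes>\<^sub>M M2) (case_prod (\<lambda>x t. u (x, t) * cnj (\<phi> x * \<psi> t)))"
    using integrable_l2inner[OF u L2_product[OF \<phi> \<psi>]] by (simp add: case_prod_beta')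
  have "l2inner (M1 \<Otimes>\<^sub>M M2) u (\<lambda>(x, t). \<phi> x * \<psi> t) = (LINT t|M2. LINT x|M1. u (x, t) * cnj (\<phi> x * \<psi> t))"
    unfolding l2inner_def using integral_snd[OF i] by (simp add: case_prod_beta')
  also have "\<dots> = (LINT t|M2. (LINT x|M1. u (x, t) * cnj (\<phi> x)) * cnj (\<psi> t))"
    by (simp add: mult.assoc[symmetric])
  finally show ?thesis by (simp add: l2inner_def)
qed

lemma L2_l2inner_section:
  assumes u: "u \<in> L2 (M1 \<Otimes>\<^sub>M M2)" and on: "orthonormal_system M1 \<phi>"
  shows "(\<lambda>t. l2inner M1 (\<lambda>x. u (x, t)) (\<phi> k)) \<in> L2 M2"
proof -
  note [measurable] = borel_measurable_l2inner_section[OF u orthonormal_system_L2[OF on]]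
  have "integrable M2 (\<lambda>t. (cmod (l2inner M1 (\<lambda>x. u (x, t)) (\<phi> k)))\<^sup>2)"
  proof (rule Bochner_Integration.integrable_bound[OF L2_section(2)[OF u]])
    show "AE t in M2. norm ((cmod (l2inner M1 (\<lambda>x. u (x, t)) (\<phi> k)))\<^sup>2)
        \<le> norm ((l2norm M1 (\<lambda>x. u (x, t)))\<^sup>2)"
      using L2_section(1)[OF u]
    proof eventually_elim
      case (elim t)
      then show ?case using cmod_l2inner_le[OF on elim, of k] by (simp add: power_mono)
    qed
  qed measurable
  then show ?thesis
    using borel_measurable_l2inner_section[OF u orthonormal_system_L2[OF on]] by (simp add: L2_def)
qed

lemma orthonormal_system_product:
  fixes \<phi> :: "'k \<Rightarrow> 'a \<Rightarrow> complex" and \<psi> :: "'k \<Rightarrow> 'i \<Rightarrow> 'b \<Rightarrow> complex"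
  assumes \<phi>: "orthonormal_system M1 \<phi>" and \<psi>: "\<And>k. orthonormal_system M2 (\<psi> k)"
  shows "orthonormal_system (M1 \<Otimes>\<^sub>M M2) (\<lambda>(k, m) (x, t). \<phi> k x * \<psi> k m t)"
  unfolding orthonormal_system_def
proof (intro conjI allI)
  show L: "(case i of (k, m) \<Rightarrow> \<lambda>(x, t). \<phi> k x * \<psi> k m t) \<in> L2 (M1 \<Otimes>\<^sub>M M2)" for i :: "'k \<times> 'i"
    by (cases i) (simp add: L2_product orthonormal_system_L2[OF \<phi>] orthonormal_system_L2[OF \<psi>])
  fix i j :: "'k \<times> 'i"
  obtain k m where i: "i = (k, m)" by (cases i)
  obtain l n where j: "j = (l, n)" by (cases j)
  have inner_section: "l2inner M1 (\<lambda>x. \<psi> k m t * \<phi> k x) (\<phi> l) = (if k = l then 1 else 0) * \<psi> k m t" for t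
    unfolding l2inner_mult_left using \<phi> by (simp add: orthonormal_system_def)
  have "l2inner (M1 \<Otimes>\<^sub>M M2) (\<lambda>(x, t). \<phi> k x * \<psi> k m t) (\<lambda>(x, t). \<phi> l x * \<psi> l n t)
      = l2inner M2 (\<lambda>t. l2inner M1 (\<lambda>x. \<psi> k m t * \<phi> k x) (\<phi> l)) (\<psi> l n)"
    by (subst l2inner_product)
       (simp_all add: L2_product orthonormal_system_L2[OF \<phi>] orthonormal_system_L2[OF \<psi>] mult.commute)
  also have "\<dots> = l2inner M2 (\<lambda>t. (if k = l then 1 else 0) * \<psi> k m t) (\<psi> l n)"
    unfolding inner_section ..
  also have "\<dots> = (if k = l then 1 else 0) * l2inner M2 (\<psi> k m) (\<psi> l n)"
    by (rule l2inner_mult_left)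
  also have "\<dots> = (if i = j then 1 else 0)"
    using \<psi>[of l] by (auto simp: i j orthonormal_system_def)
  finally show "l2inner (M1 \<Otimes>\<^sub>M M2) (case i of (k, m) \<Rightarrow> \<lambda>(x, t). \<phi> k x * \<psi> k m t)
      (case j of (k, m) \<Rightarrow> \<lambda>(x, t). \<phi> k x * \<psi> k m t) = (if i = j then 1 else 0)"
    by (simp add: i j)
qed

text \<open>Parseval for \<open>\<phi>\<close> at almost every \<open>t\<close>, integrated by dominated convergence, shows that the squared
  norms of finitely many coefficient functions \<open>g k\<close> exhaust that of \<open>u\<close>; Parseval for \<open>\<psi> k\<close>
  then exhausts each \<open>g k\<close>.\<close>
theorem complete_orthonormal_system_product:
  fixes \<phi> :: "nat \<Rightarrow> 'a \<Rightarrow> complex" and \<psi> :: "nat \<Rightarrow> 'i \<Rightarrow> 'b \<Rightarrow> complex"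
  assumes \<phi>: "complete_orthonormal_system M1 \<phi>" and \<psi>: "\<And>k. complete_orthonormal_system M2 (\<psi> k)"
  shows "complete_orthonormal_system (M1 \<Otimes>\<^sub>M M2) (\<lambda>(k, m) (x, t). \<phi> k x * \<psi> k m t)"
  unfolding complete_iff_parseval[of "M1 \<Otimes>\<^sub>M M2"]
proof (intro conjI ballI allI impI)
  have on1: "orthonormal_system M1 \<phi>" by (rule complete_orthonormal_system_imp[OF \<phi>])
  have on2: "orthonormal_system M2 (\<psi> k)" for k by (rule complete_orthonormal_system_imp[OF \<psi>])
  show "orthonormal_system (M1 \<Otimes>\<^sub>M M2) (\<lambda>(k, m) (x, t). \<phi> k x * \<psi> k m t)"
    by (rule orthonormal_system_product[OF on1 on2])
  fix u and \<epsilon> :: real assume u: "u \<in> L2 (M1 \<Otimes>\<^sub>M M2)" and e: "0 < \<epsilon>"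
  define g where "g k t = l2inner M1 (\<lambda>x. u (x, t)) (\<phi> k)" for k t
  have g: "g k \<in> L2 M2" for k unfolding g_def by (rule L2_l2inner_section[OF u on1])
  note [measurable] = L2_measurable[OF g]
  have "(\<lambda>n. LINT t|M2. (\<Sum>k<n. (cmod (g k t))\<^sup>2)) \<longlonglongrightarrow> (LINT t|M2. (l2norm M1 (\<lambda>x. u (x, t)))\<^sup>2)"
  proof (rule integral_dominated_convergence[OF _ _ L2_section(2)[OF u]])
    show "(\<lambda>t. (l2norm M1 (\<lambda>x. u (x, t)))\<^sup>2) \<in> borel_measurable M2"
      using L2_section(2)[OF u] by (rule borel_measurable_integrable)
    show "AE t in M2. (\<lambda>n. \<Sum>k<n. (cmod (g k t))\<^sup>2) \<longlonglongrightarrow> (l2norm M1 (\<lambda>x. u (x, t)))\<^sup>2"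
      using L2_section(1)[OF u]
      by eventually_elim (simp only: g_def parseval_tendsto[OF \<phi>])
    show "AE t in M2. norm (\<Sum>k<n. (cmod (g k t))\<^sup>2) \<le> (l2norm M1 (\<lambda>x. u (x, t)))\<^sup>2" for n
      using L2_section(1)[OF u]
    proof eventually_elim
      case (elim t)
      have "(\<Sum>k<n. (cmod (g k t))\<^sup>2) \<le> (l2norm M1 (\<lambda>x. u (x, t)))\<^sup>2"
        unfolding g_def by (rule bessel_inequality[OF on1 elim]) simp
      then show ?case by (simp add: sum_nonneg)
    qed
  qed measurable
  also have "(\<lambda>n. LINT t|M2. (\<Sum>k<n. (cmod (g k t))\<^sup>2)) = (\<lambda>n. \<Sum>k<n. (l2norm M2 (g k))\<^sup>2)"
    unfolding l2norm_squared by (rule ext, rule Bochner_Integration.integral_sum) (simp add: L2_integrable g)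
  finally have lim: "(\<lambda>n. \<Sum>k<n. (l2norm M2 (g k))\<^sup>2) \<longlonglongrightarrow> (l2norm (M1 \<Otimes>\<^sub>M M2) u)\<^sup>2"
    unfolding L2_section(3)[OF u] .
  have "(l2norm (M1 \<Otimes>\<^sub>M M2) u)\<^sup>2 - \<epsilon> / 2 < (l2norm (M1 \<Otimes>\<^sub>M M2) u)\<^sup>2" using e by simp
  from order_tendstoD(1)[OF lim this]
  obtain n where n: "(l2norm (M1 \<Otimes>\<^sub>M M2) u)\<^sup>2 - \<epsilon> / 2 < (\<Sum>k<n. (l2norm M2 (g k))\<^sup>2)"
    by (auto dest: eventually_happens)
  \<comment> \<open>The denominator uses \<open>Suc n\<close> to stay positive for \<open>n = 0\<close>.\<close>
  define \<delta> where "\<delta> = \<epsilon> / (2 * real (Suc n))"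
  have \<delta>: "\<delta> > 0" using e by (simp add: \<delta>_def)
  have "\<exists>F. finite F \<and> (l2norm M2 (g k))\<^sup>2 - \<delta> < (\<Sum>m\<in>F. (cmod (l2inner M2 (g k) (\<psi> k m)))\<^sup>2)" for k
    using \<psi>[of k] g[of k] \<delta> unfolding complete_iff_parseval by blast
  then obtain F where F: "\<And>k. finite (F k)"
    "\<And>k. (l2norm M2 (g k))\<^sup>2 - \<delta> < (\<Sum>m\<in>F k. (cmod (l2inner M2 (g k) (\<psi> k m)))\<^sup>2)" by metis
  have coeff: "l2inner (M1 \<Otimes>\<^sub>M M2) u (case i of (k, m) \<Rightarrow> \<lambda>(x, t). \<phi> k x * \<psi> k m t)
      = (case i of (k, m) \<Rightarrow> l2inner M2 (g k) (\<psi> k m))" for i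
    by (cases i) (simp add: l2inner_product[OF u] g_def[abs_def] orthonormal_system_L2[OF on1] orthonormal_system_L2[OF on2])
  have "(l2norm (M1 \<Otimes>\<^sub>M M2) u)\<^sup>2 - \<epsilon> < (\<Sum>k<n. (l2norm M2 (g k))\<^sup>2) - \<epsilon> / 2" using n by simp
  also have "\<dots> \<le> (\<Sum>k<n. (l2norm M2 (g k))\<^sup>2) - real n * \<delta>"
    using e by (simp add: \<delta>_def field_simps)
  also have "\<dots> = (\<Sum>k<n. (l2norm M2 (g k))\<^sup>2 - \<delta>)" by (simp add: sum_subtractf)
  also have "\<dots> \<le> (\<Sum>k<n. \<Sum>m\<in>F k. (cmod (l2inner M2 (g k) (\<psi> k m)))\<^sup>2)"
    by (rule sum_mono) (use F(2) less_imp_le in blast)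
  also have "\<dots> = (\<Sum>(k, m)\<in>Sigma {..<n} F. (cmod (l2inner M2 (g k) (\<psi> k m)))\<^sup>2)"
    by (rule sum.Sigma) (use F(1) in auto)
  also have "\<dots> = (\<Sum>i\<in>Sigma {..<n} F.
      (cmod (l2inner (M1 \<Otimes>\<^sub>M M2) u (case i of (k, m) \<Rightarrow> \<lambda>(x, t). \<phi> k x * \<psi> k m t)))\<^sup>2)"
    unfolding coeff by (rule sum.cong) auto
  finally show "\<exists>F. finite F \<and> (l2norm (M1 \<Otimes>\<^sub>M M2) u)\<^sup>2 - \<epsilon>
      < (\<Sum>i\<in>F. (cmod (l2inner (M1 \<Otimes>\<^sub>M M2) u (case i of (k, m) \<Rightarrow> \<lambda>(x, t). \<phi> k x * \<psi> k m t)))\<^sup>2)"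
    using F(1) by (intro exI[of _ "Sigma {..<n} F"]) auto
qed

end

section \<open>Derivatives of functions with values in $L_2$\<close>

lemma has_vector_derivative_iff_quotient:
  fixes f :: "real \<Rightarrow> complex"
  shows "(f has_vector_derivative d) (at t within S) \<longleftrightarrow>
    ((\<lambda>s. (f s - f t) / of_real (s - t)) \<longlongrightarrow> d) (at t within S)"
  unfolding has_vector_derivative_complex_iff has_field_derivative_iff
    tendsto_complex_iff[of "\<lambda>s. (f s - f t) / of_real (s - t)"]
  by (simp only: Re_divide_of_real Im_divide_of_real minus_complex.simps)

lemma has_l2_derivative_product:
  assumes \<phi>: "\<phi> \<in> L2 M" and v: "(v has_vector_derivative d) (at t within S)"
  shows "has_l2_derivative M (\<lambda>s x. \<phi> x * v s) (\<lambda>x. \<phi> x * d) t S"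
  unfolding has_l2_derivative_def
proof (intro conjI ballI)
  show "(\<lambda>x. \<phi> x * v s) \<in> L2 M" for s using L2_mult_left[OF \<phi>, of "v s"] by (simp add: mult.commute)
  show "(\<lambda>x. \<phi> x * d) \<in> L2 M" using L2_mult_left[OF \<phi>, of d] by (simp add: mult.commute)
  have "((\<lambda>s. cmod ((v s - v t) / of_real (s - t) - d) * l2norm M \<phi>) \<longlongrightarrow> cmod (d - d) * l2norm M \<phi>) (at t within S)"
    by (intro tendsto_mult tendsto_norm tendsto_diff tendsto_const v[unfolded has_vector_derivative_iff_quotient])
  moreover have "l2norm M (\<lambda>x. (\<phi> x * v s - \<phi> x * v t) / of_real (s - t) - \<phi> x * d)
      = cmod ((v s - v t) / of_real (s - t) - d) * l2norm M \<phi>" for s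
    unfolding l2norm_mult_left[symmetric]
    by (simp add: left_diff_distrib right_diff_distrib diff_divide_distrib mult.commute)
  ultimately show "((\<lambda>s. l2norm M (\<lambda>x. (\<phi> x * v s - \<phi> x * v t) / of_real (s - t) - \<phi> x * d)) \<longlongrightarrow> 0) (at t within S)"
    by simp
qed

text \<open>A coefficient of a difference quotient differs from that of the derivative by at most the norm
  of the difference, by Bessel's inequality.\<close>
lemma has_l2_derivative_inner:
  assumes U: "has_l2_derivative M U w t S" and t: "t \<in> S" and on: "orthonormal_system M \<phi>"
  shows "((\<lambda>s. l2inner M (U s) (\<phi> k)) has_vector_derivative l2inner M w (\<phi> k)) (at t within S)"
proof -
  have L: "\<And>s. s \<in> S \<Longrightarrow> U s \<in> L2 M" and w: "w \<in> L2 M"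
    and lim: "((\<lambda>s. l2norm M (\<lambda>x. (U s x - U t x) / of_real (s - t) - w x)) \<longlongrightarrow> 0) (at t within S)"
    using U unfolding has_l2_derivative_def by blast+
  note \<phi> = orthonormal_system_L2[OF on, of k]
  have bound: "cmod ((l2inner M (U s) (\<phi> k) - l2inner M (U t) (\<phi> k)) / of_real (s - t) - l2inner M w (\<phi> k))
      \<le> l2norm M (\<lambda>x. (U s x - U t x) / of_real (s - t) - w x)" if "s \<in> S" for s
  proof -
    define c :: complex where "c = 1 / of_real (s - t)"
    have d: "(\<lambda>x. U s x - U t x) \<in> L2 M" by (rule L2_diff[OF L[OF that] L[OF t]])
    have q: "(\<lambda>x. (U s x - U t x) / of_real (s - t) - w x) = (\<lambda>x. c * (U s x - U t x) - w x)"
      by (simp add: c_def)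
    have "l2inner M (\<lambda>x. c * (U s x - U t x) - w x) (\<phi> k)
        = c * (l2inner M (U s) (\<phi> k) - l2inner M (U t) (\<phi> k)) - l2inner M w (\<phi> k)"
      by (simp only: l2inner_diff_left[OF L2_mult_left[OF d] w \<phi>] l2inner_mult_left
          l2inner_diff_left[OF L[OF that] L[OF t] \<phi>])
    moreover have "cmod (l2inner M (\<lambda>x. c * (U s x - U t x) - w x) (\<phi> k))
        \<le> l2norm M (\<lambda>x. c * (U s x - U t x) - w x)"
      by (rule cmod_l2inner_le[OF on L2_diff[OF L2_mult_left[OF d] w]])
    ultimately show ?thesis unfolding q by (simp add: c_def)
  qed
  have "((\<lambda>s. (l2inner M (U s) (\<phi> k) - l2inner M (U t) (\<phi> k)) / of_real (s - t) - l2inner M w (\<phi> k)) \<longlongrightarrow> 0)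
      (at t within S)"
    by (rule Lim_null_comparison[OF _ lim]) (use bound in \<open>auto simp: eventually_at_filter\<close>)
  then show ?thesis unfolding has_vector_derivative_iff_quotient by (rule LIM_zero_cancel)
qed

section \<open>The two spectral problems\<close>

lemma self_adjoint_symmetric:
  assumes "self_adjoint M D A" "f \<in> D" "g \<in> D"
  shows "l2inner M (A f) g = l2inner M f (A g)"
proof -
  have "linear_operator M D A" using assms(1) unfolding self_adjoint_def by blast
  then have L: "g \<in> L2 M" "A g \<in> L2 M" using assms(3) unfolding linear_operator_def by blast+
  then have "\<forall>f\<in>D. l2inner M (A f) g = l2inner M f (A g)"
    using assms(1,3) unfolding self_adjoint_def by auto
  then show ?thesis using assms(2) by blast
qed

lemma l2inner_eigenfunction:
  assumes sa: "self_adjoint M D A" and f: "f \<in> D" and \<phi>: "\<phi> \<in> D"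
    and eig: "AE x in M. A \<phi> x = of_real \<mu> * \<phi> x"
  shows "l2inner M (A f) \<phi> = of_real \<mu> * l2inner M f \<phi>"
proof -
  have lin: "linear_operator M D A" using sa unfolding self_adjoint_def by blast
  then have L: "f \<in> L2 M" "\<phi> \<in> L2 M" "A \<phi> \<in> L2 M" using f \<phi> unfolding linear_operator_def by blast+
  have "l2inner M (A \<phi>) f = l2inner M (\<lambda>x. of_real \<mu> * \<phi> x) f"
    by (rule l2inner_cong_AE) (use L L2_mult_left[OF L(2)] eig in \<open>auto intro: L2_measurable\<close>)
  then have "cnj (l2inner M (A \<phi>) f) = of_real \<mu> * cnj (l2inner M \<phi> f)"
    by (simp add: l2inner_mult_left)
  then show ?thesis unfolding l2inner_cnj self_adjoint_symmetric[OF sa f \<phi>] .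
qed

lemma leb_Times:
  fixes \<Omega> :: "'a::euclidean_space set"
  assumes "open \<Omega>"
  shows "leb (\<Omega> \<times> {0<..<1::real}) = leb \<Omega> \<Otimes>\<^sub>M leb {0<..<1}"
proof -
  have "leb \<Omega> \<Otimes>\<^sub>M leb {0<..<1} = restrict_space (lborel \<Otimes>\<^sub>M lborel) (\<Omega> \<times> {0<..<1::real})"
    by (rule restrict_pair_measure[OF lborel.sigma_finite_measure_axioms lborel.sigma_finite_measure_axioms])
       (use assms in auto)
  then show ?thesis unfolding lborel_prod by simp
qed

lemma pair_sigma_finite_leb:
  fixes \<Omega> :: "'a::euclidean_space set"
  assumes "open \<Omega>"
  shows "pair_sigma_finite (leb \<Omega>) (leb {0<..<1::real})"
proof (rule pair_sigma_finite.intro)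
  show "sigma_finite_measure (leb \<Omega>)" "sigma_finite_measure (leb {0<..<1::real})"
    by (rule sigma_finite_measure_restrict_space[OF lborel.sigma_finite_measure_axioms], use assms in simp)+
qed

lemma eigenfunction_product:
  fixes \<Omega> :: "(real ^ 'n) set"
  assumes \<Omega>: "open \<Omega>" and lin: "linear_operator (leb \<Omega>) D A"
    and \<phi>: "\<phi> \<in> D" "AE x in leb \<Omega>. A \<phi> x = of_real \<mu> * \<phi> x" "l2norm (leb \<Omega>) \<phi> \<noteq> 0"
    and v: "v \<in> L2 (leb {0<..<1})" "l2norm (leb {0<..<1}) v \<noteq> 0" and ode: "nonzero_ode_solution \<mu> \<kappa> v"
  shows "eigenfunction \<Omega> D A \<kappa> (\<lambda>(x, t). \<phi> x * v t)"
proof -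
  interpret pair_sigma_finite "leb \<Omega>" "leb {0<..<1::real}" by (rule pair_sigma_finite_leb[OF \<Omega>])
  let ?P = "leb \<Omega> \<Otimes>\<^sub>M leb {0<..<1::real}"
  let ?u = "\<lambda>(x, t). \<phi> x * v t"
  have \<phi>L: "\<phi> \<in> L2 (leb \<Omega>)" using lin \<phi>(1) unfolding linear_operator_def by blast
  have uL: "?u \<in> L2 ?P" by (rule L2_product[OF \<phi>L v(1)])
  have nonzero: "\<not> (AE p in ?P. ?u p = 0)"
  proof
    assume "AE p in ?P. ?u p = 0"
    then have "l2norm ?P ?u = l2norm ?P (\<lambda>_. 0)"
      by (intro l2norm_cong_AE L2_measurable[OF uL]) auto
    then have "0 = (LINT t|leb {0<..<1}. (l2norm (leb \<Omega>) (\<lambda>x. ?u (x, t)))\<^sup>2)"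
      using L2_section(3)[OF uL] by (simp add: l2norm_def)
    also have "(\<lambda>t. (l2norm (leb \<Omega>) (\<lambda>x. ?u (x, t)))\<^sup>2) = (\<lambda>t. (cmod (v t))\<^sup>2 * (l2norm (leb \<Omega>) \<phi>)\<^sup>2)"
      using l2norm_mult_left[of "leb \<Omega>" "v t" \<phi> for t] by (simp add: mult.commute power_mult_distrib)
    also have "(LINT t|leb {0<..<1}. (cmod (v t))\<^sup>2 * (l2norm (leb \<Omega>) \<phi>)\<^sup>2)
        = (l2norm (leb {0<..<1}) v)\<^sup>2 * (l2norm (leb \<Omega>) \<phi>)\<^sup>2"
      by (simp add: l2norm_squared)
    finally show False using \<phi>(3) v(2) by simp
  qed
  obtain v' v'' where v': "\<forall>t\<in>{0..<1}. (v has_vector_derivative v' t) (at t within {0..<1})"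
    and v'': "\<forall>t\<in>{0<..<1}. (v' has_vector_derivative v'' t) (at t)"
    and eq: "\<forall>t\<in>{0<..<1}. v'' t - of_real \<mu> * v t = \<kappa> * v (1 - t)"
    and init: "v 0 = 0" "v' 0 = 0"
    using ode unfolding nonzero_ode_solution_def by (elim conjE exE)
  have D: "(\<lambda>x. \<phi> x * c) \<in> D \<and> (AE x in leb \<Omega>. A (\<lambda>x. \<phi> x * c) x = c * A \<phi> x)" for c
  proof -
    have "(\<lambda>x. c * \<phi> x + 0 * \<phi> x) \<in> D \<and>
        (AE x in leb \<Omega>. A (\<lambda>x. c * \<phi> x + 0 * \<phi> x) x = c * A \<phi> x + 0 * A \<phi> x)"
      using lin \<phi>(1) unfolding linear_operator_def by blast
    then show ?thesis by (simp add: mult.commute)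
  qed
  show ?thesis
    unfolding eigenfunction_def leb_Times[OF \<Omega>]
  proof (intro conjI exI ballI)
    show "has_l2_derivative (leb \<Omega>) (\<lambda>s x. ?u (x, s)) (\<lambda>x. \<phi> x * v' t) t {0..<1}" if "t \<in> {0..<1}" for t
      using has_l2_derivative_product[OF \<phi>L bspec[OF v' that]] by simp
    show "has_l2_derivative (leb \<Omega>) (\<lambda>t x. \<phi> x * v' t) (\<lambda>x. \<phi> x * v'' t) t {0<..<1}" if "t \<in> {0<..<1}" for t
      by (rule has_l2_derivative_product[OF \<phi>L has_vector_derivative_at_within[OF bspec[OF v'' that]]])
    fix t :: real assume t: "t \<in> {0<..<1}"
    show "(\<lambda>x. ?u (x, t)) \<in> D" using D[of "v t"] by simp
    show "AE x in leb \<Omega>. \<phi> x * v'' t - A (\<lambda>x. ?u (x, t)) x = \<kappa> * ?u (x, 1 - t)"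
      using D[of "v t", THEN conjunct2] \<phi>(2)
    proof eventually_elim
      case (elim x)
      have "v'' t = of_real \<mu> * v t + \<kappa> * v (1 - t)" using bspec[OF eq t] by (simp add: algebra_simps)
      then show ?case using elim by (simp add: algebra_simps)
    qed
  qed (use uL nonzero init in auto)
qed

text \<open>Take \<open>f = (u(\<cdot>, t), \<phi> k)\<close>. Symmetry of the operator moves it to \<open>\<phi> k\<close>, where it becomes
  multiplication by \<open>\<mu> k\<close>. If all these functions vanished for \<open>0 < t < 1\<close>, completeness of \<open>\<phi>\<close> would
  make every section of \<open>u\<close>, and hence \<open>u\<close>, zero almost everywhere.\<close>
theorem eigenfunction_projection:
  fixes \<Omega> :: "(real ^ 'n) set" and \<phi> :: "'i \<Rightarrow> real ^ 'n \<Rightarrow> complex"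
  assumes \<Omega>: "open \<Omega>" and sa: "self_adjoint (leb \<Omega>) D A"
    and \<phi>: "complete_orthonormal_system (leb \<Omega>) \<phi>"
    and eig: "\<And>k. \<phi> k \<in> D" "\<And>k. AE x in leb \<Omega>. A (\<phi> k) x = of_real (\<mu> k) * \<phi> k x"
    and u: "eigenfunction \<Omega> D A \<kappa> u"
  shows "\<exists>k f f'. (\<forall>t\<in>{0<..<1}. (f has_vector_derivative f' t) (at t)) \<and>
    (\<forall>t\<in>{0<..<1}. (f' has_vector_derivative of_real (\<mu> k) * f t + \<kappa> * f (1 - t)) (at t)) \<and>
    f 0 = 0 \<and> (f has_vector_derivative 0) (at 0 within {0..<1}) \<and> (\<exists>t\<in>{0<..<1}. f t \<noteq> 0)"
proof -
  let ?M = "leb \<Omega>"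
  interpret pair_sigma_finite ?M "leb {0<..<1::real}" by (rule pair_sigma_finite_leb[OF \<Omega>])
  let ?P = "?M \<Otimes>\<^sub>M leb {0<..<1::real}"
  have on: "orthonormal_system ?M \<phi>" by (rule complete_orthonormal_system_imp[OF \<phi>])
  have lin: "linear_operator ?M D A" using sa unfolding self_adjoint_def by blast
  obtain w z where uL: "u \<in> L2 ?P" and u_nz: "\<not> (AE p in ?P. u p = 0)"
    and w: "\<forall>t\<in>{0..<1}. has_l2_derivative ?M (\<lambda>s x. u (x, s)) (w t) t {0..<1}"
    and z: "\<forall>t\<in>{0<..<1}. has_l2_derivative ?M w (z t) t {0<..<1}"
    and eq: "\<forall>t\<in>{0<..<1}. (\<lambda>x. u (x, t)) \<in> D \<and>
           (AE x in ?M. z t x - A (\<lambda>x. u (x, t)) x = \<kappa> * u (x, 1 - t))"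
    and init: "AE x in ?M. u (x, 0) = 0" "AE x in ?M. w 0 x = 0"
    using u unfolding eigenfunction_def leb_Times[OF \<Omega>] by (elim conjE exE)
  have U: "(\<lambda>x. u (x, t)) \<in> L2 ?M" if "t \<in> {0..<1}" for t
    using bspec[OF w that] that unfolding has_l2_derivative_def by blast
  have W: "w t \<in> L2 ?M" if "t \<in> {0..<1}" for t
    using bspec[OF w that] unfolding has_l2_derivative_def by blast
  have Z: "z t \<in> L2 ?M" if "t \<in> {0<..<1}" for t
    using bspec[OF z that] unfolding has_l2_derivative_def by blast
  define f where "f k t = l2inner ?M (\<lambda>x. u (x, t)) (\<phi> k)" for k t
  define f' where "f' k t = l2inner ?M (w t) (\<phi> k)" for k t
  have null: "l2inner ?M g (\<phi> k) = 0" if "g \<in> L2 ?M" "AE x in ?M. g x = 0" for g k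
  proof -
    have "l2inner ?M g (\<phi> k) = l2inner ?M (\<lambda>_. 0) (\<phi> k)"
      by (rule l2inner_cong_AE) (use that L2_measurable orthonormal_system_L2[OF on] in auto)
    then show ?thesis by (simp add: l2inner_def)
  qed
  have df: "(f k has_vector_derivative f' k t) (at t within {0..<1})" if "t \<in> {0..<1}" for k t
    unfolding f_def[abs_def] f'_def by (rule has_l2_derivative_inner[OF bspec[OF w that] that on])
  have f'0: "f' k 0 = 0" for k unfolding f'_def by (rule null[OF W init(2)]) simp
  have d1: "(f k has_vector_derivative f' k t) (at t)" if t: "t \<in> {0<..<1}" for k t
  proof -
    have "at t within {0..<1} = at t" by (rule at_within_interior) (use t in simp)
    then show ?thesis using df[of t k] t by simp
  qed
  have d2: "(f' k has_vector_derivative of_real (\<mu> k) * f k t + \<kappa> * f k (1 - t)) (at t)"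
    if t: "t \<in> {0<..<1}" for k t
  proof -
    have "(f' k has_vector_derivative l2inner ?M (z t) (\<phi> k)) (at t within {0<..<1})"
      unfolding f'_def[abs_def] by (rule has_l2_derivative_inner[OF bspec[OF z t] t on])
    then have d: "(f' k has_vector_derivative l2inner ?M (z t) (\<phi> k)) (at t)"
      using t at_within_open[OF t open_greaterThanLessThan] by simp
    have ut: "(\<lambda>x. u (x, t)) \<in> D" using bspec[OF eq t] by blast
    then have AL: "A (\<lambda>x. u (x, t)) \<in> L2 ?M" using lin unfolding linear_operator_def by blast
    have t': "1 - t \<in> {0..<1}" using t by auto
    note \<phi>L = orthonormal_system_L2[OF on, of k]
    have R: "(\<lambda>x. A (\<lambda>x. u (x, t)) x + \<kappa> * u (x, 1 - t)) \<in> L2 ?M"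
      by (intro L2_add AL L2_mult_left U t')
    have "AE x in ?M. z t x = A (\<lambda>x. u (x, t)) x + \<kappa> * u (x, 1 - t)"
      using bspec[OF eq t, THEN conjunct2] by eventually_elim (simp add: algebra_simps)
    then have "l2inner ?M (z t) (\<phi> k) = l2inner ?M (\<lambda>x. A (\<lambda>x. u (x, t)) x + \<kappa> * u (x, 1 - t)) (\<phi> k)"
      by (rule l2inner_cong_AE[OF L2_measurable[OF Z[OF t]] L2_measurable[OF R] L2_measurable[OF \<phi>L]])
    also have "\<dots> = l2inner ?M (A (\<lambda>x. u (x, t))) (\<phi> k) + \<kappa> * f k (1 - t)"
      unfolding f_def by (simp only: l2inner_add_left[OF AL L2_mult_left[OF U[OF t']] \<phi>L] l2inner_mult_left)
    also have "l2inner ?M (A (\<lambda>x. u (x, t))) (\<phi> k) = of_real (\<mu> k) * f k t"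
      unfolding f_def by (rule l2inner_eigenfunction[OF sa ut eig])
    finally show ?thesis using d by simp
  qed
  have "\<exists>k. \<exists>t\<in>{0<..<1}. f k t \<noteq> 0"
  proof (rule ccontr)
    assume "\<not> ?thesis"
    then have f0: "f k t = 0" if "t \<in> {0<..<1}" for k t using that by blast
    have "l2norm ?M (\<lambda>x. u (x, t)) = 0" if t: "t \<in> {0<..<1}" for t
    proof -
      have tt: "t \<in> {0..<1}" using t by auto
      have "AE x in ?M. u (x, t) = 0"
        by (rule complete_orthogonal_zero[OF \<phi> U[OF tt]]) (use f0[OF t] in \<open>simp add: f_def\<close>)
      then have "l2norm ?M (\<lambda>x. u (x, t)) = l2norm ?M (\<lambda>_. 0)"
        by (intro l2norm_cong_AE L2_measurable[OF U[OF tt]]) auto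
      then show ?thesis by (simp add: l2norm_def)
    qed
    then have "(LINT t|leb {0<..<1}. (l2norm ?M (\<lambda>x. u (x, t)))\<^sup>2) = (LINT t|leb {0<..<1::real}. 0)"
      by (intro Bochner_Integration.integral_cong) (auto simp: space_restrict_space)
    then have "l2norm ?P u = 0" unfolding L2_section(3)[OF uL] by simp
    then show False using l2norm_zero_AE[OF uL] u_nz by blast
  qed
  then obtain k where nz: "\<exists>t\<in>{0<..<1}. f k t \<noteq> 0" by blast
  have f0: "f k 0 = 0" unfolding f_def by (rule null[OF U init(1)]) simp
  have d0: "(f k has_vector_derivative 0) (at 0 within {0..<1})" using df[of 0 k] f'0[of k] by simp
  show ?thesis using d1 d2 f0 d0 nz by (intro exI[of _ k] exI[of _ "f k"] exI[of _ "f' k"] conjI ballI) auto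
qed

text \<open>If \<open>\<mu>\<close> were bounded, compactness of the resolvent would give \<open>\<phi>\<close> a convergent subsequence, but
  distinct members of an orthonormal system have distance \<open>sqrt 2\<close>.\<close>
lemma eigenvalues_unbounded:
  assumes cr: "compact_resolvent M D A" and lin: "linear_operator M D A" and mono: "mono \<mu>"
    and on: "orthonormal_system M \<phi>"
    and eig: "\<And>k. \<phi> k \<in> D" "\<And>k. AE x in M. A (\<phi> k) x = of_real (\<mu> k) * \<phi> k x"
    and pos: "\<And>k. 0 \<le> \<mu> k"
  shows "filterlim \<mu> at_top sequentially"
proof -
  have "\<exists>k. \<mu> k > B" for B
  proof (rule ccontr)
    assume "\<not> ?thesis"
    then have B: "\<mu> k \<le> B" for k by (simp add: not_less)
    obtain \<zeta> where \<zeta>: "\<forall>u :: nat \<Rightarrow> 'a \<Rightarrow> complex.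
           (\<forall>j. u j \<in> D) \<and> (\<exists>C. \<forall>j. l2norm M (\<lambda>x. A (u j) x - \<zeta> * u j x) \<le> C) \<longrightarrow>
           (\<exists>r g. strict_mono r \<and> g \<in> L2 M \<and>
              (\<lambda>j. l2norm M (\<lambda>x. u (r j) x - g x)) \<longlonglongrightarrow> 0)"
      using cr unfolding compact_resolvent_def by (elim exE conjE)
    have bound: "l2norm M (\<lambda>x. A (\<phi> j) x - \<zeta> * \<phi> j x) \<le> B + cmod \<zeta>" for j
    proof -
      have \<phi>L: "\<phi> j \<in> L2 M" by (rule orthonormal_system_L2[OF on])
      have AL: "A (\<phi> j) \<in> L2 M" using lin eig(1) unfolding linear_operator_def by blast
      have "l2norm M (\<lambda>x. A (\<phi> j) x - \<zeta> * \<phi> j x) = l2norm M (\<lambda>x. (of_real (\<mu> j) - \<zeta>) * \<phi> j x)"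
      proof (rule l2norm_cong_AE)
        show "AE x in M. A (\<phi> j) x - \<zeta> * \<phi> j x = (of_real (\<mu> j) - \<zeta>) * \<phi> j x"
          using eig(2)[of j] by eventually_elim (simp add: left_diff_distrib)
      qed (intro L2_measurable L2_diff L2_mult_left \<phi>L AL)+
      also have "\<dots> = cmod (of_real (\<mu> j) - \<zeta>)"
        unfolding l2norm_mult_left orthonormal_system_l2norm[OF on] by simp
      also have "\<dots> \<le> \<bar>\<mu> j\<bar> + cmod \<zeta>" using norm_triangle_ineq4[of "of_real (\<mu> j)" \<zeta>] by simp
      finally show ?thesis using B[of j] pos[of j] by simp
    qed
    obtain r g where r: "strict_mono (r :: nat \<Rightarrow> nat)" and g: "g \<in> L2 M"
      and lim: "(\<lambda>j. l2norm M (\<lambda>x. \<phi> (r j) x - g x)) \<longlonglongrightarrow> 0"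
      using \<zeta>[rule_format, of \<phi>] eig(1) bound by blast
    from order_tendstoD(2)[OF lim, of "1 / 2"]
    obtain N where N: "\<And>j. j \<ge> N \<Longrightarrow> l2norm M (\<lambda>x. \<phi> (r j) x - g x) < 1 / 2"
      by (auto simp: eventually_sequentially)
    have "r N \<noteq> r (Suc N)" using strict_mono_less[OF r, of N "Suc N"] by simp
    then have "(l2norm M (\<lambda>x. \<phi> (r N) x - (\<Sum>i\<in>{r (Suc N)}. 1 * \<phi> i x)))\<^sup>2 = 2"
      using l2norm_diff_sum_squared[OF on orthonormal_system_L2[OF on], of "{r (Suc N)}" "r N" "\<lambda>_. 1"] on
      by (simp add: orthonormal_system_l2norm[OF on] orthonormal_system_def)
    then have "2 = (l2norm M (\<lambda>x. (\<phi> (r N) x - g x) + (-1) * (\<phi> (r (Suc N)) x - g x)))\<^sup>2"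
      by (simp add: algebra_simps)
    also have "\<dots> \<le> 2 * (l2norm M (\<lambda>x. \<phi> (r N) x - g x))\<^sup>2
        + 2 * (l2norm M (\<lambda>x. (-1) * (\<phi> (r (Suc N)) x - g x)))\<^sup>2"
      by (intro l2norm_add_squared_le L2_diff L2_mult_left orthonormal_system_L2[OF on] g)
    also have "\<dots> = 2 * (l2norm M (\<lambda>x. \<phi> (r N) x - g x))\<^sup>2 + 2 * (l2norm M (\<lambda>x. \<phi> (r (Suc N)) x - g x))\<^sup>2"
      unfolding l2norm_mult_left by simp
    also have "\<dots> < 2 * (1 / 2)\<^sup>2 + 2 * (1 / 2)\<^sup>2"
      using power_strict_mono[OF N[of N] l2norm_nonneg, of 2] power_strict_mono[OF N[of "Suc N"] l2norm_nonneg, of 2]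
      by simp
    finally show False by (simp add: power2_eq_square)
  qed
  then have "\<exists>k. \<forall>n\<ge>k. B \<le> \<mu> n" for B
    using monoD[OF mono] by (meson less_imp_le order_trans)
  then show ?thesis by (simp add: filterlim_at_top eventually_sequentially)
qed

theorem theorem1:
  fixes \<Omega> :: "(real ^ 'n) set"
    and D :: "(real ^ 'n \<Rightarrow> complex) set"
    and A :: "(real ^ 'n \<Rightarrow> complex) \<Rightarrow> real ^ 'n \<Rightarrow> complex"
    and \<mu> :: "nat \<Rightarrow> real"
    and \<phi> :: "nat \<Rightarrow> real ^ 'n \<Rightarrow> complex"
  assumes "smooth_bounded_domain \<Omega>"
    and "self_adjoint (leb \<Omega>) D A"
    and "compact_resolvent (leb \<Omega>) D A"
    and "\<And>f. f \<in> D \<Longrightarrow> Re (l2inner (leb \<Omega>) (A f) f) \<ge> (l2norm (leb \<Omega>) f)\<^sup>2"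
    and "mono \<mu>"
    and "complete_orthonormal_system (leb \<Omega>) \<phi>"
    and "lists_eigenvalues (leb \<Omega>) D A \<mu> \<phi>"
  shows "\<exists>(v :: nat \<Rightarrow> nat \<Rightarrow> real \<Rightarrow> complex) (\<kappa> :: nat \<Rightarrow> nat \<Rightarrow> complex).
    (\<forall>k m. nonzero_ode_solution (\<mu> k) (\<kappa> k m) (v k m)) \<and>
    (\<forall>k m. eigenfunction \<Omega> D A (\<kappa> k m) (\<lambda>(x, t). \<phi> k x * v k m t)) \<and>
    complete_orthonormal_system (leb (\<Omega> \<times> {0<..<1}))
      (\<lambda>(k, m) (x, t). \<phi> k x * v k m t) \<and>
    {\<kappa>'. \<exists>u. eigenfunction \<Omega> D A \<kappa>' u} = {\<kappa> k m | k m. True} \<and>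
    (\<forall>k m. cmod (\<kappa> k 0) \<le> cmod (\<kappa> k m)) \<and>
    (\<exists>\<epsilon> :: nat \<Rightarrow> complex. \<epsilon> \<longlonglongrightarrow> 0 \<and>
       (\<forall>k. \<kappa> k 0 = of_real (4 * \<mu> k * exp (- sqrt (\<mu> k))) * (1 + \<epsilon> k)))"
proof -
  let ?M = "leb \<Omega>" and ?I = "leb {0<..<1::real}"
  note sa = assms(2) and \<phi> = assms(6)
  have \<Omega>: "open \<Omega>" using assms(1) unfolding smooth_bounded_domain_def by blast
  have lin: "linear_operator ?M D A" using sa unfolding self_adjoint_def by blast
  have on: "orthonormal_system ?M \<phi>" by (rule complete_orthonormal_system_imp[OF \<phi>])
  have eig: "\<phi> k \<in> D" "AE x in ?M. A (\<phi> k) x = of_real (\<mu> k) * \<phi> k x" for k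
    using assms(7) unfolding lists_eigenvalues_def by blast+
  have \<mu>1: "1 \<le> \<mu> k" for k
  proof -
    have "l2inner ?M (A (\<phi> k)) (\<phi> k) = of_real (\<mu> k)"
      using l2inner_eigenfunction[OF sa eig(1) eig, of k k] on by (simp add: orthonormal_system_def)
    then show ?thesis
      using assms(4)[OF eig(1)[of k]] by (simp add: orthonormal_system_l2norm[OF on])
  qed
  define s where "s k = sqrt (\<mu> k)" for k
  have s: "s k > 0" "s k \<noteq> 0" "(s k)\<^sup>2 = \<mu> k" for k
    using \<mu>1[of k] by (simp_all add: s_def)
  have "\<exists>v \<rho>. eigenbasis (reflected_volterra (s k)) v \<rho>" for k
    by (rule reflected_volterra_eigenbasis[OF s(2)])
  then obtain v \<rho> where eb: "\<And>k. eigenbasis (reflected_volterra (s k)) (v k) (\<rho> k)" by metis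
  define V where "V k m t = complex_of_real (fn (v k m) t)" for k m t
  define \<kappa> where "\<kappa> k m = complex_of_real (1 / \<rho> k m)" for k m
  have Vc: "complete_orthonormal_system ?I (V k)" for k
    unfolding V_def[abs_def] by (rule eigenbasis_complete[OF s(2) eb])
  note Von = complete_orthonormal_system_imp[OF Vc]
  have ode: "nonzero_ode_solution (\<mu> k) (\<kappa> k m) (V k m)" for k m
    using eigenbasis_nonzero_ode_solution[OF s(2) eb, of k m] unfolding V_def[abs_def] \<kappa>_def s(3) .
  have pde: "eigenfunction \<Omega> D A (\<kappa> k m) (\<lambda>(x, t). \<phi> k x * V k m t)" for k m
    by (rule eigenfunction_product[OF \<Omega> lin eig _ _ _ ode])
       (simp_all add: orthonormal_system_l2norm[OF on] orthonormal_system_l2norm[OF Von] orthonormal_system_L2[OF Von])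
  have complete: "complete_orthonormal_system (leb (\<Omega> \<times> {0<..<1})) (\<lambda>(k, m) (x, t). \<phi> k x * V k m t)"
    unfolding leb_Times[OF \<Omega>]
    by (rule pair_sigma_finite.complete_orthonormal_system_product[OF pair_sigma_finite_leb[OF \<Omega>] \<phi> Vc])
  have all: "\<exists>k m. \<kappa>' = \<kappa> k m" if ef: "eigenfunction \<Omega> D A \<kappa>' u" for \<kappa>' u
  proof -
    obtain k f f' where f: "\<forall>t\<in>{0<..<1}. (f has_vector_derivative f' t) (at t)"
      "\<forall>t\<in>{0<..<1}. (f' has_vector_derivative of_real (\<mu> k) * f t + \<kappa>' * f (1 - t)) (at t)"
      "f 0 = 0" "(f has_vector_derivative 0) (at 0 within {0..<1})" "\<exists>t\<in>{0<..<1}. f t \<noteq> 0"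
      using eigenfunction_projection[OF \<Omega> sa \<phi> eig ef] by (elim exE conjE)
    have "\<exists>m. \<kappa>' = of_real (1 / \<rho> k m)"
      by (rule ode_eigenvalue_cases[OF s(2) eb bspec[OF f(1)] _ f(3-5)]) (use f(2) s(3) in simp_all)
    then show ?thesis unfolding \<kappa>_def by blast
  qed
  have smallest: "cmod (\<kappa> k 0) \<le> cmod (\<kappa> k m)" for k m
  proof -
    have "norm (reflected_volterra (s k) (v k m)) \<le> \<bar>\<rho> k 0\<bar> * norm (v k m)"
      using eb[of k] unfolding eigenbasis_def by blast
    then have "\<bar>\<rho> k m\<bar> \<le> \<bar>\<rho> k 0\<bar>"
      by (simp add: eigenbasis_eq[OF s(2) eb] eigenbasis_norm[OF s(2) eb])
    then show ?thesis
      using eigenbasis_nonzero[OF s(2) eb, of k m] by (simp add: \<kappa>_def norm_divide frac_le)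
  qed
  define \<epsilon> where "\<epsilon> k = \<kappa> k 0 / of_real (4 * \<mu> k * exp (- sqrt (\<mu> k))) - 1" for k
  have "filterlim \<mu> at_top sequentially"
    by (rule eigenvalues_unbounded[OF assms(3) lin assms(5) on eig]) (use \<mu>1 order_trans zero_le_one in blast)
  then have s_lim: "filterlim s at_top sequentially"
    unfolding s_def[abs_def] by (rule filterlim_compose[OF sqrt_at_top])
  have "(\<lambda>k. complex_of_real (1 / \<rho> k 0 / (4 * (s k)\<^sup>2 * exp (- s k))) - 1) \<longlonglongrightarrow> of_real 1 - 1"
    by (rule tendsto_diff[OF tendsto_of_real[OF eigenvalue_asymptotics[OF s(1) s_lim eb]] tendsto_const])
  then have \<epsilon>: "\<epsilon> \<longlonglongrightarrow> 0"
    unfolding \<epsilon>_def[abs_def] \<kappa>_def s(3) by (simp add: s_def)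
  have \<kappa>0: "\<kappa> k 0 = of_real (4 * \<mu> k * exp (- sqrt (\<mu> k))) * (1 + \<epsilon> k)" for k
    using \<mu>1[of k] by (simp add: \<epsilon>_def)
  show ?thesis
    by (intro exI[of _ V] exI[of _ \<kappa>] exI[of _ \<epsilon>] conjI allI ode pde complete smallest \<epsilon> \<kappa>0)
       (use all pde in blast)
qed

end
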